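(* Let $H$ be an infinite-dimensional separable complex Hilbert space, let $A \in C([0,1], L(H))$ have selfadjoint values, and let $d_n\in C([0,1])$, $n\in\mathbb N$. Assume that there are $a, b \in \mathbb R$ such that \[ d_n(t)\in [a, b] \subset \operatorname{Int}_{\mathbb R} \operatorname{conv} \sigma_e(A(t)), \qquad n\in \mathbb N, \ t\in [0,1]. \] Then there exist $(v_n)_{n=1}^{\infty} \subset C([0,1], H)$ such that $(v_n(t))_{n=1}^\infty$ is an orthonormal basis of $H$ for every $t\in[0,1]$ and \[ \langle A(t)v_n(t),v_n(t)\rangle= d_n(t), \qquad n \in \mathbb N, \ t \in [0,1]. \] Moreover, if the sequence $(d_n)_{n=1}^\infty$ is equicontinuous, then $(v_n)_{n=1}^\infty$ can be chosen equicontinuous.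
   Context: $\sigma_e(T)$ is the essential spectrum; $\operatorname{conv}$ is convex hull and $\operatorname{Int}_{\mathbb R}$ is the interior relative to $\mathbb R$; $C([0,1])$ denotes continuous real- or complex-valued functions on $[0,1]$. A family of functions is equicontinuous if all of them admit a common modulus of continuity $\delta$ (non-decreasing, $\delta(0)=\lim_{s\to0+}\delta(s)=0$, $\|f(t)-f(t')\|\le\delta(|t-t'|)$). *)

theory Defs
  imports "HOL-Analysis.Analysis"
begin

class complex_vector = real_vector +
  fixes scaleC :: "complex \<Rightarrow> 'a \<Rightarrow> 'a"  (infixr \<open>*\<^sub>C\<close> 75)
  assumes scaleC_add_right: "a *\<^sub>C (x + y) = a *\<^sub>C x + a *\<^sub>C y"
    and scaleC_add_left: "(a + b) *\<^sub>C x = a *\<^sub>C x + b *\<^sub>C x"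
    and scaleC_scaleC: "a *\<^sub>C (b *\<^sub>C x) = (a * b) *\<^sub>C x"
    and scaleC_one: "1 *\<^sub>C x = x"
    and scaleR_scaleC: "scaleR r = scaleC (complex_of_real r)"

class complex_normed_vector = complex_vector + real_normed_vector +
  assumes norm_scaleC: "norm (a *\<^sub>C x) = cmod a * norm x"

text \<open>A complex inner product on a complex normed space, inducing its norm.
  Convention: conjugate-linear in the first argument, linear in the second.\<close>
definition complex_inner_product :: "('h::complex_normed_vector \<Rightarrow> 'h \<Rightarrow> complex) \<Rightarrow> bool" where
  "complex_inner_product ci \<longleftrightarrow>
     (\<forall>x y z. ci x (y + z) = ci x y + ci x z) \<and>
     (\<forall>c x y. ci x (c *\<^sub>C y) = c * ci x y) \<and>
     (\<forall>x y. ci y x = cnj (ci x y)) \<and>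
     (\<forall>x. norm x = sqrt (Re (ci x x)))"

definition cspan :: "'h::complex_vector set \<Rightarrow> 'h set" where
  "cspan S = {x. \<exists>F c. finite F \<and> F \<subseteq> S \<and> x = (\<Sum>v\<in>F. c v *\<^sub>C v)}"

definition cfinite_dim :: "'h::complex_vector set \<Rightarrow> bool" where
  "cfinite_dim S \<longleftrightarrow> (\<exists>F. finite F \<and> S \<subseteq> cspan F)"

definition separable_space :: "'h::metric_space itself \<Rightarrow> bool" where
  "separable_space _ \<longleftrightarrow> (\<exists>D::'h set. countable D \<and> closure D = UNIV)"

definition clinear_op :: "('h::complex_vector \<Rightarrow> 'h) \<Rightarrow> bool" where
  "clinear_op T \<longleftrightarrow> (\<forall>x y. T (x + y) = T x + T y) \<and> (\<forall>c x. T (c *\<^sub>C x) = c *\<^sub>C T x)"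

definition selfadjoint_op :: "('h \<Rightarrow> 'h \<Rightarrow> complex) \<Rightarrow> ('h \<Rightarrow> 'h) \<Rightarrow> bool" where
  "selfadjoint_op ci T \<longleftrightarrow> (\<forall>x y. ci (T x) y = ci x (T y))"

definition fredholm :: "('h::{complex_normed_vector} \<Rightarrow> 'h) \<Rightarrow> bool" where
  "fredholm T \<longleftrightarrow> closed (range T) \<and> cfinite_dim {x. T x = 0} \<and>
     (\<exists>F. finite F \<and> cspan (range T \<union> F) = UNIV)"

definition essential_spectrum :: "('h::complex_normed_vector \<Rightarrow> 'h) \<Rightarrow> complex set" where
  "essential_spectrum T = {l. \<not> fredholm (\<lambda>x. T x - l *\<^sub>C x)}"

definition orthonormal_basis :: "('h \<Rightarrow> 'h \<Rightarrow> complex) \<Rightarrow> (nat \<Rightarrow> 'h::complex_normed_vector) \<Rightarrow> bool" where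
  "orthonormal_basis ci e \<longleftrightarrow>
     (\<forall>i j. ci (e i) (e j) = (if i = j then 1 else 0)) \<and> closure (cspan (range e)) = UNIV"

definition equicontinuous_on :: "real set \<Rightarrow> (nat \<Rightarrow> real \<Rightarrow> 'b::real_normed_vector) \<Rightarrow> bool" where
  "equicontinuous_on S f \<longleftrightarrow>
     (\<exists>\<delta>::real \<Rightarrow> real. mono_on {0..} \<delta> \<and> \<delta> 0 = 0 \<and> (\<delta> \<longlongrightarrow> 0) (at_right 0) \<and>
        (\<forall>n. \<forall>t\<in>S. \<forall>t'\<in>S. norm (f n t - f n t') \<le> \<delta> \<bar>t - t'\<bar>))"

end

theory Submission
  imports Defs
begin

text \<open>
  By Weyl's criterion a point of \<open>\<sigma>\<^sub>e(A(t))\<close> yields approximate eigenvectors orthogonal to any given finite set;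
  with compactness of \<open>[0,1]\<close> this gives \<open>e > 0\<close> such that outside every finite-dimensional space
  there are, for each \<open>t\<close>, unit vectors with quadratic form \<open>\<ge> b + e\<close> and \<open>\<le> a - e\<close>. Such vectors, taken for the
  points of a fine grid of times, are arranged in the blocks of a constant orthonormal basis. Sweeping rotations inside
  each block join the grid points, so that the first two vectors \<open>P(t), Q(t)\<close> of a block are extremal
  for every \<open>t\<close>, almost \<open>A(t)\<close>-orthogonal to the earlier blocks, and Lipschitz uniformly in the block.

  A remaining basis vector \<open>u\<close> is then used up by an infinite chain of rotations: with \<open>w = cos \<theta> P + sin \<theta> Q\<close>
  from a fresh block, put \<open>v = c u + s w\<close>, where \<open>\<theta>(t)\<close> is chosen such that \<open>v\<close> has the next prescribed
  diagonal entry, and replace \<open>u\<close> by \<open>s u - c w\<close>. The part of \<open>u\<close> orthogonal to all vectors \<open>v\<close> decays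
  like \<open>s\<^sup>k\<close>, so the vectors \<open>v\<close> are complete. The factor \<open>s = sqrt(1 - c\<^sup>2)\<close> contracts the modulus of
  continuity of \<open>u\<close> by about \<open>c\<^sup>2/2\<close>, whereas \<open>u\<close> influences the modulus of \<open>w\<close> only with weight
  \<open>O(c\<^sup>2)\<close> and hence its own successor with weight \<open>O(c\<^sup>3)\<close>. For small \<open>c\<close> all moduli therefore stay
  below a fixed multiple of those of \<open>A\<close> and of the functions \<open>d\<^sub>n\<close>.
\<close>

section \<open>Complex inner product spaces\<close>

lemma scaleC_zero_left [simp]: "0 *\<^sub>C (x::'a::complex_vector) = 0"
  using scaleC_add_left[of 0 0 x] by simp

lemma scaleC_zero_right [simp]: "a *\<^sub>C (0::'a::complex_vector) = 0"
  using scaleC_add_right[of a 0 "0::'a"] by simp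

lemma scaleC_minus_right: "a *\<^sub>C (- x::'a::complex_vector) = - (a *\<^sub>C x)"
  using scaleC_add_right[of a x "- x"] by (simp add: eq_neg_iff_add_eq_0 add.commute)

lemma scaleC_diff_right: "a *\<^sub>C (x - y::'a::complex_vector) = a *\<^sub>C x - a *\<^sub>C y"
  using scaleC_add_right[of a x "- y"] by (simp add: scaleC_minus_right)

lemma scaleC_sum_right: "a *\<^sub>C (\<Sum>i\<in>F. f i) = (\<Sum>i\<in>F. a *\<^sub>C (f i :: 'a::complex_vector))"
  by (induction F rule: infinite_finite_induct) (auto simp: scaleC_add_right)

section \<open>Complex subspaces and complex linear spans\<close>

definition csubspace :: "'a::complex_vector set \<Rightarrow> bool" where
  "csubspace V \<longleftrightarrow> 0 \<in> V \<and> (\<forall>x\<in>V. \<forall>y\<in>V. x + y \<in> V) \<and> (\<forall>c. \<forall>x\<in>V. c *\<^sub>C x \<in> V)"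

lemma csubspaceD:
  assumes "csubspace V"
  shows "0 \<in> V" "x \<in> V \<Longrightarrow> y \<in> V \<Longrightarrow> x + y \<in> V" "x \<in> V \<Longrightarrow> c *\<^sub>C x \<in> V"
    "x \<in> V \<Longrightarrow> r *\<^sub>R x \<in> V" "x \<in> V \<Longrightarrow> - x \<in> V" "x \<in> V \<Longrightarrow> y \<in> V \<Longrightarrow> x - y \<in> V"
proof -
  show 0: "0 \<in> V" and add: "\<And>x y. x \<in> V \<Longrightarrow> y \<in> V \<Longrightarrow> x + y \<in> V"
    and sc: "\<And>c x. x \<in> V \<Longrightarrow> c *\<^sub>C x \<in> V"
    using assms by (auto simp: csubspace_def)
  show scr: "\<And>r x. x \<in> V \<Longrightarrow> r *\<^sub>R x \<in> V" using sc by (simp add: scaleR_scaleC)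
  show neg: "\<And>x. x \<in> V \<Longrightarrow> - x \<in> V" using scr[of _ "-1"] by simp
  show "x \<in> V \<Longrightarrow> y \<in> V \<Longrightarrow> x - y \<in> V" using add[of x "- y"] neg[of y] by simp
qed

lemma csubspace_sum:
  assumes "csubspace V" "\<And>i. i \<in> F \<Longrightarrow> f i \<in> V"
  shows "(\<Sum>i\<in>F. f i) \<in> V"
  using assms(2) by (induction F rule: infinite_finite_induct) (auto intro: csubspaceD[OF assms(1)])

lemma cspan_base: "x \<in> S \<Longrightarrow> x \<in> cspan S"
  unfolding cspan_def by (auto intro!: exI[of _ "{x}"] exI[of _ "\<lambda>_. 1"] simp: scaleC_one)

lemma csubspace_cspan: "csubspace (cspan S)"
  unfolding csubspace_def
proof (intro conjI ballI allI)
  show "0 \<in> cspan S" unfolding cspan_def by (auto intro!: exI[of _ "{}"])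
next
  fix x y assume "x \<in> cspan S" "y \<in> cspan S"
  then obtain F c G e where F: "finite F" "F \<subseteq> S" "x = (\<Sum>v\<in>F. c v *\<^sub>C v)"
    and G: "finite G" "G \<subseteq> S" "y = (\<Sum>v\<in>G. e v *\<^sub>C v)" unfolding cspan_def by auto
  have x: "x = (\<Sum>v\<in>F \<union> G. (if v \<in> F then c v else 0) *\<^sub>C v)"
    unfolding F(3) by (rule sum.mono_neutral_cong_left) (use F G in auto)
  have y: "y = (\<Sum>v\<in>F \<union> G. (if v \<in> G then e v else 0) *\<^sub>C v)"
    unfolding G(3) by (rule sum.mono_neutral_cong_left) (use F G in auto)
  have "x + y = (\<Sum>v\<in>F \<union> G. ((if v \<in> F then c v else 0) + (if v \<in> G then e v else 0)) *\<^sub>C v)"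
    by (subst x, subst y) (simp add: scaleC_add_left sum.distrib)
  then show "x + y \<in> cspan S"
    unfolding cspan_def mem_Collect_eq using F G
    by (intro exI[of _ "F \<union> G"] exI[of _ "\<lambda>v. (if v \<in> F then c v else 0) + (if v \<in> G then e v else 0)"]) auto
next
  fix a x assume "x \<in> cspan S"
  then obtain F c where F: "finite F" "F \<subseteq> S" "x = (\<Sum>v\<in>F. c v *\<^sub>C v)" unfolding cspan_def by auto
  have "a *\<^sub>C x = (\<Sum>v\<in>F. (a * c v) *\<^sub>C v)" by (simp add: F(3) scaleC_sum_right scaleC_scaleC)
  then show "a *\<^sub>C x \<in> cspan S" using F(1,2) unfolding cspan_def mem_Collect_eq
    by (intro exI[of _ F] exI[of _ "\<lambda>v. a * c v"]) simp
qed

lemmas cspan_zero = csubspaceD(1)[OF csubspace_cspan]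
  and cspan_add = csubspaceD(2)[OF csubspace_cspan]
  and cspan_scaleC = csubspaceD(3)[OF csubspace_cspan]
  and cspan_scaleR = csubspaceD(4)[OF csubspace_cspan]
  and cspan_diff = csubspaceD(6)[OF csubspace_cspan]

lemma cspan_minimal:
  assumes "S \<subseteq> V" "csubspace V" shows "cspan S \<subseteq> V"
proof
  fix x assume "x \<in> cspan S"
  then obtain F c where F: "finite F" "F \<subseteq> S" "x = (\<Sum>v\<in>F. c v *\<^sub>C v)" unfolding cspan_def by auto
  show "x \<in> V" unfolding F(3)
    by (rule csubspace_sum[OF assms(2)]) (use F assms in \<open>auto intro: csubspaceD\<close>)
qed

lemma cspan_mono: "S \<subseteq> S' \<Longrightarrow> cspan S \<subseteq> cspan S'"
  by (rule cspan_minimal) (auto intro: cspan_base csubspace_cspan)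

lemma cspan_eqI:
  assumes "S \<subseteq> cspan S'" "S' \<subseteq> cspan S" shows "cspan S = cspan S'"
  using assms by (intro equalityI cspan_minimal csubspace_cspan)

section \<open>Inner product identities, Cauchy-Schwarz and orthogonal projection\<close>

locale hilbert_ip =
  fixes ci :: "'h::{complex_normed_vector, banach} \<Rightarrow> 'h \<Rightarrow> complex"
  assumes ip: "complex_inner_product ci"
begin

lemma ci_add_right: "ci x (y + z) = ci x y + ci x z"
  and ci_scaleC_right: "ci x (c *\<^sub>C y) = c * ci x y"
  and ci_cnj: "ci y x = cnj (ci x y)"
  and norm_eq_ci: "norm x = sqrt (Re (ci x x))"
  using ip unfolding complex_inner_product_def by blast+

lemma ci_add_left: "ci (x + y) z = ci x z + ci y z"
  by (subst (1 2 3) ci_cnj) (simp add: ci_add_right)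

lemma ci_scaleC_left: "ci (c *\<^sub>C x) y = cnj c * ci x y"
  by (subst (1 2) ci_cnj) (simp add: ci_scaleC_right)

lemma ci_scaleR_right: "ci x (r *\<^sub>R y) = of_real r * ci x y"
  and ci_scaleR_left: "ci (r *\<^sub>R x) y = of_real r * ci x y"
  by (simp_all add: scaleR_scaleC ci_scaleC_right ci_scaleC_left)

lemma ci_zero_right [simp]: "ci x 0 = 0" and ci_zero_left [simp]: "ci 0 x = 0"
  using ci_scaleR_right[of x 0 0] ci_scaleR_left[of 0 0 x] by simp_all

lemma ci_minus_right: "ci x (- y) = - ci x y" and ci_minus_left: "ci (- x) y = - ci x y"
  using ci_scaleR_right[of x "-1" y] ci_scaleR_left[of "-1" x y] by simp_all

lemma ci_diff_right: "ci x (y - z) = ci x y - ci x z"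
  and ci_diff_left: "ci (y - z) x = ci y x - ci z x"
  using ci_add_right[of x y "-z"] ci_add_left[of y "-z" x] by (simp_all add: ci_minus_right ci_minus_left)

lemmas ci_bilinear = ci_add_right ci_add_left ci_scaleR_right ci_scaleR_left ci_scaleC_left
  ci_scaleC_right ci_diff_right ci_diff_left ci_minus_right ci_minus_left

lemma ci_eq_0_commute: "ci x y = 0 \<longleftrightarrow> ci y x = 0"
  using ci_cnj[of x y] by simp

lemma ci_self: "ci x x = of_real ((norm x)\<^sup>2)"
proof -
  \<comment> \<open>The HOL square root of a negative real is negative, so nonnegativity of the norm
    already forces this.\<close>
  have "Re (ci x x) \<ge> 0"
    using norm_ge_zero[of x] unfolding norm_eq_ci by (simp del: norm_ge_zero)
  then have "Re (ci x x) = (norm x)\<^sup>2" by (simp add: norm_eq_ci)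
  moreover have "Im (ci x x) = 0" using arg_cong[OF ci_cnj[of x x], of Im] by simp
  ultimately show ?thesis by (simp add: complex_eq_iff)
qed

lemma norm_diff_sq: "(norm (x - y))\<^sup>2 = (norm x)\<^sup>2 + (norm y)\<^sup>2 - 2 * Re (ci x y)"
proof -
  have "complex_of_real ((norm (x - y))\<^sup>2) = ci x x + ci y y - (ci x y + ci y x)"
    unfolding ci_self[symmetric] by (simp add: ci_bilinear)
  then have "(norm (x - y))\<^sup>2 = Re (ci x x + ci y y - (ci x y + ci y x))"
    by (metis Re_complex_of_real)
  then show ?thesis using ci_cnj[of x y] by (simp add: ci_self)
qed

lemma norm_add_sq: "(norm (x + y))\<^sup>2 = (norm x)\<^sup>2 + (norm y)\<^sup>2 + 2 * Re (ci x y)"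
  using norm_diff_sq[of x "- y"] by (simp add: ci_minus_right)

text \<open>Removing from \<open>y\<close> its component \<open>k *\<^sub>C x\<close> along
  \<open>x\<close> leaves a vector orthogonal to \<open>x\<close>; by Pythagoras this component is
  no longer than \<open>y\<close>.\<close>

lemma cauchy_schwarz: "cmod (ci x y) \<le> norm x * norm y"
proof (cases "x = 0")
  case False
  define k where "k = ci x y / of_real ((norm x)\<^sup>2)"
  define z where "z = y - k *\<^sub>C x"
  have nz: "complex_of_real ((norm x)\<^sup>2) \<noteq> 0" using False by simp
  have zx: "ci x z = 0" unfolding z_def using nz by (simp add: ci_bilinear ci_self k_def)
  have "(norm y)\<^sup>2 = (norm z)\<^sup>2 + (norm (k *\<^sub>C x))\<^sup>2 + 2 * Re (ci z (k *\<^sub>C x))"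
    using norm_add_sq[of z "k *\<^sub>C x"] by (simp add: z_def)
  moreover have "ci z (k *\<^sub>C x) = 0" using zx ci_cnj[of x z] by (simp add: ci_scaleC_right)
  ultimately have "(norm (k *\<^sub>C x))\<^sup>2 \<le> (norm y)\<^sup>2" by simp
  then have "norm (k *\<^sub>C x) \<le> norm y" by (simp add: power2_le_iff_abs_le)
  moreover have "norm (k *\<^sub>C x) * norm x = cmod (ci x y)"
    using False by (simp add: norm_scaleC k_def norm_divide norm_mult power2_eq_square del: of_real_power)
  ultimately show ?thesis
    by (metis mult.commute mult_right_mono norm_ge_zero)
qed simp

lemma bounded_linear_ci_right: "bounded_linear (ci x)"
  by (rule bounded_linear_intro[of _ "norm x"])
     (simp_all add: ci_add_right ci_scaleR_right scaleR_conv_of_real mult.commute[of _ "norm x"] cauchy_schwarz)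

lemma csubspace_orth: "csubspace {x. \<forall>s\<in>S. ci s x = 0}"
  by (auto simp: csubspace_def ci_bilinear)

lemma closed_orth: "closed {x. \<forall>s\<in>S. ci s x = 0}"
proof -
  have "{x. \<forall>s\<in>S. ci s x = 0} = (\<Inter>s\<in>S. {x. ci s x = 0})" by auto
  moreover have "closed {x. ci s x = 0}" for s
    by (intro closed_Collect_eq continuous_on_const linear_continuous_on bounded_linear_ci_right)
  ultimately show ?thesis by auto
qed

lemma orth_cspan:
  assumes "\<And>s. s \<in> S \<Longrightarrow> ci s x = 0" "y \<in> cspan S" shows "ci y x = 0"
proof -
  have "cspan S \<subseteq> {y. \<forall>s\<in>{x}. ci s y = 0}"
    by (rule cspan_minimal[OF _ csubspace_orth]) (use assms(1) ci_eq_0_commute[of x] in auto)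
  then show ?thesis using assms(2) ci_eq_0_commute[of x y] by auto
qed

text \<open>The distance-minimising argument: by the parallelogram law a minimising sequence in
  \<open>V\<close> is Cauchy, completeness supplies its limit, and minimality makes the residual
  orthogonal to \<open>V\<close>.\<close>

lemma orthogonal_projection:
  assumes V: "csubspace V" and cl: "closed V"
  obtains y where "y \<in> V" "\<And>v. v \<in> V \<Longrightarrow> ci v (x - y) = 0"
proof -
  define D where "D = (INF v\<in>V. norm (x - v))"
  have ne: "V \<noteq> {}" using csubspaceD(1)[OF V] by auto
  have bdd: "bdd_below ((\<lambda>v. norm (x - v)) ` V)" by (rule bdd_belowI[of _ 0]) auto
  have Dle: "D \<le> norm (x - v)" if "v \<in> V" for v
    unfolding D_def using bdd that by (rule cINF_lower)
  have D0: "D \<ge> 0" unfolding D_def using ne by (intro cINF_greatest) auto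
  have "\<exists>v\<in>V. norm (x - v) < D + 1 / Suc n" for n
    using cINF_less_iff[OF ne bdd, of "D + 1 / Suc n"] by (simp add: D_def)
  then obtain f where f: "\<And>n. f n \<in> V" "\<And>n. norm (x - f n) < D + 1 / Suc n" by metis
  \<comment> \<open>An upper bound for the excess of the squared distance from \<open>x\<close> to
    \<open>f n\<close> over its infimum.\<close>
  define e where "e n = (D + 1 / Suc n)\<^sup>2 - D\<^sup>2" for n
  have "e \<longlonglongrightarrow> (D + 0)\<^sup>2 - D\<^sup>2" unfolding e_def
    by (intro tendsto_intros LIMSEQ_Suc[OF lim_const_over_n])
  then have e0: "e \<longlonglongrightarrow> 0" by simp
  have bnd: "(norm (f m - f n))\<^sup>2 \<le> 2 * e m + 2 * e n" for m n
  proof -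
    let ?p = "x - f m" and ?q = "x - f n"
    have par: "(norm (?p + ?q))\<^sup>2 + (norm (?p - ?q))\<^sup>2 = 2 * (norm ?p)\<^sup>2 + 2 * (norm ?q)\<^sup>2"
      unfolding norm_add_sq norm_diff_sq[of ?p ?q] by simp
    have "(1/2) *\<^sub>R (f m + f n) \<in> V" using f(1) V by (auto intro: csubspaceD)
    note Dle[OF this]
    moreover have "?p + ?q = 2 *\<^sub>R (x - (1/2) *\<^sub>R (f m + f n))"
      by (simp add: scaleR_diff_right scaleR_add_right scaleR_2)
    ultimately have "2 * D \<le> norm (?p + ?q)" by simp
    then have "(2 * D)\<^sup>2 \<le> (norm (?p + ?q))\<^sup>2" using D0 by (intro power_mono) auto
    moreover have "(norm ?p)\<^sup>2 \<le> (D + 1 / Suc m)\<^sup>2" "(norm ?q)\<^sup>2 \<le> (D + 1 / Suc n)\<^sup>2"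
      using f(2)[of m] f(2)[of n] by (auto intro!: power_mono)
    ultimately have "(norm (?p - ?q))\<^sup>2 \<le> 2 * e m + 2 * e n"
      using par by (simp add: e_def power_mult_distrib)
    then show ?thesis by (simp add: norm_minus_commute)
  qed
  have "Cauchy f"
  proof (rule metric_CauchyI)
    fix r :: real assume r: "r > 0"
    then have "\<forall>\<^sub>F n in sequentially. e n < r\<^sup>2 / 4" using e0 by (intro order_tendstoD) auto
    then obtain N where N: "\<And>n. n \<ge> N \<Longrightarrow> e n < r\<^sup>2 / 4" by (auto simp: eventually_sequentially)
    have "dist (f m) (f n) < r" if "m \<ge> N" "n \<ge> N" for m n
    proof -
      have "(norm (f m - f n))\<^sup>2 < r\<^sup>2" using bnd[of m n] N[OF that(1)] N[OF that(2)] by linarith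
      then show ?thesis using r by (simp add: dist_norm power2_less_imp_less)
    qed
    then show "\<exists>N. \<forall>m\<ge>N. \<forall>n\<ge>N. dist (f m) (f n) < r" by blast
  qed
  then obtain y where y: "f \<longlonglongrightarrow> y" by (auto simp: Cauchy_convergent_iff convergent_def)
  have yV: "y \<in> V" using closed_sequentially[OF cl] f(1) y by blast
  have "(\<lambda>n. norm (x - f n)) \<longlonglongrightarrow> norm (x - y)" by (intro tendsto_intros y)
  moreover have "(\<lambda>n. D + 1 / Suc n) \<longlonglongrightarrow> D + 0"
    by (intro tendsto_intros LIMSEQ_Suc[OF lim_const_over_n])
  ultimately have "norm (x - y) \<le> D + 0"
    using f(2) by (intro LIMSEQ_le) (auto intro: less_imp_le)
  then have yD: "norm (x - y) \<le> norm (x - v)" if "v \<in> V" for v using Dle[OF that] by simp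
  have "ci v (x - y) = 0" if v: "v \<in> V" for v
  proof (cases "v = 0")
    case False
    \<comment> \<open>The optimal step along \<open>v\<close>: moving from \<open>y\<close> by
      \<open>k *\<^sub>C v\<close> lowers the squared distance by
      \<open>(norm (k *\<^sub>C v))\<^sup>2\<close>, so minimality forces
      \<open>k = 0\<close>.\<close>
    define k where "k = ci v (x - y) / of_real ((norm v)\<^sup>2)"
    have "y + k *\<^sub>C v \<in> V" using yV v V by (auto intro: csubspaceD)
    then have "(norm (x - y))\<^sup>2 \<le> (norm ((x - y) - k *\<^sub>C v))\<^sup>2"
      using yD by (intro power_mono) (auto simp: algebra_simps)
    also have "\<dots> = (norm (x - y))\<^sup>2 + (norm (k *\<^sub>C v))\<^sup>2 - 2 * Re (k * ci (x - y) v)"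
      by (simp add: norm_diff_sq[of "x - y" "k *\<^sub>C v"] ci_scaleC_right)
    also have "k * ci (x - y) v = of_real ((norm (k *\<^sub>C v))\<^sup>2)"
    proof -
      have "of_real ((norm v)\<^sup>2) * k = ci v (x - y)" using False by (simp add: k_def)
      then have "ci (x - y) v = cnj (of_real ((norm v)\<^sup>2) * k)" using ci_cnj[of "x - y" v] by simp
      then show ?thesis by (simp add: norm_scaleC power_mult_distrib flip: complex_norm_square)
    qed
    finally have "norm (k *\<^sub>C v) = 0" by simp
    then have "k = 0" using False by (simp add: norm_scaleC)
    then show ?thesis using False by (simp add: k_def)
  qed simp
  then show thesis using that yV by blast
qed

end

section \<open>Approximate eigenvectors\<close>

lemma bounded_linear_scaleC_left: "bounded_linear (\<lambda>a. a *\<^sub>C (v::'a::complex_normed_vector))"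
  by (rule bounded_linear_intro[of _ "norm v"])
     (simp_all add: scaleC_add_left scaleR_scaleC scaleC_scaleC scaleR_conv_of_real norm_scaleC)

lemma bounded_linear_scaleC_right: "bounded_linear (\<lambda>v. a *\<^sub>C (v::'a::complex_normed_vector))"
  by (rule bounded_linear_intro[of _ "cmod a"])
     (simp_all add: scaleC_add_right scaleR_scaleC scaleC_scaleC norm_scaleC mult.commute)

lemma csubspace_Int: "csubspace V \<Longrightarrow> csubspace W \<Longrightarrow> csubspace (V \<inter> W)"
  by (simp add: csubspace_def)

section \<open>Fredholm property from bounds on a complement of finite codimension\<close>

context hilbert_ip
begin

text \<open>Each condition \<open>ci s x = 0\<close> cuts out a subspace of codimension at most one,
  and imposing all of them leaves nothing.\<close>

lemma cfinite_dim_if_trivial_orth: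
  assumes "finite S" "csubspace V" "\<And>x. x \<in> V \<Longrightarrow> \<forall>s\<in>S. ci s x = 0 \<Longrightarrow> x = 0"
  shows "cfinite_dim V"
  using assms
proof (induction S arbitrary: V rule: finite_induct)
  case empty
  then have "V \<subseteq> cspan {}" using cspan_zero[of "{}"] by auto
  then show ?case unfolding cfinite_dim_def by blast
next
  case (insert s S)
  define V' where "V' = V \<inter> {x. \<forall>s\<in>{s}. ci s x = 0}"
  have "cfinite_dim V'"
  proof (rule insert.IH)
    show "csubspace V'" unfolding V'_def by (intro csubspace_Int csubspace_orth insert.prems)
  qed (use insert.prems in \<open>auto simp: V'_def\<close>)
  then obtain F where F: "finite F" "V' \<subseteq> cspan F" unfolding cfinite_dim_def by auto
  show ?case
  proof (cases "V \<subseteq> V'")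
    case True
    then show ?thesis using F unfolding cfinite_dim_def by blast
  next
    case False
    then obtain x0 where x0: "x0 \<in> V" "ci s x0 \<noteq> 0" by (auto simp: V'_def)
    have "x \<in> cspan (insert x0 F)" if x: "x \<in> V" for x
    proof -
      define k where "k = ci s x / ci s x0"
      have "x - k *\<^sub>C x0 \<in> V'" using x x0 insert.prems(1)
        by (auto simp: V'_def k_def ci_bilinear intro!: csubspaceD)
      then have "x - k *\<^sub>C x0 \<in> cspan (insert x0 F)" using F(2) cspan_mono[of F "insert x0 F"] by auto
      moreover have "k *\<^sub>C x0 \<in> cspan (insert x0 F)" by (intro cspan_scaleC cspan_base) simp
      ultimately show ?thesis using cspan_add by fastforce
    qed
    then show ?thesis using F(1) unfolding cfinite_dim_def by blast
  qed
qed

text \<open>Let \<open>w\<close> be the component of \<open>v\<close> orthogonal to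
  \<open>Y\<close>. Subtracting the projection onto \<open>w\<close> is continuous, and the sum is
  the preimage of \<open>Y\<close> under this map.\<close>

lemma closed_add_line:
  assumes Y: "csubspace Y" "closed (Y :: 'h set)"
  shows "closed {y + c *\<^sub>C v |y c. y \<in> Y}"
proof -
  obtain p where p: "p \<in> Y" "\<And>y. y \<in> Y \<Longrightarrow> ci y (v - p) = 0"
    using orthogonal_projection[OF Y] by blast
  define w where "w = v - p"
  \<comment> \<open>If \<open>v\<close> lies in \<open>Y\<close>, then \<open>w = 0\<close>;
    division by zero makes \<open>k\<close> vanish, and the preimage is \<open>Y\<close> itself, as
    it should be.\<close>
  define k where "k z = ci w z / of_real ((norm w)\<^sup>2)" for z
  have wY: "ci w y = 0" if "y \<in> Y" for y using p(2)[OF that] ci_eq_0_commute by (auto simp: w_def)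
  have kY: "k (y + c *\<^sub>C w) *\<^sub>C w = c *\<^sub>C w" if "y \<in> Y" for y c
    using wY[OF that] by (cases "w = 0") (auto simp: k_def ci_bilinear ci_self)
  have "{y + c *\<^sub>C v |y c. y \<in> Y} = (\<lambda>z. z - k z *\<^sub>C w) -` Y"
  proof (intro equalityI subsetI)
    fix z assume "z \<in> {y + c *\<^sub>C v |y c. y \<in> Y}"
    then obtain y c where z: "z = y + c *\<^sub>C v" "y \<in> Y" by auto
    have "z = (y + c *\<^sub>C p) + c *\<^sub>C w" by (simp add: z w_def scaleC_diff_right)
    moreover have "y + c *\<^sub>C p \<in> Y" using z p Y(1) by (auto intro: csubspaceD)
    ultimately show "z \<in> (\<lambda>z. z - k z *\<^sub>C w) -` Y" by (simp add: kY)
  next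
    fix z assume "z \<in> (\<lambda>z. z - k z *\<^sub>C w) -` Y"
    then have "z - k z *\<^sub>C w - k z *\<^sub>C p \<in> Y" using p Y(1) by (auto intro!: csubspaceD)
    moreover have "z = (z - k z *\<^sub>C w - k z *\<^sub>C p) + k z *\<^sub>C v" by (simp add: w_def scaleC_diff_right)
    ultimately show "z \<in> {y + c *\<^sub>C v |y c. y \<in> Y}" by blast
  qed
  moreover have "continuous_on UNIV (\<lambda>z. z - k z *\<^sub>C w)"
    unfolding k_def divide_inverse
    by (intro continuous_intros bounded_linear.continuous_on[OF bounded_linear_scaleC_left]
        bounded_linear.continuous_on[OF bounded_linear_ci_right])
  ultimately show ?thesis using Y(2) by (simp add: closed_vimage)
qed

text \<open>With no conditions left, a map bounded below on a closed subspace has complete image.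
  Each further condition has codimension at most one, so it changes the image at most by adding a
  line.\<close>

lemma closed_image_if_bounded_below_orth:
  assumes "finite S" and T: "bounded_linear T" "clinear_op T" and d: "\<delta> > 0"
    and W: "csubspace W" "closed W"
    and below: "\<And>x. x \<in> W \<Longrightarrow> \<forall>s\<in>S. ci s x = 0 \<Longrightarrow> \<delta> * norm x \<le> norm (T x)"
  shows "closed (T ` W)"
  using assms(1) W below
proof (induction S arbitrary: W rule: finite_induct)
  case empty
  have "complete (T ` W)"
  proof (rule complete_isometric_image[OF d _ T(1)])
    show "subspace W" using empty.prems(1) by (auto simp: subspace_def intro: csubspaceD)
  qed (use empty.prems in \<open>auto simp: mult.commute complete_eq_closed\<close>)
  then show ?case by (rule complete_imp_closed)
next
  case (insert s S)
  define W' where "W' = W \<inter> {x. \<forall>s\<in>{s}. ci s x = 0}"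
  have W': "csubspace W'" "closed W'" unfolding W'_def
    by (intro csubspace_Int csubspace_orth closed_Int closed_orth insert.prems)+
  have cl: "closed (T ` W')" by (rule insert.IH[OF W']) (use insert.prems in \<open>auto simp: W'_def\<close>)
  show ?case
  proof (cases "W \<subseteq> W'")
    case True
    then have "W = W'" by (auto simp: W'_def)
    then show ?thesis using cl by simp
  next
    case False
    then obtain x0 where x0: "x0 \<in> W" "ci s x0 \<noteq> 0" by (auto simp: W'_def)
    have Tadd: "T (x + y) = T x + T y" and Tsc: "T (c *\<^sub>C x) = c *\<^sub>C T x" for x y c
      using T(2) by (auto simp: clinear_op_def)
    have "T ` W = {y + c *\<^sub>C T x0 |y c. y \<in> T ` W'}"
    proof (intro equalityI subsetI)
      fix z assume "z \<in> T ` W"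
      then obtain x where x: "x \<in> W" "z = T x" by auto
      define k where "k = ci s x / ci s x0"
      have "x - k *\<^sub>C x0 \<in> W'" using x x0 insert.prems(1)
        by (auto simp: W'_def k_def ci_bilinear intro!: csubspaceD)
      moreover have "z = T (x - k *\<^sub>C x0) + k *\<^sub>C T x0"
        unfolding x(2) by (metis Tadd Tsc diff_add_cancel)
      ultimately show "z \<in> {y + c *\<^sub>C T x0 |y c. y \<in> T ` W'}" by blast
    next
      fix z assume "z \<in> {y + c *\<^sub>C T x0 |y c. y \<in> T ` W'}"
      then obtain x c where x: "x \<in> W'" "z = T x + c *\<^sub>C T x0" by auto
      have "x + c *\<^sub>C x0 \<in> W" using x x0 insert.prems(1) by (auto simp: W'_def intro: csubspaceD)
      moreover have "z = T (x + c *\<^sub>C x0)" by (simp add: x Tadd Tsc)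
      ultimately show "z \<in> T ` W" by blast
    qed
    moreover have "csubspace (T ` W')"
      unfolding csubspace_def
    proof (intro conjI ballI allI)
      show "0 \<in> T ` W'" using csubspaceD(1)[OF W'(1)] linear_0[OF bounded_linear.linear[OF T(1)]] by force
    next
      fix x y assume "x \<in> T ` W'" "y \<in> T ` W'"
      then show "x + y \<in> T ` W'" using csubspaceD(2)[OF W'(1)] by (auto simp flip: Tadd)
    next
      fix c x assume "x \<in> T ` W'"
      then show "c *\<^sub>C x \<in> T ` W'" using csubspaceD(3)[OF W'(1)] by (auto simp flip: Tsc)
    qed
    ultimately show ?thesis using closed_add_line[OF _ cl] by simp
  qed
qed

text \<open>The two preceding inductions give the finite-dimensional kernel and the closed range. By
  selfadjointness the orthogonal complement of the range lies in the kernel, so a finite set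
  spanning the kernel also completes the range.\<close>

lemma fredholm_if_bounded_below_orth:
  assumes S: "finite S" and T: "bounded_linear T" "clinear_op T" "selfadjoint_op ci T" and d: "\<delta> > 0"
    and below: "\<And>x. \<forall>s\<in>S. ci s x = 0 \<Longrightarrow> \<delta> * norm x \<le> norm (T x)"
  shows "fredholm T"
proof -
  have Tadd: "T (x + y) = T x + T y" and Tsc: "T (c *\<^sub>C x) = c *\<^sub>C T x" for x y c
    using T(2) by (auto simp: clinear_op_def)
  have T0: "T 0 = 0" by (rule linear_0[OF bounded_linear.linear[OF T(1)]])
  have cl: "closed (range T)"
    by (rule closed_image_if_bounded_below_orth[OF S T(1,2) d]) (auto simp: csubspace_def below)
  have rng: "csubspace (range T)"
    unfolding csubspace_def
  proof (intro conjI ballI allI)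
    show "0 \<in> range T" using T0 by (metis rangeI)
  qed (auto simp flip: Tadd Tsc)
  have ker: "cfinite_dim {x. T x = 0}"
  proof (rule cfinite_dim_if_trivial_orth[OF S])
    show "csubspace {x. T x = 0}" by (auto simp: csubspace_def Tadd Tsc T0)
    fix x assume "x \<in> {x. T x = 0}" "\<forall>s\<in>S. ci s x = 0"
    then show "x = 0" using below[of x] d by (simp add: mult_le_0_iff)
  qed
  then obtain F where F: "finite F" "{x. T x = 0} \<subseteq> cspan F" unfolding cfinite_dim_def by auto
  have "x \<in> cspan (range T \<union> F)" for x
  proof -
    obtain y where y: "y \<in> range T" "\<And>v. v \<in> range T \<Longrightarrow> ci v (x - y) = 0"
      using orthogonal_projection[OF rng cl] by blast
    \<comment> \<open>The right-hand side vanishes, because \<open>T (T (x - y))\<close> is in the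
      range and \<open>x - y\<close> is orthogonal to it.\<close>
    have "ci (T (x - y)) (T (x - y)) = ci (T (T (x - y))) (x - y)"
      using T(3) by (simp add: selfadjoint_op_def)
    then have "T (x - y) = 0" using y(2) by (simp add: ci_self)
    then have "x - y \<in> cspan (range T \<union> F)" using F(2) cspan_mono[of F "range T \<union> F"] by auto
    moreover have "y \<in> cspan (range T \<union> F)" using y(1) by (intro cspan_base) simp
    ultimately show ?thesis using cspan_add by fastforce
  qed
  then show ?thesis unfolding fredholm_def using cl ker F(1) by blast
qed

text \<open>Weyl's criterion with prescribed orthogonality: if it failed, \<open>T - l\<close> would
  be bounded below by \<open>\<delta>\<close> on the orthogonal complement of \<open>S\<close> and
  hence be Fredholm.\<close>

lemma weyl_vector:
  assumes S: "finite S" and T: "bounded_linear T" "clinear_op T" "selfadjoint_op ci T"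
    and l: "complex_of_real l \<in> essential_spectrum T" and d: "\<delta> > 0"
  shows "\<exists>x. norm x = 1 \<and> (\<forall>s\<in>S. ci s x = 0) \<and> norm (T x - l *\<^sub>R x) < \<delta>"
proof (rule ccontr)
  assume "\<not> ?thesis"
  then have no: "\<delta> \<le> norm (T x - l *\<^sub>R x)" if "norm x = 1" "\<forall>s\<in>S. ci s x = 0" for x
    using that by (meson not_le)
  define B where "B x = T x - complex_of_real l *\<^sub>C x" for x
  have BR: "B x = T x - l *\<^sub>R x" for x by (simp add: B_def scaleR_scaleC)
  have B: "bounded_linear B" unfolding B_def
    by (intro bounded_linear_sub T bounded_linear_scaleC_right)
  have "fredholm B"
  proof (rule fredholm_if_bounded_below_orth[OF S B _ _ d])
    show "clinear_op B" using T(2)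
      by (simp add: clinear_op_def B_def scaleC_add_right scaleC_diff_right scaleC_scaleC mult.commute)
    show "selfadjoint_op ci B" using T(3)
      by (simp add: selfadjoint_op_def B_def ci_bilinear)
    fix x assume x: "\<forall>s\<in>S. ci s x = 0"
    show "\<delta> * norm x \<le> norm (B x)"
    proof (cases "x = 0")
      case False
      have "\<delta> \<le> norm (B ((1 / norm x) *\<^sub>R x))" unfolding BR
        using False x by (intro no) (auto simp: ci_bilinear)
      also have "\<dots> = norm (B x) / norm x"
        by (simp add: linear_scale[OF bounded_linear.linear[OF B]])
      finally show ?thesis using False by (simp add: field_simps)
    qed simp
  qed
  then show False using l by (simp add: essential_spectrum_def B_def[abs_def])
qed

text \<open>The sign \<open>\<sigma>\<close> treats both ends of the essential spectrum at once. An
  approximate eigenvector for \<open>l\<close> has quadratic form close to \<open>l\<close>; the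
  resulting margin is stable under small norm changes of \<open>A\<close>, so compactness makes it
  uniform in time.\<close>

lemma uniform_extremal_vectors:
  fixes A :: "real \<Rightarrow> ('h \<Rightarrow>\<^sub>L 'h)"
  assumes A_cont: "continuous_on {0..1} A"
    and A_lin: "\<forall>t\<in>{0..1}. clinear_op (A t)" and A_sa: "\<forall>t\<in>{0..1}. selfadjoint_op ci (A t)"
    and \<sigma>: "\<bar>\<sigma>\<bar> = (1::real)"
    and l: "\<forall>t\<in>{0..1}. \<exists>l. complex_of_real l \<in> essential_spectrum (A t) \<and> \<sigma> * l > \<beta>"
  obtains e where "e > 0"
    "\<And>t S. t \<in> {0..1} \<Longrightarrow> finite S \<Longrightarrow>
      \<exists>x. norm x = 1 \<and> (\<forall>s\<in>S. ci s x = 0) \<and> \<sigma> * Re (ci x (A t x)) \<ge> \<beta> + e"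
proof -
  define E where "E t e \<longleftrightarrow> (\<forall>S. finite S \<longrightarrow>
      (\<exists>x. norm x = 1 \<and> (\<forall>s\<in>S. ci s x = 0) \<and> \<sigma> * Re (ci x (A t x)) \<ge> \<beta> + e))" for t e
  have pt: "\<exists>e>0. E t e" if t: "t \<in> {0..1}" for t
  proof -
    obtain l where l: "complex_of_real l \<in> essential_spectrum (A t)" "\<sigma> * l > \<beta>" using l t by blast
    \<comment> \<open>One half of the gap absorbs the error of the approximate eigenvector, the
      other half remains as margin.\<close>
    define e where "e = (\<sigma> * l - \<beta>) / 2"
    have e: "e > 0" using l by (simp add: e_def)
    have "E t e" unfolding E_def
    proof (intro allI impI)
      fix S :: "'h set" assume S: "finite S"
      obtain x where x: "norm x = 1" "\<forall>s\<in>S. ci s x = 0" "norm (A t x - l *\<^sub>R x) < e"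
        using weyl_vector[OF S blinfun.bounded_linear_right _ _ l(1) e] A_lin A_sa t by blast
      have "cmod (ci x (A t x - l *\<^sub>R x)) \<le> e" using cauchy_schwarz[of x "A t x - l *\<^sub>R x"] x by simp
      then have "\<bar>Re (ci x (A t x)) - l\<bar> \<le> e"
        using abs_Re_le_cmod[of "ci x (A t x - l *\<^sub>R x)"] x(1) by (simp add: ci_bilinear ci_self)
      then have "\<bar>\<sigma> * Re (ci x (A t x)) - \<sigma> * l\<bar> \<le> e"
        using \<sigma> by (simp add: abs_mult flip: right_diff_distrib)
      then have "\<sigma> * Re (ci x (A t x)) \<ge> \<beta> + e" 
        using abs_le_D2[of "\<sigma> * Re (ci x (A t x)) - \<sigma> * l" e] unfolding e_def by (simp add: field_simps)
      then show "\<exists>x. norm x = 1 \<and> (\<forall>s\<in>S. ci s x = 0) \<and> \<sigma> * Re (ci x (A t x)) \<ge> \<beta> + e"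
        using x by blast
    qed
    then show ?thesis using e by blast
  qed
  have stab: "E t' e'" if E: "E t e" and le: "norm (A t' - A t) + e' \<le> e" for t t' e e'
    unfolding E_def
  proof (intro allI impI)
    fix S :: "'h set" assume "finite S"
    then obtain x where x: "norm x = 1" "\<forall>s\<in>S. ci s x = 0" "\<sigma> * Re (ci x (A t x)) \<ge> \<beta> + e"
      using E unfolding E_def by blast
    have "\<bar>\<sigma> * Re (ci x ((A t' - A t) x))\<bar> \<le> norm ((A t' - A t) x)"
      using abs_Re_le_cmod[of "ci x ((A t' - A t) x)"] cauchy_schwarz[of x "(A t' - A t) x"] x(1) \<sigma>
      by (simp add: abs_mult)
    also have "\<dots> \<le> norm (A t' - A t)" using norm_blinfun[of "A t' - A t" x] x(1) by simp
    finally have "\<sigma> * Re (ci x (A t' x)) \<ge> \<beta> + e'"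
      using x(3) le by (simp add: blinfun.diff_left ci_bilinear right_diff_distrib abs_le_iff)
    then show "\<exists>x. norm x = 1 \<and> (\<forall>s\<in>S. ci s x = 0) \<and> \<sigma> * Re (ci x (A t' x)) \<ge> \<beta> + e'"
      using x by blast
  qed
  have "\<exists>e>0. \<forall>t\<in>{0..1}. E t e"
  proof (rule ccontr)
    assume "\<not> ?thesis"
    \<comment> \<open>Times at which the margins \<open>1 / Suc k\<close> fail accumulate at some
      \<open>t\<close>; the positive margin at \<open>t\<close> spreads to nearby times by
      \<open>stab\<close>, a contradiction.\<close>
    then have "\<exists>t\<in>{0..1}. \<not> E t (1 / Suc k)" for k by (metis of_nat_0_less_iff zero_less_Suc zero_less_divide_1_iff)
    then obtain f where f: "\<And>k. f k \<in> {0..1}" "\<And>k. \<not> E (f k) (1 / Suc k)" by metis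
    have "seq_compact {0..1::real}" using compact_Icc compact_eq_seq_compact_metric by blast
    then obtain t r where t: "t \<in> {0..1}" "strict_mono r" "(f \<circ> r) \<longlonglongrightarrow> t"
      using f(1) by (meson seq_compactE)
    obtain e where e: "e > 0" "E t e" using pt[OF t(1)] by blast
    have "(A \<circ> (f \<circ> r)) \<longlonglongrightarrow> A t"
      using A_cont t f(1) unfolding continuous_on_sequentially by (metis comp_apply)
    then have "(\<lambda>k. norm (A (f (r k)) - A t)) \<longlonglongrightarrow> 0"
      by (intro tendsto_norm_zero) (simp add: o_def LIM_zero_iff)
    then have "\<forall>\<^sub>F k in sequentially. norm (A (f (r k)) - A t) < e / 2"
      using e by (intro order_tendstoD(2)) auto
    moreover have "(\<lambda>k. 1 / real (Suc (r k))) \<longlonglongrightarrow> 0"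
      using LIMSEQ_subseq_LIMSEQ[OF LIMSEQ_Suc[OF lim_const_over_n[of 1]] t(2)] by (simp add: o_def)
    then have "\<forall>\<^sub>F k in sequentially. 1 / real (Suc (r k)) < e / 2"
      using e by (intro order_tendstoD(2)) auto
    ultimately have "\<forall>\<^sub>F k in sequentially. False"
    proof eventually_elim
      case (elim k)
      then have "E (f (r k)) (1 / Suc (r k))" by (intro stab[OF e(2)]) linarith
      then show ?case using f(2) by blast
    qed
    then show False by simp
  qed
  then show thesis using that unfolding E_def by metis
qed

end

section \<open>A block orthonormal basis adapted to finitely many operators\<close>

lemma cspan_insert: "cspan (insert v S) = {y + c *\<^sub>C v |y c. y \<in> cspan S}"
proof (intro equalityI cspan_minimal)
  show "insert v S \<subseteq> {y + c *\<^sub>C v |y c. y \<in> cspan S}"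
  proof
    fix x assume "x \<in> insert v S"
    then consider "x = 0 + 1 *\<^sub>C v" | "x = x + 0 *\<^sub>C v" "x \<in> cspan S"
      by (auto simp: scaleC_one intro: cspan_base)
    then show "x \<in> {y + c *\<^sub>C v |y c. y \<in> cspan S}" using cspan_zero by cases blast+
  qed
  show "csubspace {y + c *\<^sub>C v |y c. y \<in> cspan S}"
    unfolding csubspace_def
  proof (intro conjI ballI allI)
    show "0 \<in> {y + c *\<^sub>C v |y c. y \<in> cspan S}"
      using cspan_zero[of S] by (auto intro!: exI[of _ 0] exI[of _ "0::complex"])
  next
    fix x x' assume "x \<in> {y + c *\<^sub>C v |y c. y \<in> cspan S}" "x' \<in> {y + c *\<^sub>C v |y c. y \<in> cspan S}"
    then obtain y c y' c' where "x = y + c *\<^sub>C v" "x' = y' + c' *\<^sub>C v" "y \<in> cspan S" "y' \<in> cspan S" by auto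
    then show "x + x' \<in> {y + c *\<^sub>C v |y c. y \<in> cspan S}"
      by (auto simp: scaleC_add_left intro!: exI[of _ "y + y'"] exI[of _ "c + c'"] cspan_add)
  next
    fix a x assume "x \<in> {y + c *\<^sub>C v |y c. y \<in> cspan S}"
    then obtain y c where "x = y + c *\<^sub>C v" "y \<in> cspan S" by auto
    then show "a *\<^sub>C x \<in> {y + c *\<^sub>C v |y c. y \<in> cspan S}"
      by (auto simp: scaleC_add_right scaleC_scaleC intro!: exI[of _ "a *\<^sub>C y"] exI[of _ "a * c"] cspan_scaleC)
  qed
  show "{y + c *\<^sub>C v |y c. y \<in> cspan S} \<subseteq> cspan (insert v S)"
  proof
    fix x assume "x \<in> {y + c *\<^sub>C v |y c. y \<in> cspan S}"
    then obtain y c where x: "x = y + c *\<^sub>C v" "y \<in> cspan S" by auto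
    have y: "y \<in> cspan (insert v S)" using x(2) cspan_mono[of S "insert v S"] by auto
    show "x \<in> cspan (insert v S)" unfolding x(1) by (intro cspan_add[OF y] cspan_scaleC cspan_base) auto
  qed
qed

context hilbert_ip
begin

definition orthonormal_on :: "'i set \<Rightarrow> ('i \<Rightarrow> 'h) \<Rightarrow> bool" where
  "orthonormal_on I f \<longleftrightarrow> (\<forall>i\<in>I. \<forall>j\<in>I. ci (f i) (f j) = (if i = j then 1 else 0))"

lemma orthonormal_onD:
  "orthonormal_on I f \<Longrightarrow> i \<in> I \<Longrightarrow> j \<in> I \<Longrightarrow> ci (f i) (f j) = (if i = j then 1 else 0)"
  by (simp add: orthonormal_on_def)

lemma norm_eq_1_iff: "norm x = 1 \<longleftrightarrow> ci x x = 1"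
proof -
  have "ci x x = 1 \<longleftrightarrow> (norm x)\<^sup>2 = 1" unfolding ci_self by (metis of_real_1 of_real_eq_iff)
  then show ?thesis by (simp add: power2_eq_1_iff) (smt (verit) norm_ge_zero)
qed

lemma orthonormal_on_norm: "orthonormal_on I f \<Longrightarrow> i \<in> I \<Longrightarrow> norm (f i) = 1"
  by (simp add: norm_eq_1_iff orthonormal_onD)

lemma closed_cspan_finite:
  assumes "finite S" shows "closed (cspan (S :: 'h set))"
  using assms
proof (induction S rule: finite_induct)
  case empty
  have "cspan {} = {0 :: 'h}" using cspan_zero[of "{}"] by (auto simp: cspan_def)
  then show ?case by simp
next
  case (insert v S)
  then show ?case unfolding cspan_insert by (intro closed_add_line csubspace_cspan)
qed

lemma exists_unit_orth:
  assumes inf: "\<not> cfinite_dim (UNIV :: 'h set)" and S: "finite S"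
  shows "\<exists>x. norm x = 1 \<and> (\<forall>s\<in>S. ci s x = 0)"
proof -
  have "csubspace (UNIV :: 'h set)" by (simp add: csubspace_def)
  then obtain x where x: "\<forall>s\<in>S. ci s x = 0" "x \<noteq> 0"
    using cfinite_dim_if_trivial_orth[OF S] inf by blast
  then show ?thesis by (intro exI[of _ "(1 / norm x) *\<^sub>R x"]) (auto simp: ci_bilinear)
qed

text \<open>A Gram-Schmidt step; if \<open>y\<close> already lies in the span of \<open>S\<close>,
  any unit vector orthogonal to \<open>S\<close> will do.\<close>

lemma exists_unit_orth_capturing:
  assumes inf: "\<not> cfinite_dim (UNIV :: 'h set)" and S: "finite S"
  shows "\<exists>x. norm x = 1 \<and> (\<forall>s\<in>S. ci s x = 0) \<and> y \<in> cspan (insert x S)"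
proof -
  obtain p where p: "p \<in> cspan S" "\<And>v. v \<in> cspan S \<Longrightarrow> ci v (y - p) = 0"
    using orthogonal_projection[OF csubspace_cspan closed_cspan_finite[OF S]] by blast
  show ?thesis
  proof (cases "y = p")
    case True
    then have "y \<in> cspan (insert x S)" for x using p(1) cspan_mono[of S "insert x S"] by auto
    then show ?thesis using exists_unit_orth[OF inf S] by blast
  next
    case False
    define x where "x = (1 / norm (y - p)) *\<^sub>R (y - p)"
    have "y = p + complex_of_real (norm (y - p)) *\<^sub>C x"
      using False by (simp add: x_def flip: scaleR_scaleC)
    then have "y \<in> cspan (insert x S)" unfolding cspan_insert using p(1) by blast
    moreover have "norm x = 1" using False by (simp add: x_def)
    moreover have "\<forall>s\<in>S. ci s x = 0" using p(2) by (simp add: x_def ci_bilinear cspan_base)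
    ultimately show ?thesis by blast
  qed
qed

text \<open>Index \<open>(n, k)\<close> is position \<open>k\<close> of block \<open>n\<close>.
  Position \<open>N\<close> of each block absorbs the next member of a dense sequence, which yields
  completeness. Vectors at positions below \<open>N\<close> are picked orthogonal to the
  \<open>Bs\<close>-images of all predecessors; the vector at position \<open>N\<close> is not,
  which is why the last clause excludes it as a later partner in the same block.\<close>

lemma block_orthonormal_basis:
  fixes Bs :: "('h \<Rightarrow> 'h) set" and Q :: "nat \<Rightarrow> 'h \<Rightarrow> bool" and N :: nat
  assumes inf: "\<not> cfinite_dim (UNIV :: 'h set)" and sep: "separable_space TYPE('h)"
    and Bs: "finite Bs" "\<And>B. B \<in> Bs \<Longrightarrow> selfadjoint_op ci B"
    and Q: "\<And>k S. k < N \<Longrightarrow> finite S \<Longrightarrow> \<exists>x. norm x = 1 \<and> (\<forall>s\<in>S. ci s x = 0) \<and> Q k x"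
  obtains b :: "nat \<times> nat \<Rightarrow> 'h" where
    "orthonormal_on {i. snd i \<le> N} b" "closure (cspan (b ` {i. snd i \<le> N})) = UNIV"
    "\<And>n k. k < N \<Longrightarrow> Q k (b (n, k))"
    "\<And>B n k (n'::nat) k'. B \<in> Bs \<Longrightarrow> k < N \<Longrightarrow> k' \<le> N \<Longrightarrow> n' < n \<or> n' = n \<and> k' < N \<and> k' \<noteq> k \<Longrightarrow>
      ci (B (b (n, k))) (b (n', k')) = 0"
proof -
  obtain D :: "'h set" where D: "countable D" "closure D = UNIV"
    using sep by (auto simp: separable_space_def)
  then have Dne: "D \<noteq> {}" by auto
  define K where "K = Suc N"
  \<comment> \<open>The requirements on the vector chosen at step \<open>k\<close>, which fills
    position \<open>k mod K\<close> of block \<open>k div K\<close>. They involve \<open>f\<close>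
    only below \<open>k\<close>, as the recursion demands.\<close>
  define P where "P f k x \<longleftrightarrow> norm x = 1 \<and> (\<forall>s\<in>f ` {..<k}. ci s x = 0) \<and>
      (k mod K < N \<longrightarrow> Q (k mod K) x \<and> (\<forall>B\<in>Bs. \<forall>s\<in>f ` {..<k}. ci (B s) x = 0)) \<and>
      (k mod K = N \<longrightarrow> from_nat_into D (k div K) \<in> cspan (insert x (f ` {..<k})))"
    for f :: "nat \<Rightarrow> 'h" and k x
  have ex: "\<exists>x. P f k x" for f k
  proof (cases "k mod K < N")
    case True
    have "finite (f ` {..<k} \<union> (\<Union>B\<in>Bs. B ` f ` {..<k}))" using Bs(1) by simp
    from Q[OF True this] obtain x where x: "norm x = 1" "Q (k mod K) x"
      "\<forall>s\<in>f ` {..<k} \<union> (\<Union>B\<in>Bs. B ` f ` {..<k}). ci s x = 0" by blast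
    have "ci (B s) x = 0" if "B \<in> Bs" "s \<in> f ` {..<k}" for B s
      by (rule bspec[OF x(3)]) (use that in blast)
    then have "P f k x" using True x unfolding P_def by simp
    then show ?thesis ..
  next
    case False
    have "finite (f ` {..<k})" by simp
    from exists_unit_orth_capturing[OF inf this, of "from_nat_into D (k div K)"]
    show ?thesis using False unfolding P_def by blast
  qed
  have "\<exists>f. \<forall>k. P f k (f k)"
  proof (rule dependent_wf_choice[of less_than])
    fix x and f g :: "nat \<Rightarrow> 'h" and k :: nat
    assume "\<And>z. (z, k) \<in> less_than \<Longrightarrow> f z = g z"
    then have "f ` {..<k} = g ` {..<k}" by (intro image_cong) auto
    then show "P f k x = P g k x" unfolding P_def by simp
  qed (simp_all add: ex)
  then obtain f where f: "\<And>k. P f k (f k)" by blast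
  have orth: "ci (f l) (f k) = 0" if "l < k" for l k using f[of k] that by (auto simp: P_def)
  have on: "ci (f l) (f k) = (if l = k then 1 else 0)" for l k
    using orth[of l k] orth[of k l] ci_eq_0_commute[of "f l" "f k"] norm_eq_1_iff[of "f k"] f[of k]
    by (cases l k rule: linorder_cases) (auto simp: P_def)
  have fQ: "Q (k mod K) (f k)" "\<And>B l. B \<in> Bs \<Longrightarrow> l < k \<Longrightarrow> ci (B (f l)) (f k) = 0"
    if "k mod K < N" for k using f[of k] that by (auto simp: P_def)
  \<comment> \<open>Selfadjointness of \<open>B\<close> makes the relation symmetric, so only the
    later of the two vectors has to sit at a position below \<open>N\<close>.\<close>
  have fB: "ci (B (f k)) (f l) = 0" if "B \<in> Bs" "l \<noteq> k" "k < l \<longrightarrow> l mod K < N" "k mod K < N" for B k l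
  proof (cases "k < l")
    case True then show ?thesis using fQ(2)[of l B k] that by simp
  next
    case False
    then have "ci (B (f l)) (f k) = 0" using fQ(2)[of k B l] that by simp
    then have "ci (f l) (B (f k)) = 0" using Bs(2)[OF that(1)] by (simp add: selfadjoint_op_def)
    then show ?thesis using ci_eq_0_commute by blast
  qed
  define b where "b i = f (fst i * K + snd i)" for i
  have idx: "(n * K + k) mod K = k" "(n * K + k) div K = n" if "k \<le> N" for n k
    using that less_Suc_eq_le[of k N] by (simp_all add: K_def del: mult_Suc_right)
  have inj: "n * K + k = n' * K + k' \<longleftrightarrow> n = n' \<and> k = k'" if "k \<le> N" "k' \<le> N" for n k n' k'
    using idx[OF that(1), of n] idx[OF that(2), of n'] by auto
  show thesis
  proof (rule that[of b])
    show "orthonormal_on {i. snd i \<le> N} b"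
      unfolding orthonormal_on_def by (auto simp: b_def on inj)
    have "b ` {i. snd i \<le> N} = range f"
    proof (intro equalityI subsetI)
      fix x assume "x \<in> range f"
      then obtain k where "x = f k" by auto
      then have "x = b (k div K, k mod K)" by (simp add: b_def)
      moreover have "k mod K \<le> N" using mod_less_divisor[of K k] by (simp add: K_def)
      ultimately show "x \<in> b ` {i. snd i \<le> N}" by auto
    qed (auto simp: b_def)
    moreover have "D \<subseteq> cspan (range f)"
    proof
      fix x assume "x \<in> D"
      then obtain n where n: "from_nat_into D n = x" using from_nat_into_surj[OF D(1)] by blast
      let ?k = "n * K + N"
      have "x \<in> cspan (insert (f ?k) (f ` {..<?k}))"
        using f[of ?k] idx[of N n] by (simp add: P_def n)
      also have "\<dots> \<subseteq> cspan (range f)" by (intro cspan_mono) auto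
      finally show "x \<in> cspan (range f)" .
    qed
    then have "closure (cspan (range f)) = UNIV" using D(2) closure_mono by blast
    ultimately show "closure (cspan (b ` {i. snd i \<le> N})) = UNIV" by simp
    show "Q k (b (n, k))" if "k < N" for n k
      using fQ(1)[of "n * K + k"] idx[of k n] that by (simp add: b_def)
    fix B and n k n' k' :: nat assume a: "B \<in> Bs" "k < N" "k' \<le> N" "n' < n \<or> n' = n \<and> k' < N \<and> k' \<noteq> k"
    have "n' * K + k' < n * K + k" if "n' < n"
    proof -
      have "n' * K + k' < Suc n' * K" using a(3) by (simp add: K_def)
      also have "\<dots> \<le> n * K" using that by (intro mult_right_mono) auto
      finally show ?thesis by simp
    qed
    then show "ci (B (b (n, k))) (b (n', k')) = 0"
      unfolding b_def using a idx inj[of k' k n' n] by (intro fB) auto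
  qed
qed

end

section \<open>Sweeping rotations\<close>

definition rotate_family :: "('i \<Rightarrow> real) \<Rightarrow> ('i \<Rightarrow> real) \<Rightarrow> ('i \<Rightarrow> 'i) \<Rightarrow> ('i \<Rightarrow> 'v::real_vector) \<Rightarrow> 'i \<Rightarrow> 'v" where
  "rotate_family \<alpha> \<beta> \<sigma> f = (\<lambda>i. \<alpha> i *\<^sub>R f i + \<beta> i *\<^sub>R f (\<sigma> i))"

text \<open>The involution \<open>\<sigma>\<close> pairs the indices, and the opposite signs of
  \<open>\<beta>\<close> across a pair make each pair undergo a plane rotation. At a fixed point of
  \<open>\<sigma>\<close> they force \<open>\<beta> i = 0\<close>.\<close>

definition rotation :: "'i set \<Rightarrow> ('i \<Rightarrow> real) \<Rightarrow> ('i \<Rightarrow> real) \<Rightarrow> ('i \<Rightarrow> 'i) \<Rightarrow> bool" where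
  "rotation I \<alpha> \<beta> \<sigma> \<longleftrightarrow> (\<forall>i\<in>I. \<sigma> i \<in> I \<and> \<sigma> (\<sigma> i) = i \<and> (\<alpha> i)\<^sup>2 + (\<beta> i)\<^sup>2 = 1 \<and>
     \<alpha> (\<sigma> i) = \<alpha> i \<and> \<beta> (\<sigma> i) = - \<beta> i)"

text \<open>The inverse rotation recovers each \<open>f i\<close> from the rotated pair, and
  \<open>S\<close> contains a pair as soon as it contains one of its members.\<close>

lemma cspan_rotate_family:
  fixes f :: "'i \<Rightarrow> 'h::complex_vector"
  assumes rot: "rotation I \<alpha> \<beta> \<sigma>" and S: "S \<subseteq> I" "\<sigma> ` S \<subseteq> S"
  shows "cspan (rotate_family \<alpha> \<beta> \<sigma> f ` S) = cspan (f ` S)"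
proof (rule cspan_eqI)
  show "rotate_family \<alpha> \<beta> \<sigma> f ` S \<subseteq> cspan (f ` S)"
  proof (intro image_subsetI)
    fix i assume "i \<in> S"
    then show "rotate_family \<alpha> \<beta> \<sigma> f i \<in> cspan (f ` S)"
      unfolding rotate_family_def using S by (intro cspan_add cspan_scaleR cspan_base) auto
  qed
  show "f ` S \<subseteq> cspan (rotate_family \<alpha> \<beta> \<sigma> f ` S)"
  proof
    fix x assume "x \<in> f ` S"
    then obtain i where i: "i \<in> S" "x = f i" by auto
    let ?g = "rotate_family \<alpha> \<beta> \<sigma> f"
    have r: "\<sigma> (\<sigma> i) = i" "(\<alpha> i)\<^sup>2 + (\<beta> i)\<^sup>2 = 1" "\<alpha> (\<sigma> i) = \<alpha> i" "\<beta> (\<sigma> i) = - \<beta> i"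
      using rot i S by (auto simp: rotation_def)
    have "\<alpha> i *\<^sub>R ?g i - \<beta> i *\<^sub>R ?g (\<sigma> i) = ((\<alpha> i)\<^sup>2 + (\<beta> i)\<^sup>2) *\<^sub>R f i"
      by (simp add: rotate_family_def r(1,3,4) algebra_simps power2_eq_square)
    then have "x = \<alpha> i *\<^sub>R ?g i - \<beta> i *\<^sub>R ?g (\<sigma> i)" by (simp add: r i)
    moreover have "\<sigma> i \<in> S" using i S by auto
    ultimately show "x \<in> cspan (?g ` S)"
      using i(1) by (simp only:) (intro cspan_diff cspan_scaleR cspan_base imageI)
  qed
qed

lemma norm_scaleR_diff_le:
  "norm (a *\<^sub>R x - a' *\<^sub>R (x'::'a::real_normed_vector)) \<le> \<bar>a - a'\<bar> * norm x + \<bar>a'\<bar> * norm (x - x')"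
proof -
  have "a *\<^sub>R x - a' *\<^sub>R x' = (a - a') *\<^sub>R x + a' *\<^sub>R (x - x')" by (simp add: algebra_simps)
  then show ?thesis by (metis norm_scaleR norm_triangle_ineq)
qed

lemma abs_cos_diff_le: "\<bar>cos x - cos y\<bar> \<le> \<bar>x - (y::real)\<bar>"
proof -
  have "norm (cos x - cos y) \<le> 1 * norm (x - y)"
    by (rule field_differentiable_bound[of UNIV cos "\<lambda>x. - sin x"]) (auto intro!: derivative_eq_intros)
  then show ?thesis by simp
qed

lemma abs_sin_diff_le: "\<bar>sin x - sin y\<bar> \<le> \<bar>x - (y::real)\<bar>"
  using abs_cos_diff_le[of "pi/2 - x" "pi/2 - y"] by (simp add: cos_diff)

text \<open>Splits the increment of a rotated pair into the change of the angle and the changes of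
  the vectors; both members of the pair are needed later.\<close>

lemma norm_rotate_diff_le:
  fixes x y :: "'a::real_normed_vector"
  assumes "norm x \<le> 1" "norm y \<le> 1"
  shows "norm ((cos \<phi> *\<^sub>R x + sin \<phi> *\<^sub>R y) - (cos \<psi> *\<^sub>R x' + sin \<psi> *\<^sub>R y'))
      \<le> 2 * \<bar>\<phi> - \<psi>\<bar> + (norm (x - x') + norm (y - y'))"
    and "norm ((cos \<phi> *\<^sub>R x - sin \<phi> *\<^sub>R y) - (cos \<psi> *\<^sub>R x' - sin \<psi> *\<^sub>R y'))
      \<le> 2 * \<bar>\<phi> - \<psi>\<bar> + (norm (x - x') + norm (y - y'))"
proof -
  have c: "norm (cos \<phi> *\<^sub>R x - cos \<psi> *\<^sub>R x') \<le> \<bar>\<phi> - \<psi>\<bar> + norm (x - x')"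
    by (rule order_trans[OF norm_scaleR_diff_le add_mono])
       (use assms abs_cos_diff_le[of \<phi> \<psi>] in \<open>auto intro: mult_left_le_one_le order_trans[OF mult_left_le]\<close>)
  have s: "norm (sin \<phi> *\<^sub>R y - sin \<psi> *\<^sub>R y') \<le> \<bar>\<phi> - \<psi>\<bar> + norm (y - y')"
    by (rule order_trans[OF norm_scaleR_diff_le add_mono])
       (use assms abs_sin_diff_le[of \<phi> \<psi>] in \<open>auto intro: mult_left_le_one_le order_trans[OF mult_left_le]\<close>)
  have eq: "(cos \<phi> *\<^sub>R x + sin \<phi> *\<^sub>R y) - (cos \<psi> *\<^sub>R x' + sin \<psi> *\<^sub>R y') =
      (cos \<phi> *\<^sub>R x - cos \<psi> *\<^sub>R x') + (sin \<phi> *\<^sub>R y - sin \<psi> *\<^sub>R y')" by simp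
  show "norm ((cos \<phi> *\<^sub>R x + sin \<phi> *\<^sub>R y) - (cos \<psi> *\<^sub>R x' + sin \<psi> *\<^sub>R y'))
      \<le> 2 * \<bar>\<phi> - \<psi>\<bar> + (norm (x - x') + norm (y - y'))"
    unfolding eq by (rule order_trans[OF norm_triangle_ineq]) (use c s in simp)
  have eq: "(cos \<phi> *\<^sub>R x - sin \<phi> *\<^sub>R y) - (cos \<psi> *\<^sub>R x' - sin \<psi> *\<^sub>R y') =
      (cos \<phi> *\<^sub>R x - cos \<psi> *\<^sub>R x') - (sin \<phi> *\<^sub>R y - sin \<psi> *\<^sub>R y')" by simp
  show "norm ((cos \<phi> *\<^sub>R x - sin \<phi> *\<^sub>R y) - (cos \<psi> *\<^sub>R x' - sin \<psi> *\<^sub>R y'))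
      \<le> 2 * \<bar>\<phi> - \<psi>\<bar> + (norm (x - x') + norm (y - y'))"
    unfolding eq by (rule order_trans[OF norm_triangle_ineq4]) (use c s in simp)
qed

context hilbert_ip
begin

lemma orthonormal_on_rotate_family:
  assumes on: "orthonormal_on I f" and rot: "rotation I \<alpha> \<beta> \<sigma>"
  shows "orthonormal_on I (rotate_family \<alpha> \<beta> \<sigma> f)"
  unfolding orthonormal_on_def
proof (intro ballI)
  fix i j assume ij: "i \<in> I" "j \<in> I"
  have r: "\<sigma> i \<in> I" "\<sigma> j \<in> I" "\<sigma> (\<sigma> i) = i" "\<sigma> (\<sigma> j) = j"
    "(\<alpha> i)\<^sup>2 + (\<beta> i)\<^sup>2 = 1" "\<alpha> (\<sigma> i) = \<alpha> i" "\<beta> (\<sigma> i) = - \<beta> i" "\<alpha> (\<sigma> j) = \<alpha> j" "\<beta> (\<sigma> j) = - \<beta> j"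
    using rot ij by (auto simp: rotation_def)
  have e: "ci (rotate_family \<alpha> \<beta> \<sigma> f i) (rotate_family \<alpha> \<beta> \<sigma> f j) = of_real (\<alpha> i * \<alpha> j) * (if i = j then 1 else 0) +
      of_real (\<alpha> i * \<beta> j) * (if i = \<sigma> j then 1 else 0) + of_real (\<beta> i * \<alpha> j) * (if \<sigma> i = j then 1 else 0) +
      of_real (\<beta> i * \<beta> j) * (if \<sigma> i = \<sigma> j then 1 else 0)"
    by (simp add: rotate_family_def ci_bilinear orthonormal_onD[OF on] ij r(1,2) algebra_simps)
  have s: "\<sigma> i = j \<longleftrightarrow> i = \<sigma> j" "\<sigma> i = \<sigma> j \<longleftrightarrow> i = j" using r(3,4) by metis+
  show "ci (rotate_family \<alpha> \<beta> \<sigma> f i) (rotate_family \<alpha> \<beta> \<sigma> f j) = (if i = j then 1 else 0)"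
  proof (cases "i = j")
    case True
    have "\<alpha> i * \<alpha> i + \<beta> i * \<beta> i = 1" using r(5) by (simp add: power2_eq_square)
    moreover have "\<beta> i = 0" if "i = \<sigma> i" using r(7) that by simp
    ultimately show ?thesis unfolding e s using True
      by (auto simp flip: of_real_mult of_real_add)
  next
    case False
    have "\<alpha> i * \<beta> j + \<beta> i * \<alpha> j = 0" if "i = \<sigma> j" using r(8,9) that by simp
    then show ?thesis unfolding e s using False
      by (auto simp flip: of_real_mult of_real_add)
  qed
qed

text \<open>Induction on the number of sweeps. In every block, sweep \<open>s\<close> turns
  positions 0 and 1 from the basis vectors \<open>2 * s\<close> and \<open>2 * s + 1\<close> into
  \<open>2 * s + 2\<close> and \<open>2 * s + 3\<close> while time runs from \<open>s / r\<close> to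
  \<open>Suc s / r\<close>. Rotations stay inside blocks, so spans of initial blocks are kept, and
  the Lipschitz constant does not depend on the block.\<close>

lemma sweeping_frame_aux:
  fixes b :: "nat \<times> nat \<Rightarrow> 'h" and r :: nat
  defines "I \<equiv> {i. snd i \<le> 2 * r + 2}"
  assumes on: "orthonormal_on I b" and r: "r > 0" and s: "s \<le> r"
  shows "\<exists>h \<Lambda>. (\<forall>t. orthonormal_on I (\<lambda>i. h i t)) \<and>
    (\<forall>t n. cspan ((\<lambda>i. h i t) ` {i \<in> I. fst i \<le> n}) = cspan (b ` {i \<in> I. fst i \<le> n})) \<and>
    (\<forall>i\<in>I. \<forall>t t'. norm (h i t - h i t') \<le> \<Lambda> * \<bar>t - t'\<bar>) \<and>
    (\<forall>i t. snd i > 2 * s + 1 \<longrightarrow> h i t = b i) \<and>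
    (\<forall>n. \<forall>t\<ge>0. (t \<ge> s / r \<and> h (n, 0) t = b (n, 2 * s) \<and> h (n, 1) t = b (n, 2 * s + 1)) \<or>
       (\<exists>i<s. \<exists>\<phi>. i / r \<le> t \<and> t \<le> Suc i / r \<and>
          h (n, 0) t = cos \<phi> *\<^sub>R b (n, 2 * i) + sin \<phi> *\<^sub>R b (n, 2 * i + 2) \<and>
          h (n, 1) t = cos \<phi> *\<^sub>R b (n, 2 * i + 1) + sin \<phi> *\<^sub>R b (n, 2 * i + 3)))"
  using s
proof (induction s)
  case 0
  show ?case
    by (rule exI[of _ "\<lambda>i t. b i"], rule exI[of _ 0]) (simp add: on)
next
  case (Suc s)
  then obtain h \<Lambda> where h: "\<And>t. orthonormal_on I (\<lambda>i. h i t)"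
    "\<And>t n. cspan ((\<lambda>i. h i t) ` {i \<in> I. fst i \<le> n}) = cspan (b ` {i \<in> I. fst i \<le> n})"
    "\<And>i t t'. i \<in> I \<Longrightarrow> norm (h i t - h i t') \<le> \<Lambda> * \<bar>t - t'\<bar>"
    "\<And>i t. snd i > 2 * s + 1 \<Longrightarrow> h i t = b i"
    and hb: "\<And>n t. t \<ge> 0 \<Longrightarrow> (t \<ge> s / r \<and> h (n, 0) t = b (n, 2 * s) \<and> h (n, 1) t = b (n, 2 * s + 1)) \<or>
       (\<exists>i<s. \<exists>\<phi>. i / r \<le> t \<and> t \<le> Suc i / r \<and>
          h (n, 0) t = cos \<phi> *\<^sub>R b (n, 2 * i) + sin \<phi> *\<^sub>R b (n, 2 * i + 2) \<and>
          h (n, 1) t = cos \<phi> *\<^sub>R b (n, 2 * i + 1) + sin \<phi> *\<^sub>R b (n, 2 * i + 3))"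
    by auto blast
  \<comment> \<open>The angle is 0 up to time \<open>s / r\<close> and \<open>pi / 2\<close> from
    \<open>Suc s / r\<close> on: the new sweep does nothing before its interval and is complete
    after it.\<close>
  define \<phi> where "\<phi> t = pi / 2 * max 0 (min 1 (r * t - s))" for t :: real
  define \<sigma> where "\<sigma> i = (fst i, if snd i = 0 then 2 * s + 2 else if snd i = 1 then 2 * s + 3
      else if snd i = 2 * s + 2 then 0 else if snd i = 2 * s + 3 then 1 else snd i)" for i :: "nat \<times> nat"
  define \<alpha> where "\<alpha> t i = (if snd i \<in> {0, 1, 2 * s + 2, 2 * s + 3} then cos (\<phi> t) else 1)"
    for t and i :: "nat \<times> nat"
  define \<beta> where "\<beta> t i = (if snd i \<in> {0, 1} then sin (\<phi> t)
      else if snd i \<in> {2 * s + 2, 2 * s + 3} then - sin (\<phi> t) else 0)" for t and i :: "nat \<times> nat"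
  define g where "g i t = rotate_family (\<alpha> t) (\<beta> t) \<sigma> (\<lambda>i. h i t) i" for i t
  have \<sigma>I: "\<sigma> i \<in> I" if "i \<in> I" for i using that Suc.prems by (auto simp: \<sigma>_def I_def)
  have rot: "rotation I (\<alpha> t) (\<beta> t) \<sigma>" for t
    unfolding rotation_def
  proof (intro ballI conjI)
    fix i assume "i \<in> I"
    then show "\<sigma> i \<in> I" by (rule \<sigma>I)
  qed (auto simp: \<sigma>_def \<alpha>_def \<beta>_def prod_eq_iff)
  have "\<bar>\<phi> t - \<phi> t'\<bar> \<le> pi / 2 * (r * \<bar>t - t'\<bar>)" for t t' :: real
  proof -
    have "\<bar>max 0 (min 1 (r * t - s)) - max 0 (min 1 (r * t' - s))\<bar> \<le> \<bar>(r * t - s) - (r * t' - s)\<bar>" by linarith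
    also have "\<dots> = r * \<bar>t - t'\<bar>" by (simp add: abs_mult flip: right_diff_distrib)
    finally have "pi / 2 * \<bar>max 0 (min 1 (r * t - s)) - max 0 (min 1 (r * t' - s))\<bar> \<le> pi / 2 * (r * \<bar>t - t'\<bar>)"
      by (intro mult_left_mono) auto
    also have "pi / 2 * \<bar>max 0 (min 1 (r * t - s)) - max 0 (min 1 (r * t' - s))\<bar> = \<bar>\<phi> t - \<phi> t'\<bar>"
      unfolding \<phi>_def right_diff_distrib[symmetric] abs_mult by simp
    finally show ?thesis .
  qed
  note \<phi>L = this
  have \<phi>L: "2 * \<bar>\<phi> t - \<phi> t'\<bar> \<le> pi * r * \<bar>t - t'\<bar>" for t t'
    using \<phi>L[of t t'] by (simp add: mult.assoc)
  \<comment> \<open>A sweep contributes \<open>pi * r\<close> through its angle and at most doubles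
    the earlier constant, since two vectors are mixed.\<close>
  have gL: "norm (g i t - g i t') \<le> (pi * r + 2 * \<bar>\<Lambda>\<bar>) * \<bar>t - t'\<bar>" if i: "i \<in> I" for i t t'
  proof -
    have \<Lambda>: "norm (h j t - h j t') \<le> \<bar>\<Lambda>\<bar> * \<bar>t - t'\<bar>" if "j \<in> I" for j
      using h(3)[OF that, of t t'] by (smt (verit) mult_right_mono abs_ge_zero)
    have n1: "norm (h j t) \<le> 1" if "j \<in> I" for j using orthonormal_on_norm[OF h(1) that] by simp
    note b = norm_rotate_diff_le[of "h i t" "h (\<sigma> i) t" "\<phi> t" "\<phi> t'" "h i t'" "h (\<sigma> i) t'"]
    have eq: "(pi * r + 2 * \<bar>\<Lambda>\<bar>) * \<bar>t - t'\<bar> = pi * r * \<bar>t - t'\<bar> + (\<bar>\<Lambda>\<bar> * \<bar>t - t'\<bar> + \<bar>\<Lambda>\<bar> * \<bar>t - t'\<bar>)"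
      by (simp add: algebra_simps)
    consider "snd i \<in> {0, 1}" | "snd i \<in> {2 * s + 2, 2 * s + 3}"
      | "snd i \<notin> {0, 1, 2 * s + 2, 2 * s + 3}" by blast
    then show ?thesis
    proof cases
      case 3
      then have g: "g i = h i" by (auto simp: g_def rotate_family_def \<alpha>_def \<beta>_def)
      have "0 \<le> pi * r * \<bar>t - t'\<bar>" "0 \<le> \<bar>\<Lambda>\<bar> * \<bar>t - t'\<bar>" by simp_all
      then show ?thesis unfolding eq g using \<Lambda>[OF i] by (intro add_increasing add_increasing2)
    qed (use b n1[OF i] n1[OF \<sigma>I[OF i]] \<Lambda>[OF i] \<Lambda>[OF \<sigma>I[OF i]] \<phi>L[of t t'] eq in
        \<open>auto simp: g_def rotate_family_def \<alpha>_def \<beta>_def\<close>)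
  qed
  have g01: "g (n, 0) t = cos (\<phi> t) *\<^sub>R h (n, 0) t + sin (\<phi> t) *\<^sub>R b (n, 2 * s + 2)"
    "g (n, 1) t = cos (\<phi> t) *\<^sub>R h (n, 1) t + sin (\<phi> t) *\<^sub>R b (n, 2 * s + 3)" for n t
    by (auto simp: g_def rotate_family_def \<alpha>_def \<beta>_def \<sigma>_def h(4))
  show ?case
  proof (rule exI[of _ g], rule exI[of _ "pi * r + 2 * \<bar>\<Lambda>\<bar>"], intro conjI allI ballI impI)
    fix t n
    show "orthonormal_on I (\<lambda>i. g i t)" unfolding g_def by (rule orthonormal_on_rotate_family[OF h(1) rot])
    show "cspan ((\<lambda>i. g i t) ` {i \<in> I. fst i \<le> n}) = cspan (b ` {i \<in> I. fst i \<le> n})"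
      unfolding g_def h(2)[of t n, symmetric]
      by (rule cspan_rotate_family[OF rot]) (use \<sigma>I in \<open>auto simp: \<sigma>_def\<close>)
  next
    fix i :: "nat \<times> nat" and t assume "2 * Suc s + 1 < snd i"
    then show "g i t = b i" by (auto simp: g_def rotate_family_def \<alpha>_def \<beta>_def h(4))
  next
    fix n and t :: real assume t: "0 \<le> t"
    from hb[OF t, of n] show "Suc s / r \<le> t \<and> g (n, 0) t = b (n, 2 * Suc s) \<and> g (n, 1) t = b (n, 2 * Suc s + 1) \<or>
       (\<exists>i<Suc s. \<exists>\<phi>. i / r \<le> t \<and> t \<le> Suc i / r \<and>
          g (n, 0) t = cos \<phi> *\<^sub>R b (n, 2 * i) + sin \<phi> *\<^sub>R b (n, 2 * i + 2) \<and>
          g (n, 1) t = cos \<phi> *\<^sub>R b (n, 2 * i + 1) + sin \<phi> *\<^sub>R b (n, 2 * i + 3))"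
    proof (elim disjE conjE exE)
      assume a: "s / r \<le> t" "h (n, 0) t = b (n, 2 * s)" "h (n, 1) t = b (n, 2 * s + 1)"
      show ?thesis
      proof (cases "Suc s / r \<le> t")
        case True
        then have "real (Suc s) \<le> r * t" using r by (simp add: pos_divide_le_eq mult.commute)
        then have "\<phi> t = pi / 2" by (simp add: \<phi>_def)
        then have "cos (\<phi> t) = 0" "sin (\<phi> t) = 1" by (simp_all only: cos_pi_half sin_pi_half)
        then show ?thesis using True unfolding g01 by (intro disjI1) (simp add: numeral_3_eq_3)
      next
        case False
        then show ?thesis using a
          by (intro disjI2 exI[of _ s] conjI exI[of _ "\<phi> t"]) (use a in \<open>auto simp: g01[simplified]\<close>)
      qed
    next
      fix i \<psi> assume a: "i < s" "i / r \<le> t" "t \<le> Suc i / r"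
        "h (n, 0) t = cos \<psi> *\<^sub>R b (n, 2 * i) + sin \<psi> *\<^sub>R b (n, 2 * i + 2)"
        "h (n, 1) t = cos \<psi> *\<^sub>R b (n, 2 * i + 1) + sin \<psi> *\<^sub>R b (n, 2 * i + 3)"
      have "r * t \<le> Suc i" using a(3) r by (simp add: pos_le_divide_eq mult.commute)
      then have "r * t \<le> s" using a(1) by linarith
      then have "\<phi> t = 0" by (simp add: \<phi>_def)
      then show ?thesis using a
        by (intro disjI2 exI[of _ i] conjI exI[of _ \<psi>]) (use a in \<open>auto simp: g01[simplified]\<close>)
    qed
  qed (rule gL)
qed

lemma sweeping_frame:
  fixes b :: "nat \<times> nat \<Rightarrow> 'h" and r :: nat
  defines "I \<equiv> {i. snd i \<le> 2 * r + 2}"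
  assumes on: "orthonormal_on I b" and r: "r > 0"
  obtains h \<Lambda> where "\<And>t. orthonormal_on I (\<lambda>i. h i t)"
    "\<And>t n. cspan ((\<lambda>i. h i t) ` {i \<in> I. fst i \<le> n}) = cspan (b ` {i \<in> I. fst i \<le> n})"
    "\<And>i t t'. i \<in> I \<Longrightarrow> norm (h i t - h i t') \<le> \<Lambda> * \<bar>t - t'\<bar>"
    "\<And>n t. t \<in> {0..1} \<Longrightarrow> \<exists>i<r. \<exists>\<phi>. i / r \<le> t \<and> t \<le> Suc i / r \<and>
          h (n, 0) t = cos \<phi> *\<^sub>R b (n, 2 * i) + sin \<phi> *\<^sub>R b (n, 2 * i + 2) \<and>
          h (n, 1) t = cos \<phi> *\<^sub>R b (n, 2 * i + 1) + sin \<phi> *\<^sub>R b (n, 2 * i + 3)"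
proof -
  obtain h \<Lambda> where h: "\<And>t. orthonormal_on I (\<lambda>i. h i t)"
    "\<And>t n. cspan ((\<lambda>i. h i t) ` {i \<in> I. fst i \<le> n}) = cspan (b ` {i \<in> I. fst i \<le> n})"
    "\<And>i t t'. i \<in> I \<Longrightarrow> norm (h i t - h i t') \<le> \<Lambda> * \<bar>t - t'\<bar>"
    and hb: "\<And>n t. t \<ge> 0 \<Longrightarrow> (t \<ge> r / r \<and> h (n, 0) t = b (n, 2 * r) \<and> h (n, 1) t = b (n, 2 * r + 1)) \<or>
       (\<exists>i<r. \<exists>\<phi>. i / r \<le> t \<and> t \<le> Suc i / r \<and>
          h (n, 0) t = cos \<phi> *\<^sub>R b (n, 2 * i) + sin \<phi> *\<^sub>R b (n, 2 * i + 2) \<and>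
          h (n, 1) t = cos \<phi> *\<^sub>R b (n, 2 * i + 1) + sin \<phi> *\<^sub>R b (n, 2 * i + 3))"
    using sweeping_frame_aux[OF on[unfolded I_def] r order_refl] unfolding I_def by blast
  show thesis
  proof (rule that[OF h])
    fix n and t :: real assume t: "t \<in> {0..1}"
    then have "0 \<le> t" by simp
    from hb[OF this, of n] show "\<exists>i<r. \<exists>\<phi>. i / r \<le> t \<and> t \<le> Suc i / r \<and>
          h (n, 0) t = cos \<phi> *\<^sub>R b (n, 2 * i) + sin \<phi> *\<^sub>R b (n, 2 * i + 2) \<and>
          h (n, 1) t = cos \<phi> *\<^sub>R b (n, 2 * i + 1) + sin \<phi> *\<^sub>R b (n, 2 * i + 3)"
    proof (elim disjE conjE)
      assume a: "r / r \<le> t" "h (n, 0) t = b (n, 2 * r)" "h (n, 1) t = b (n, 2 * r + 1)"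
      \<comment> \<open>Only the final instant is left; it is the end of the last sweep, with angle
        \<open>pi / 2\<close>.\<close>
      then have "t = 1" using t r by simp
      moreover obtain j where j: "r = Suc j" using r by (cases r) auto
      ultimately show ?thesis using a
        by (intro exI[of _ j] conjI exI[of _ "pi / 2"]) (auto simp: field_simps numeral_eq_Suc)
    qed
  qed auto
qed

end

section \<open>Solving for the angle\<close>

text \<open>
  The value of a real quadratic form at \<open>c u + s (cos \<theta> P + sin \<theta> Q)\<close>. Its diagonal entries at
  \<open>u, P, Q\<close> are \<open>\<alpha>, p, q\<close>, and its entries at \<open>(P, Q), (u, P), (u, Q)\<close> are \<open>\<gamma>, x, y\<close>.
\<close>
definition trig_form :: "real \<Rightarrow> real \<Rightarrow> real \<Rightarrow> real \<Rightarrow> real \<Rightarrow> real \<Rightarrow> real \<Rightarrow> real \<Rightarrow> real \<Rightarrow> real" where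
  "trig_form c s \<alpha> p q \<gamma> x y \<theta> = c\<^sup>2 * \<alpha> + s\<^sup>2 * ((cos \<theta>)\<^sup>2 * p + (sin \<theta>)\<^sup>2 * q + 2 * sin \<theta> * cos \<theta> * \<gamma>) +
     2 * c * s * (cos \<theta> * x + sin \<theta> * y)"

text \<open>Reflecting the angle exchanges \<open>P\<close> and \<open>Q\<close>, so estimates near
  one end carry over to the other.\<close>

lemma trig_form_swap: "trig_form c s \<alpha> p q \<gamma> x y (pi / 2 - \<theta>) = trig_form c s \<alpha> q p \<gamma> y x \<theta>"
  by (simp add: trig_form_def cos_diff sin_diff algebra_simps)

lemma abs_mult_le: "\<bar>x\<bar> \<le> a \<Longrightarrow> \<bar>y\<bar> \<le> b \<Longrightarrow> \<bar>x * y\<bar> \<le> a * (b::real)"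
  unfolding abs_mult by (rule mult_mono) auto

lemma abs_cos_sin_comb_le:
  assumes "\<bar>x\<bar> \<le> \<eta>" "\<bar>y\<bar> \<le> \<eta>" shows "\<bar>cos \<theta> * x + sin \<theta> * y\<bar> \<le> 2 * (\<eta>::real)"
  using abs_mult_le[OF abs_cos_le_one assms(1), of \<theta>] abs_mult_le[OF abs_sin_le_one assms(2), of \<theta>] by linarith

lemma two_mult_le_one: assumes "c\<^sup>2 + s\<^sup>2 = (1::real)" shows "\<bar>2 * c * s\<bar> \<le> 1"
  using assms zero_le_power2[of "c - s"] zero_le_power2[of "c + s"]
  by (simp add: abs_le_iff power2_diff power2_sum)

text \<open>For small \<open>c\<close> and \<theta> the vector is almost \<open>P\<close>. The
  changes of the diagonal weights cost at most \<open>e / 4\<close> each, and the off-diagonal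
  entries at most \<open>3 * \<eta>\<close>, hence \<open>e / 2\<close>.\<close>

lemma trig_form_close:
  assumes cs: "c\<^sup>2 + s\<^sup>2 = 1" and M: "\<bar>\<alpha>\<bar> \<le> M" "\<bar>p\<bar> \<le> M" "\<bar>q\<bar> \<le> M"
    and \<eta>: "\<bar>\<gamma>\<bar> \<le> \<eta>" "\<bar>x\<bar> \<le> \<eta>" "\<bar>y\<bar> \<le> \<eta>"
    and e: "2 * M * c\<^sup>2 \<le> e / 4" "2 * M * \<theta>\<^sup>2 \<le> e / 4" "6 * \<eta> \<le> e"
  shows "\<bar>trig_form c s \<alpha> p q \<gamma> x y \<theta> - p\<bar> \<le> e"
proof -
  have "trig_form c s \<alpha> p q \<gamma> x y \<theta> - p = trig_form c s \<alpha> p q \<gamma> x y \<theta> - (c\<^sup>2 + s\<^sup>2) * p" using cs by simp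
  also have "\<dots> = c\<^sup>2 * (\<alpha> - p) + s\<^sup>2 * (sin \<theta>)\<^sup>2 * (q - p) + s\<^sup>2 * (2 * sin \<theta> * cos \<theta>) * \<gamma> +
      2 * c * s * (cos \<theta> * x + sin \<theta> * y)"
    unfolding trig_form_def cos_squared_eq by (simp add: algebra_simps)
  finally have eq: "trig_form c s \<alpha> p q \<gamma> x y \<theta> - p = c\<^sup>2 * (\<alpha> - p) + s\<^sup>2 * (sin \<theta>)\<^sup>2 * (q - p) +
      s\<^sup>2 * (2 * sin \<theta> * cos \<theta>) * \<gamma> + 2 * c * s * (cos \<theta> * x + sin \<theta> * y)" .
  have s2: "s\<^sup>2 \<le> 1" using cs zero_le_power2[of c] by linarith
  have M0: "0 \<le> M" using M by linarith
  have 1: "\<bar>c\<^sup>2 * (\<alpha> - p)\<bar> \<le> c\<^sup>2 * (2 * M)" by (rule abs_mult_le) (use M in auto)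
  have "\<bar>sin \<theta>\<bar> \<le> \<bar>\<theta>\<bar>" by (rule abs_sin_x_le_abs_x)
  then have "(sin \<theta>)\<^sup>2 \<le> \<theta>\<^sup>2" by (rule abs_le_square_iff[THEN iffD1])
  then have "s\<^sup>2 * (sin \<theta>)\<^sup>2 \<le> 1 * \<theta>\<^sup>2" using s2 by (intro mult_mono) auto
  then have 2: "\<bar>s\<^sup>2 * (sin \<theta>)\<^sup>2 * (q - p)\<bar> \<le> \<theta>\<^sup>2 * (2 * M)" by (intro abs_mult_le) (use M in auto)
  have "\<bar>s\<^sup>2 * (2 * sin \<theta> * cos \<theta>)\<bar> \<le> 1 * 1"
    by (intro abs_mult_le two_mult_le_one) (use s2 in auto)
  then have 3: "\<bar>s\<^sup>2 * (2 * sin \<theta> * cos \<theta>) * \<gamma>\<bar> \<le> 1 * \<eta>" by (intro abs_mult_le \<eta>) simp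
  have 4: "\<bar>2 * c * s * (cos \<theta> * x + sin \<theta> * y)\<bar> \<le> 1 * (2 * \<eta>)"
    by (intro abs_mult_le two_mult_le_one abs_cos_sin_comb_le \<eta> cs)
  show ?thesis unfolding eq using 1 2 3 4 e by (simp add: mult.commute mult.left_commute)
qed

text \<open>By closeness to \<open>p\<close> and \<open>q\<close> the form is at least
  \<open>d\<close> at \<open>\<theta>0\<close> and at most \<open>d\<close> at
  \<open>pi / 2 - \<theta>0\<close>, so the intermediate value theorem applies. Keeping the distance
  \<open>\<theta>0\<close> from both ends bounds the slope away from 0 in the next estimate.\<close>

lemma trig_form_root:
  assumes cs: "c\<^sup>2 + s\<^sup>2 = 1" and M: "\<bar>\<alpha>\<bar> \<le> M" "\<bar>p\<bar> \<le> M" "\<bar>q\<bar> \<le> M"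
    and \<eta>: "\<bar>\<gamma>\<bar> \<le> \<eta>" "\<bar>x\<bar> \<le> \<eta>" "\<bar>y\<bar> \<le> \<eta>"
    and e: "2 * M * c\<^sup>2 \<le> e / 4" "2 * M * \<theta>0\<^sup>2 \<le> e / 4" "6 * \<eta> \<le> e"
    and pq: "p \<ge> b + e" "q \<le> a - e" and d: "a \<le> d" "d \<le> b" and \<theta>0: "\<theta>0 \<le> pi / 4"
  shows "\<exists>\<theta>\<in>{\<theta>0..pi / 2 - \<theta>0}. trig_form c s \<alpha> p q \<gamma> x y \<theta> = d"
proof -
  have "\<bar>trig_form c s \<alpha> p q \<gamma> x y \<theta>0 - p\<bar> \<le> e"
    by (rule trig_form_close[OF cs M \<eta> e])
  then have 1: "d \<le> trig_form c s \<alpha> p q \<gamma> x y \<theta>0" using pq d by linarith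
  have "\<bar>trig_form c s \<alpha> q p \<gamma> y x \<theta>0 - q\<bar> \<le> e"
    by (rule trig_form_close[OF cs M(1,3,2) \<eta>(1,3,2) e])
  then have 2: "trig_form c s \<alpha> p q \<gamma> x y (pi / 2 - \<theta>0) \<le> d" using pq d by (simp add: trig_form_swap)
  have "\<exists>\<theta>. \<theta>0 \<le> \<theta> \<and> \<theta> \<le> pi / 2 - \<theta>0 \<and> trig_form c s \<alpha> p q \<gamma> x y \<theta> = d"
    by (rule IVT2'[where f = "trig_form c s \<alpha> p q \<gamma> x y", OF 2 1]) (use \<theta>0 in \<open>auto simp: trig_form_def intro!: continuous_intros\<close>)
  then show ?thesis by auto
qed

lemma sin_double_ge:
  assumes "0 \<le> \<theta>0" "\<theta>0 \<le> \<theta>" "\<theta> \<le> pi / 2 - \<theta>0" shows "sin (2 * \<theta>0) \<le> sin (2 * \<theta>)"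
proof (cases "2 * \<theta> \<le> pi / 2")
  case True
  then show ?thesis using assms by (intro sin_monotone_2pi_le) auto
next
  case False
  then have "sin (2 * \<theta>0) \<le> sin (pi - 2 * \<theta>)" using assms by (intro sin_monotone_2pi_le) auto
  then show ?thesis by simp
qed

text \<open>The leading part of the derivative is
  \<open>- s\<^sup>2 * sin (2 * \<theta>) * (p - q)\<close>, which is at most
  \<open>- e * sin (2 * \<theta>0)\<close>. The off-diagonal entries contribute at most
  \<open>4 * \<eta>\<close>, no more than half of that.\<close>

lemma trig_form_strict_antimono:
  assumes cs: "c\<^sup>2 + s\<^sup>2 = 1" "s\<^sup>2 \<ge> 1 / 2" and \<eta>: "\<bar>\<gamma>\<bar> \<le> \<eta>" "\<bar>x\<bar> \<le> \<eta>" "\<bar>y\<bar> \<le> \<eta>"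
    and pq: "p - q \<ge> 2 * e" "e > 0" and \<theta>0: "0 \<le> \<theta>0" and \<eta>e: "8 * \<eta> \<le> e * sin (2 * \<theta>0)"
    and \<theta>: "\<theta>0 \<le> \<theta>1" "\<theta>1 \<le> \<theta>2" "\<theta>2 \<le> pi / 2 - \<theta>0"
  shows "e / 2 * sin (2 * \<theta>0) * (\<theta>2 - \<theta>1) \<le> trig_form c s \<alpha> p q \<gamma> x y \<theta>1 - trig_form c s \<alpha> p q \<gamma> x y \<theta>2"
proof (cases "\<theta>1 = \<theta>2")
  case False
  define D where "D \<theta> = - (s\<^sup>2 * sin (2 * \<theta>) * (p - q)) + 2 * s\<^sup>2 * (cos (2 * \<theta>) * \<gamma>) + 2 * c * s * (cos \<theta> * y - sin \<theta> * x)" for \<theta>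
  have der: "(trig_form c s \<alpha> p q \<gamma> x y has_real_derivative D \<theta>) (at \<theta>)" for \<theta>
    unfolding trig_form_def[abs_def] D_def sin_double cos_double
    by (rule derivative_eq_intros refl | simp)+
       (simp add: algebra_simps power2_eq_square)
  obtain z where z: "\<theta>1 < z" "z < \<theta>2"
    "trig_form c s \<alpha> p q \<gamma> x y \<theta>2 - trig_form c s \<alpha> p q \<gamma> x y \<theta>1 = (\<theta>2 - \<theta>1) * D z"
    using MVT2[of \<theta>1 \<theta>2 "trig_form c s \<alpha> p q \<gamma> x y" D] False \<theta> der by auto
  have s0: "0 \<le> sin (2 * \<theta>0)" using \<theta> \<theta>0 by (intro sin_ge_zero) auto
  have "1 / 2 * sin (2 * \<theta>0) * (2 * e) \<le> s\<^sup>2 * sin (2 * z) * (p - q)"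
    using sin_double_ge[of \<theta>0 z] z \<theta> \<theta>0 pq cs(2) s0 by (intro mult_mono) auto
  moreover have "s\<^sup>2 \<le> 1" using cs(1) zero_le_power2[of c] by linarith
  then have "\<bar>2 * s\<^sup>2 * (cos (2 * z) * \<gamma>)\<bar> \<le> 2 * (1 * \<eta>)"
    by (intro abs_mult_le \<eta> abs_cos_le_one) (auto simp: abs_mult)
  moreover have "\<bar>2 * c * s * (cos z * y - sin z * x)\<bar> \<le> 1 * (2 * \<eta>)"
    using abs_cos_sin_comb_le[of y \<eta> "- x" z] \<eta> by (intro abs_mult_le two_mult_le_one cs(1)) simp
  moreover have "- U + V + W \<le> - (e / 2 * S)"
    if "1 / 2 * S * (2 * e) \<le> U" "\<bar>V\<bar> \<le> 2 * (1 * \<eta>)" "\<bar>W\<bar> \<le> 1 * (2 * \<eta>)" "8 * \<eta> \<le> e * S" for U V W S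
    using that by (simp add: field_simps)
  ultimately have "D z \<le> - (e / 2 * sin (2 * \<theta>0))"
    using \<eta>e unfolding D_def by blast
  then have "(\<theta>2 - \<theta>1) * D z \<le> (\<theta>2 - \<theta>1) * - (e / 2 * sin (2 * \<theta>0))"
    using \<theta> by (intro mult_left_mono) auto
  then show ?thesis using z(3) by (simp add: algebra_simps)
qed simp

text \<open>The point is the small weights \<open>c\<^sup>2\<close> and \<open>2 * c\<close> on the
  entries that involve \<open>u\<close>: they limit the influence of \<open>u\<close> on the
  angle.\<close>

lemma trig_form_diff_le:
  assumes cs: "c\<^sup>2 + s\<^sup>2 = 1" "0 \<le> c"
  shows "\<bar>trig_form c s \<alpha> p q \<gamma> x y \<theta> - trig_form c s \<alpha>' p' q' \<gamma>' x' y' \<theta>\<bar> \<le>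
    c\<^sup>2 * \<bar>\<alpha> - \<alpha>'\<bar> + \<bar>p - p'\<bar> + \<bar>q - q'\<bar> + \<bar>\<gamma> - \<gamma>'\<bar> + 2 * c * (\<bar>x - x'\<bar> + \<bar>y - y'\<bar>)"
proof -
  have eq: "trig_form c s \<alpha> p q \<gamma> x y \<theta> - trig_form c s \<alpha>' p' q' \<gamma>' x' y' \<theta> =
      c\<^sup>2 * (\<alpha> - \<alpha>') + s\<^sup>2 * ((cos \<theta>)\<^sup>2 * (p - p')) + s\<^sup>2 * ((sin \<theta>)\<^sup>2 * (q - q')) +
      s\<^sup>2 * (2 * sin \<theta> * cos \<theta> * (\<gamma> - \<gamma>')) + 2 * c * s * (cos \<theta> * (x - x') + sin \<theta> * (y - y'))"
    by (simp add: trig_form_def algebra_simps)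
  have s2: "s\<^sup>2 \<le> 1" using cs zero_le_power2[of c] by linarith
  have s1: "\<bar>s\<bar> \<le> 1" using s2 by (simp add: abs_square_le_1)
  have 1: "\<bar>c\<^sup>2 * (\<alpha> - \<alpha>')\<bar> \<le> c\<^sup>2 * \<bar>\<alpha> - \<alpha>'\<bar>" by (simp add: abs_mult)
  have 2: "\<bar>s\<^sup>2 * ((cos \<theta>)\<^sup>2 * (p - p'))\<bar> \<le> 1 * (1 * \<bar>p - p'\<bar>)"
    by (intro abs_mult_le) (use s2 in \<open>auto simp: abs_square_le_1\<close>)
  have 3: "\<bar>s\<^sup>2 * ((sin \<theta>)\<^sup>2 * (q - q'))\<bar> \<le> 1 * (1 * \<bar>q - q'\<bar>)"
    by (intro abs_mult_le) (use s2 in \<open>auto simp: abs_square_le_1\<close>)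
  have 4: "\<bar>s\<^sup>2 * (2 * sin \<theta> * cos \<theta> * (\<gamma> - \<gamma>'))\<bar> \<le> 1 * (1 * \<bar>\<gamma> - \<gamma>'\<bar>)"
    by (intro abs_mult_le two_mult_le_one) (use s2 in auto)
  have 5: "\<bar>2 * c * s * (cos \<theta> * (x - x') + sin \<theta> * (y - y'))\<bar> \<le> (2 * c * 1) * (\<bar>x - x'\<bar> + \<bar>y - y'\<bar>)"
  proof (intro abs_mult_le)
    show "\<bar>cos \<theta> * (x - x') + sin \<theta> * (y - y')\<bar> \<le> \<bar>x - x'\<bar> + \<bar>y - y'\<bar>"
      using abs_mult_le[OF abs_cos_le_one order_refl, of \<theta> "x - x'"] abs_mult_le[OF abs_sin_le_one order_refl, of \<theta> "y - y'"]
      by (intro order_trans[OF abs_triangle_ineq add_mono]) simp_all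
  qed (use cs s1 in auto)
  have tri: "\<bar>u\<bar> \<le> u' \<Longrightarrow> \<bar>v\<bar> \<le> v' \<Longrightarrow> \<bar>u + v\<bar> \<le> u' + v'" for u u' v v' :: real by linarith
  show ?thesis unfolding eq using tri[OF tri[OF tri[OF tri[OF 1 2] 3] 4] 5] by (simp only: mult_1 mult_1_right)
qed

section \<open>Rotations of two chosen indices\<close>

definition givens :: "'i \<Rightarrow> 'i \<Rightarrow> real \<Rightarrow> real \<Rightarrow> ('i \<Rightarrow> 'v::real_vector) \<Rightarrow> 'i \<Rightarrow> 'v" where
  "givens j k x y f = f(j := x *\<^sub>R f j + y *\<^sub>R f k, k := x *\<^sub>R f k - y *\<^sub>R f j)"

lemma givens_conv_rotate_family:
  assumes "j \<noteq> k"
  shows "givens j k x y f = rotate_family (\<lambda>i. if i \<in> {j, k} then x else 1)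
      (\<lambda>i. if i = j then y else if i = k then - y else 0) (id(j := k, k := j)) f"
  using assms by (auto simp: givens_def rotate_family_def fun_eq_iff)

lemma rotation_givens:
  assumes "j \<in> I" "k \<in> I" "j \<noteq> k" "x\<^sup>2 + y\<^sup>2 = 1"
  shows "rotation I (\<lambda>i. if i \<in> {j, k} then x else 1)
      (\<lambda>i. if i = j then y else if i = k then - y else 0) (id(j := k, k := j))"
  using assms by (auto simp: rotation_def)

lemma cspan_givens:
  fixes f :: "'i \<Rightarrow> 'h::complex_vector"
  assumes "j \<in> S" "k \<in> S" "j \<noteq> k" "x\<^sup>2 + y\<^sup>2 = 1"
  shows "cspan (givens j k x y f ` S) = cspan (f ` S)"
  unfolding givens_conv_rotate_family[OF assms(3)]
  by (rule cspan_rotate_family[OF rotation_givens[OF assms] order_refl]) (use assms in auto)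

lemma (in hilbert_ip) orthonormal_on_givens:
  assumes "orthonormal_on I f" "j \<in> I" "k \<in> I" "j \<noteq> k" "x\<^sup>2 + y\<^sup>2 = 1"
  shows "orthonormal_on I (givens j k x y f)"
  unfolding givens_conv_rotate_family[OF assms(4)]
  by (rule orthonormal_on_rotate_family[OF assms(1) rotation_givens[OF assms(2-)]])

lemma cspan_Un_cong: "cspan A = cspan B \<Longrightarrow> cspan (A \<union> C) = cspan (B \<union> C)"
proof (rule cspan_eqI)
  assume "cspan A = cspan B"
  then have "A \<subseteq> cspan B" "B \<subseteq> cspan A" using cspan_base by blast+
  then show "A \<union> C \<subseteq> cspan (B \<union> C)" "B \<union> C \<subseteq> cspan (A \<union> C)"
    using cspan_mono[of B "B \<union> C"] cspan_mono[of A "A \<union> C"] cspan_base[of _ "A \<union> C"] cspan_base[of _ "B \<union> C"]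
    by blast+
qed

text \<open>The frame \<open>h\<close> with its constants. \<open>F n\<close> is the
  time-independent span of the blocks up to \<open>n\<close>; block \<open>Suc n\<close> supplies
  the extremal pair of step \<open>n\<close>. The weights of each chain rotation are
  \<open>c\<close> and \<open>s\<close>, angles keep the distance \<open>\<theta>0\<close> from 0
  and \<open>pi / 2\<close>, \<open>\<eta>\<close> bounds off-diagonal entries, and \<open>L\<close>
  is the factor by which the moduli of the vectors may exceed those of the data.
  \<open>L_large\<close> makes \<open>L\<close> absorb everything that does not come from the
  modulus of \<open>u\<close>.\<close>

locale diagonal_setup = hilbert_ip ci
  for ci :: "'h::{complex_normed_vector, banach} \<Rightarrow> 'h \<Rightarrow> complex" +
  fixes A :: "real \<Rightarrow> 'h \<Rightarrow>\<^sub>L 'h" and d :: "nat \<Rightarrow> real \<Rightarrow> real"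
    and a b e M c s \<eta> \<theta>0 \<Lambda> L :: real and N :: nat
    and h :: "nat \<times> nat \<Rightarrow> real \<Rightarrow> 'h" and F :: "nat \<Rightarrow> 'h set"
  assumes A_sa: "t \<in> {0..1} \<Longrightarrow> selfadjoint_op ci (A t)"
    and A_bound: "t \<in> {0..1} \<Longrightarrow> norm (A t) \<le> M"
    and d_range: "t \<in> {0..1} \<Longrightarrow> a \<le> d n t" "t \<in> {0..1} \<Longrightarrow> d n t \<le> b"
    and N: "N \<ge> 2"
    and h_on: "t \<in> {0..1} \<Longrightarrow> orthonormal_on {i. snd i \<le> N} (\<lambda>i. h i t)"
    and h_span: "t \<in> {0..1} \<Longrightarrow> cspan ((\<lambda>i. h i t) ` {i. snd i \<le> N \<and> fst i \<le> n}) = F n"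
    and h_lip: "snd i \<le> N \<Longrightarrow> norm (h i t - h i t') \<le> \<Lambda> * \<bar>t - t'\<bar>"
    and total: "closure (\<Union>n. F n) = UNIV"
    and upper: "t \<in> {0..1} \<Longrightarrow> b + e \<le> Re (ci (h (Suc n, 0) t) (A t (h (Suc n, 0) t)))"
    and lower: "t \<in> {0..1} \<Longrightarrow> Re (ci (h (Suc n, 1) t) (A t (h (Suc n, 1) t))) \<le> a - e"
    and off: "t \<in> {0..1} \<Longrightarrow> \<bar>Re (ci (h (Suc n, 1) t) (A t (h (Suc n, 0) t)))\<bar> \<le> \<eta>"
    and almost_orth: "t \<in> {0..1} \<Longrightarrow> y \<in> F n \<Longrightarrow> \<bar>Re (ci y (A t (h (Suc n, 0) t)))\<bar> \<le> \<eta> * norm y"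
      "t \<in> {0..1} \<Longrightarrow> y \<in> F n \<Longrightarrow> \<bar>Re (ci y (A t (h (Suc n, 1) t)))\<bar> \<le> \<eta> * norm y"
    and cs: "c\<^sup>2 + s\<^sup>2 = 1" "0 < c" "c \<le> 1 / 2" "0 < s"
    and M: "1 \<le> M" and e: "0 < e" and \<Lambda>: "0 \<le> \<Lambda>" and L: "0 \<le> L" and \<theta>0: "0 < \<theta>0" "\<theta>0 \<le> pi / 4"
    and small: "2 * M * c\<^sup>2 \<le> e / 4" "2 * M * \<theta>0\<^sup>2 \<le> e / 4" "6 * \<eta> \<le> e" "8 * \<eta> \<le> e * sin (2 * \<theta>0)"
      "\<eta> \<le> c" "48 * M * c \<le> e / 2 * sin (2 * \<theta>0)"
    and L_large: "2 * (9 + 10 * M * \<Lambda>) / (e / 2 * sin (2 * \<theta>0)) + 2 * \<Lambda> \<le> c * L / 4"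
begin

abbreviation "I \<equiv> {i::nat \<times> nat. snd i \<le> N}"
abbreviation "J n \<equiv> {i::nat \<times> nat. snd i \<le> N \<and> fst i \<le> n}"

definition qf :: "real \<Rightarrow> 'h \<Rightarrow> 'h \<Rightarrow> real" where "qf t x y = Re (ci x (A t y))"

text \<open>Moduli of continuity in pointwise form: one \<open>R\<close> dominates all increments
  between \<open>t\<close> and \<open>t'\<close>. Letting \<open>R\<close> depend on finitely many
  functions gives continuity, an \<open>R\<close> common to all of them equicontinuity.\<close>

definition modulus :: "real \<Rightarrow> real \<Rightarrow> real \<Rightarrow> nat \<Rightarrow> bool" where
  "modulus t t' R n \<longleftrightarrow> t \<in> {0..1} \<and> t' \<in> {0..1} \<and> \<bar>t - t'\<bar> \<le> R \<and> norm (A t - A t') \<le> R \<and>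
     (\<forall>k<n. \<bar>d k t - d k t'\<bar> \<le> R)"

lemma qf_add: "qf t (x + y) z = qf t x z + qf t y z" "qf t z (x + y) = qf t z x + qf t z y"
  and qf_scale: "qf t (r *\<^sub>R x) z = r * qf t x z" "qf t z (r *\<^sub>R x) = r * qf t z x"
  by (simp_all add: qf_def ci_bilinear blinfun.add_right blinfun.scaleR_right)

lemma qf_sym: assumes "t \<in> {0..1}" shows "qf t x y = qf t y x"
proof -
  have "ci x (A t y) = ci (A t x) y" using A_sa[OF assms] by (simp add: selfadjoint_op_def)
  then show ?thesis using ci_cnj[of "A t x" y] by (simp add: qf_def)
qed

lemma norm_A_le: "t \<in> {0..1} \<Longrightarrow> norm (A t x) \<le> M * norm x"
  using norm_blinfun[of "A t" x] A_bound[of t] by (meson mult_right_mono norm_ge_zero order_trans)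

lemma abs_Re_ci_le: "\<bar>Re (ci x y)\<bar> \<le> norm x * norm y"
  using abs_Re_le_cmod cauchy_schwarz order_trans by blast

lemma norm_A_diff_le:
  assumes m: "modulus t t' R n" and x: "norm x = 1"
  shows "norm (A t x - A t' x') \<le> R + M * norm (x - x')"
proof -
  have "A t x - A t' x' = (A t - A t') x + A t' (x - x')"
    by (simp add: blinfun.diff_left blinfun.diff_right)
  also have "norm \<dots> \<le> norm ((A t - A t') x) + norm (A t' (x - x'))" by (rule norm_triangle_ineq)
  also have "\<dots> \<le> R + M * norm (x - x')"
    using norm_blinfun[of "A t - A t'" x] x m norm_A_le[of t' "x - x'"] by (intro add_mono) (auto simp: modulus_def)
  finally show ?thesis .
qed

text \<open>The first bound keeps the term with \<open>x - x'\<close>, so that almost-orthogonality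
  can be used on it; the second estimates it by the operator norm.\<close>

lemma qf_diff_le:
  assumes m: "modulus t t' R n" and n: "norm x' = 1" "norm y = 1"
  shows "\<bar>qf t x y - qf t' x' y'\<bar> \<le> \<bar>qf t (x - x') y\<bar> + (R + M * norm (y - y'))"
    and "\<bar>qf t x y - qf t' x' y'\<bar> \<le> R + M * norm (x - x') + M * norm (y - y')"
proof -
  have "qf t x y - qf t' x' y' = qf t (x - x') y + Re (ci x' (A t y - A t' y'))"
    by (simp add: qf_def ci_bilinear)
  moreover have "\<bar>Re (ci x' (A t y - A t' y'))\<bar> \<le> R + M * norm (y - y')"
    using abs_Re_ci_le[of x' "A t y - A t' y'"] norm_A_diff_le[OF m n(2), of y'] n(1) by simp
  ultimately show 1: "\<bar>qf t x y - qf t' x' y'\<bar> \<le> \<bar>qf t (x - x') y\<bar> + (R + M * norm (y - y'))" by linarith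
  have "\<bar>qf t (x - x') y\<bar> \<le> norm (x - x') * norm (A t y)" unfolding qf_def by (rule abs_Re_ci_le)
  also have "\<dots> \<le> norm (x - x') * (M * 1)"
    using norm_A_le[of t y] n m by (intro mult_left_mono) (auto simp: modulus_def)
  finally show "\<bar>qf t x y - qf t' x' y'\<bar> \<le> R + M * norm (x - x') + M * norm (y - y')"
    using 1 by (simp add: mult.commute)
qed

lemma qf_combination:
  assumes t: "t \<in> {0..1}"
  shows "qf t (s *\<^sub>R (cos \<theta> *\<^sub>R p + sin \<theta> *\<^sub>R q) + c *\<^sub>R u) (s *\<^sub>R (cos \<theta> *\<^sub>R p + sin \<theta> *\<^sub>R q) + c *\<^sub>R u) =
    trig_form c s (qf t u u) (qf t p p) (qf t q q) (qf t q p) (qf t u p) (qf t u q) \<theta>"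
  unfolding trig_form_def
  by (simp add: qf_add qf_scale qf_sym[OF t, of p q] qf_sym[OF t, of p u] qf_sym[OF t, of q u]
      algebra_simps power2_eq_square)

lemma norm_h: "t \<in> {0..1} \<Longrightarrow> snd i \<le> N \<Longrightarrow> norm (h i t) = 1"
  using orthonormal_on_norm[OF h_on] by simp

lemma abs_qf_le: "t \<in> {0..1} \<Longrightarrow> norm x = 1 \<Longrightarrow> \<bar>qf t x x\<bar> \<le> M"
  unfolding qf_def using abs_Re_ci_le[of x "A t x"] norm_A_le[of t x] by simp

lemma csubspace_F: "csubspace (F n)"
  using h_span[of 0 n] csubspace_cspan[of "(\<lambda>i. h i 0) ` J n"] by simp

text \<open>The square of \<open>1 - c\<^sup>2 / 2\<close> exceeds \<open>s\<^sup>2\<close> by the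
  square of \<open>c\<^sup>2 / 2\<close>. The gain \<open>c\<^sup>2 / 2\<close> is what keeps the
  moduli bounded along the chain.\<close>

lemma s_le: "s \<le> 1 - c\<^sup>2 / 2" "s\<^sup>2 \<ge> 1 / 2" "s \<le> 1"
proof -
  have c1: "c\<^sup>2 \<le> (1 / 2)\<^sup>2" using cs by (intro power_mono) auto
  then show s2: "s\<^sup>2 \<ge> 1 / 2" using cs by (simp add: power2_eq_square)
  have "(1 - c\<^sup>2 / 2)\<^sup>2 = s\<^sup>2 + (c\<^sup>2 / 2)\<^sup>2" using cs(1) by (simp add: power2_diff)
  then have "s\<^sup>2 \<le> (1 - c\<^sup>2 / 2)\<^sup>2" by simp
  then show "s \<le> 1 - c\<^sup>2 / 2" by (rule power2_le_imp_le) (use c1 in \<open>simp add: power2_eq_square\<close>)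
  then show "s \<le> 1" using zero_le_power2[of c] by linarith
qed

text \<open>The form decreases in the angle with slope at least \<kappa>, so the root varies by at
  most \<open>1 / \<kappa>\<close> times the variation of the form and of \<open>d n\<close>. The
  contribution of \<open>u\<close> carries a factor of order \<open>c\<^sup>2\<close>, so for small
  \<open>c\<close> the total is at most half of \<open>c * (L * R)\<close>.\<close>

lemma angle_exists:
  assumes u: "\<And>t. t \<in> {0..1} \<Longrightarrow> norm (u t) = 1 \<and> u t \<in> F n"
  obtains \<theta> where
    "\<And>t. t \<in> {0..1} \<Longrightarrow> qf t (s *\<^sub>R (cos (\<theta> t) *\<^sub>R h (Suc n, 0) t + sin (\<theta> t) *\<^sub>R h (Suc n, 1) t) + c *\<^sub>R u t)
       (s *\<^sub>R (cos (\<theta> t) *\<^sub>R h (Suc n, 0) t + sin (\<theta> t) *\<^sub>R h (Suc n, 1) t) + c *\<^sub>R u t) = d n t"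
    "\<And>t t' R. modulus t t' R (Suc n) \<Longrightarrow> norm (u t - u t') \<le> L * R \<Longrightarrow>
       2 * \<bar>\<theta> t - \<theta> t'\<bar> + 2 * (\<Lambda> * R) \<le> c / 2 * (L * R)"
proof -
  define p where "p = h (Suc n, 0)"
  define q where "q = h (Suc n, 1)"
  define tf where "tf t = trig_form c s (qf t (u t) (u t)) (qf t (p t) (p t)) (qf t (q t) (q t)) (qf t (q t) (p t))
      (qf t (u t) (p t)) (qf t (u t) (q t))" for t
  have np: "norm (p t) = 1" "norm (q t) = 1" if "t \<in> {0..1}" for t
    using norm_h[OF that] N by (auto simp: p_def q_def)
  have \<eta>: "\<bar>qf t (q t) (p t)\<bar> \<le> \<eta>" "\<bar>qf t (u t) (p t)\<bar> \<le> \<eta>" "\<bar>qf t (u t) (q t)\<bar> \<le> \<eta>"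
    if "t \<in> {0..1}" for t
    using off[OF that, of n] almost_orth[OF that, of "u t" n] u[OF that] by (auto simp: qf_def p_def q_def)
  have pq: "b + e \<le> qf t (p t) (p t)" "qf t (q t) (q t) \<le> a - e" if "t \<in> {0..1}" for t
    using upper[OF that] lower[OF that] by (auto simp: qf_def p_def q_def)
  have "\<exists>\<theta>\<in>{\<theta>0..pi / 2 - \<theta>0}. tf t \<theta> = d n t" if t: "t \<in> {0..1}" for t
    unfolding tf_def using u[OF t] np[OF t]
    by (intro trig_form_root[OF cs(1) _ _ _ \<eta>[OF t] small(1,2,3) pq[OF t] d_range[OF t] \<theta>0(2)] abs_qf_le[OF t]) auto
  then obtain \<theta> where \<theta>: "\<And>t. t \<in> {0..1} \<Longrightarrow> \<theta>0 \<le> \<theta> t \<and> \<theta> t \<le> pi / 2 - \<theta>0 \<and> tf t (\<theta> t) = d n t"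
    by (metis atLeastAtMost_iff)
  define \<kappa> where "\<kappa> = e / 2 * sin (2 * \<theta>0)"
  have \<kappa>0: "\<kappa> > 0" unfolding \<kappa>_def using e \<theta>0 by (intro mult_pos_pos sin_gt_zero) auto
  define C1 where "C1 = 9 + 10 * M * \<Lambda>"
  show thesis
  proof (rule that[of \<theta>])
    fix t :: real assume t: "t \<in> {0..1}"
    show "qf t (s *\<^sub>R (cos (\<theta> t) *\<^sub>R h (Suc n, 0) t + sin (\<theta> t) *\<^sub>R h (Suc n, 1) t) + c *\<^sub>R u t)
       (s *\<^sub>R (cos (\<theta> t) *\<^sub>R h (Suc n, 0) t + sin (\<theta> t) *\<^sub>R h (Suc n, 1) t) + c *\<^sub>R u t) = d n t"
      unfolding qf_combination[OF t] using \<theta>[OF t] by (simp add: tf_def p_def q_def)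
  next
    fix t t' R assume m: "modulus t t' R (Suc n)" and uR: "norm (u t - u t') \<le> L * R"
    have t: "t \<in> {0..1}" "t' \<in> {0..1}" and R: "\<bar>t - t'\<bar> \<le> R" "\<bar>d n t - d n t'\<bar> \<le> R"
      using m by (auto simp: modulus_def)
    have R0: "R \<ge> 0" using R by linarith
    have hR: "norm (h (Suc n, k) t - h (Suc n, k) t') \<le> \<Lambda> * R" if "k \<le> 1" for k
      using h_lip[of "(Suc n, k)" t t'] N R(1) \<Lambda> that by (smt (verit) mult_left_mono snd_conv le_trans one_le_numeral)
    have pR: "norm (p t - p t') \<le> \<Lambda> * R" and qR: "norm (q t - q t') \<le> \<Lambda> * R"
      using hR by (auto simp: p_def q_def)
    have Mp: "M * norm (p t - p t') \<le> M * (\<Lambda> * R)" and Mq: "M * norm (q t - q t') \<le> M * (\<Lambda> * R)"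
      and Mu: "M * norm (u t - u t') \<le> M * (L * R)"
      using pR qR uR M by (auto intro: mult_left_mono)
    note n = np[OF t(1)] np[OF t(2)] u[OF t(1), THEN conjunct1] u[OF t(2), THEN conjunct1]
    define \<alpha>d where "\<alpha>d = \<bar>qf t (u t) (u t) - qf t' (u t') (u t')\<bar>"
    define pd where "pd = \<bar>qf t (p t) (p t) - qf t' (p t') (p t')\<bar>"
    define qd where "qd = \<bar>qf t (q t) (q t) - qf t' (q t') (q t')\<bar>"
    define \<gamma>d where "\<gamma>d = \<bar>qf t (q t) (p t) - qf t' (q t') (p t')\<bar>"
    define xd where "xd = \<bar>qf t (u t) (p t) - qf t' (u t') (p t')\<bar>"
    define yd where "yd = \<bar>qf t (u t) (q t) - qf t' (u t') (q t')\<bar>"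
    have \<alpha>d: "\<alpha>d \<le> R + 2 * M * (L * R)"
      using qf_diff_le(2)[OF m n(6,5), of "u t" "u t'"] Mu unfolding \<alpha>d_def by linarith
    have pd: "pd \<le> R + 2 * M * (\<Lambda> * R)"
      using qf_diff_le(2)[OF m n(3,1), of "p t" "p t'"] Mp unfolding pd_def by linarith
    have qd: "qd \<le> R + 2 * M * (\<Lambda> * R)"
      using qf_diff_le(2)[OF m n(4,2), of "q t" "q t'"] Mq unfolding qd_def by linarith
    have \<gamma>d: "\<gamma>d \<le> R + 2 * M * (\<Lambda> * R)"
      using qf_diff_le(2)[OF m n(4,1), of "q t" "p t'"] Mp Mq unfolding \<gamma>d_def by linarith
    \<comment> \<open>Since \<open>F n\<close> does not depend on time, the increment of
      \<open>u\<close> is itself almost \<open>A t\<close>-orthogonal to the fresh pair. The mixed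
      entries thus react to it with the factor \<open>\<eta> \<le> c\<close> instead of
      \<open>M\<close>.\<close>
    have uF: "u t - u t' \<in> F n" using u t csubspaceD(6)[OF csubspace_F] by blast
    have \<eta>0: "\<eta> \<ge> 0" using \<eta>(1)[OF t(1)] by linarith
    have \<eta>u: "\<eta> * norm (u t - u t') \<le> c * (L * R)"
      using small(5) uR \<eta>0 L R0 cs by (intro mult_mono) auto
    have "\<bar>qf t (u t - u t') (p t)\<bar> \<le> c * (L * R)"
      using almost_orth(1)[OF t(1) uF] \<eta>u by (simp add: qf_def p_def)
    then have xd: "xd \<le> c * (L * R) + (R + M * (\<Lambda> * R))"
      using qf_diff_le(1)[OF m n(6,1), of "u t" "p t'"] Mp unfolding xd_def by linarith
    have "\<bar>qf t (u t - u t') (q t)\<bar> \<le> c * (L * R)"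
      using almost_orth(2)[OF t(1) uF] \<eta>u by (simp add: qf_def q_def)
    then have yd: "yd \<le> c * (L * R) + (R + M * (\<Lambda> * R))"
      using qf_diff_le(1)[OF m n(6,2), of "u t" "q t'"] Mq unfolding yd_def by linarith
    have "\<bar>tf t (\<theta> t') - tf t' (\<theta> t')\<bar> \<le> c\<^sup>2 * \<alpha>d + pd + qd + \<gamma>d + 2 * c * (xd + yd)"
      unfolding tf_def \<alpha>d_def pd_def qd_def \<gamma>d_def xd_def yd_def
      using trig_form_diff_le[OF cs(1)] cs(2) by simp
    also have "\<dots> \<le> c\<^sup>2 * (R + 2 * M * (L * R)) + 3 * (R + 2 * M * (\<Lambda> * R)) +
        2 * c * (2 * (c * (L * R) + (R + M * (\<Lambda> * R))))"
    proof -
      have sum3: "x \<le> r \<Longrightarrow> y \<le> r \<Longrightarrow> z \<le> r \<Longrightarrow> x + y + z \<le> 3 * r" for x y z r :: real by linarith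
      have "c\<^sup>2 * \<alpha>d \<le> c\<^sup>2 * (R + 2 * M * (L * R))" using \<alpha>d by (intro mult_left_mono) auto
      moreover have "2 * c * (xd + yd) \<le> 2 * c * (2 * (c * (L * R) + (R + M * (\<Lambda> * R))))"
        using xd yd cs by (intro mult_left_mono) auto
      moreover have "pd + qd + \<gamma>d \<le> 3 * (R + 2 * M * (\<Lambda> * R))" by (rule sum3[OF pd qd \<gamma>d])
      ultimately show ?thesis using add_mono[OF add_mono] by (simp only: add.assoc)
    qed
    \<comment> \<open>The terms with \<open>L * R\<close> have total weight
      \<open>(2 * M + 4) * c\<^sup>2\<close>, where \<open>1 \<le> M\<close>; in the others powers
      of \<open>c\<close> are replaced by 1.\<close>
    also have "\<dots> \<le> 6 * M * c\<^sup>2 * (L * R) + (8 + 10 * M * \<Lambda>) * R"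
    proof -
      have "c\<^sup>2 \<le> 1" using cs(1) zero_le_power2[of s] by linarith
      then have "c\<^sup>2 * R \<le> 1 * R" using R0 by (intro mult_right_mono)
      moreover have "c * (R + M * (\<Lambda> * R)) \<le> 1 * (R + M * (\<Lambda> * R))"
        using cs R0 M \<Lambda> by (intro mult_right_mono) auto
      moreover have "1 * (c\<^sup>2 * (L * R)) \<le> M * (c\<^sup>2 * (L * R))" using M L R0 by (intro mult_right_mono) auto
      ultimately show ?thesis by (simp add: algebra_simps power2_eq_square)
    qed
    finally have tfd: "\<bar>tf t (\<theta> t') - tf t' (\<theta> t')\<bar> \<le> 6 * M * c\<^sup>2 * (L * R) + (8 + 10 * M * \<Lambda>) * R" .
    have pq2: "2 * e \<le> qf t (p t) (p t) - qf t (q t) (q t)"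
      using pq[OF t(1)] d_range[OF t(1), of n] by linarith
    have dec: "\<kappa> * (\<theta>2 - \<theta>1) \<le> tf t \<theta>1 - tf t \<theta>2" if "\<theta>0 \<le> \<theta>1" "\<theta>1 \<le> \<theta>2" "\<theta>2 \<le> pi / 2 - \<theta>0" for \<theta>1 \<theta>2
      unfolding tf_def \<kappa>_def
      by (rule trig_form_strict_antimono[OF cs(1) s_le(2) \<eta>[OF t(1)] pq2 e less_imp_le[OF \<theta>0(1)] small(4) that])
    have "\<kappa> * \<bar>\<theta> t - \<theta> t'\<bar> \<le> \<bar>tf t (\<theta> t) - tf t (\<theta> t')\<bar>"
    proof (cases "\<theta> t \<le> \<theta> t'")
      case True
      then have "\<kappa> * (\<theta> t' - \<theta> t) \<le> tf t (\<theta> t) - tf t (\<theta> t')"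
        using \<theta>[OF t(1)] \<theta>[OF t(2)] by (intro dec) auto
      then show ?thesis using True by (simp add: abs_real_def)
    next
      case False
      then have "\<kappa> * (\<theta> t - \<theta> t') \<le> tf t (\<theta> t') - tf t (\<theta> t)"
        using \<theta>[OF t(1)] \<theta>[OF t(2)] by (intro dec) auto
      then show ?thesis using False by (simp add: abs_real_def)
    qed
    \<comment> \<open>Both angles solve their equations, so the variation of \<open>d n\<close>
      enters as one more \<open>R\<close>, turning 8 into 9.\<close>
    also have "\<dots> \<le> 6 * M * c\<^sup>2 * (L * R) + C1 * R"
      using tfd R(2) \<theta>[OF t(1)] \<theta>[OF t(2)] by (simp add: C1_def algebra_simps)
    finally have "\<kappa> * \<bar>\<theta> t - \<theta> t'\<bar> \<le> 6 * M * c\<^sup>2 * (L * R) + C1 * R" .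
    then have "\<bar>\<theta> t - \<theta> t'\<bar> * \<kappa> \<le> 6 * M * c\<^sup>2 * (L * R) + C1 * R" by (simp only: mult.commute[of \<kappa>])
    then have "\<bar>\<theta> t - \<theta> t'\<bar> \<le> (6 * M * c\<^sup>2 * (L * R) + C1 * R) / \<kappa>"
      unfolding pos_le_divide_eq[OF \<kappa>0] .
    then have "2 * \<bar>\<theta> t - \<theta> t'\<bar> \<le> 2 * ((6 * M * c\<^sup>2 * (L * R) + C1 * R) / \<kappa>)"
      by (intro mult_left_mono) simp_all
    also have "\<dots> = (12 * M * c / \<kappa>) * (c * (L * R)) + (2 * C1 / \<kappa>) * R"
      by (simp add: field_simps power2_eq_square add_divide_distrib)
    \<comment> \<open>A quarter of \<open>c * (L * R)\<close> covers the modulus of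
      \<open>u\<close>; \<open>L_large\<close> fits the rest into another quarter.\<close>
    also have "\<dots> \<le> 1 / 4 * (c * (L * R)) + (2 * C1 / \<kappa>) * R"
    proof -
      have "12 * M * c / \<kappa> \<le> 1 / 4" using small(6)[folded \<kappa>_def] \<kappa>0 by (simp add: pos_divide_le_eq)
      then show ?thesis using cs L R0 by (intro add_mono mult_right_mono) auto
    qed
    finally have "2 * \<bar>\<theta> t - \<theta> t'\<bar> + 2 * (\<Lambda> * R) \<le> 1 / 4 * (c * (L * R)) + (2 * C1 / \<kappa> + 2 * \<Lambda>) * R"
      by (simp add: algebra_simps)
    also have "\<dots> \<le> 1 / 4 * (c * (L * R)) + (c * L / 4) * R"
      using L_large R0 by (intro add_left_mono mult_right_mono) (auto simp: C1_def \<kappa>_def)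
    also have "\<dots> = c / 2 * (L * R)" by simp
    finally show "2 * \<bar>\<theta> t - \<theta> t'\<bar> + 2 * (\<Lambda> * R) \<le> c / 2 * (L * R)" .
  qed
qed

end

section \<open>The chain of rotations\<close>

lemma csubspace_closure:
  assumes V: "csubspace (V :: 'a::complex_normed_vector set)" shows "csubspace (closure V)"
  unfolding csubspace_def
proof (intro conjI ballI allI)
  show "0 \<in> closure V" using csubspaceD(1)[OF V] closure_subset by blast
next
  fix x y assume "x \<in> closure V" "y \<in> closure V"
  then obtain f g where "\<And>n. f n \<in> V" "f \<longlonglongrightarrow> x" "\<And>n. g n \<in> V" "g \<longlonglongrightarrow> y"
    unfolding closure_sequential by blast
  then have "\<forall>n. f n + g n \<in> V" "(\<lambda>n. f n + g n) \<longlonglongrightarrow> x + y"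
    by (auto intro: csubspaceD(2)[OF V] tendsto_add)
  then show "x + y \<in> closure V" unfolding closure_sequential by (intro exI[of _ "\<lambda>n. f n + g n"] conjI)
next
  fix c x assume "x \<in> closure V"
  then obtain f where "\<And>n. f n \<in> V" "f \<longlonglongrightarrow> x" unfolding closure_sequential by blast
  then have "\<forall>n. c *\<^sub>C f n \<in> V" "(\<lambda>n. c *\<^sub>C f n) \<longlonglongrightarrow> c *\<^sub>C x"
    by (auto intro: csubspaceD(3)[OF V] bounded_linear.tendsto[OF bounded_linear_scaleC_right])
  then show "c *\<^sub>C x \<in> closure V" unfolding closure_sequential by (intro exI[of _ "\<lambda>n. c *\<^sub>C f n"] conjI)
qed

context diagonal_setup
begin

text \<open>
  The chain extended at step \<open>n\<close>. Positions \<open>(Suc k, 0)\<close> hold finished basis vectors and are never visited again.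
\<close>
definition visit :: "nat \<Rightarrow> nat \<times> nat" where
  "visit n = (let j = prod_decode (fst (prod_decode n)) in if snd j \<le> N \<and> (fst j = 0 \<or> snd j \<noteq> 0) then j else (0, 0))"

lemma visit: "snd (visit n) \<le> N" "fst (visit n) = 0 \<or> snd (visit n) \<noteq> 0" "fst (visit n) \<le> n"
proof -
  define l where "l = fst (prod_decode n)"
  have "l \<le> n" using le_prod_encode_1[of l "snd (prod_decode n)"] by (simp add: l_def)
  moreover have "fst (prod_decode l) \<le> l"
    using le_prod_encode_1[of "fst (prod_decode l)" "snd (prod_decode l)"] by simp
  ultimately show "snd (visit n) \<le> N" "fst (visit n) = 0 \<or> snd (visit n) \<noteq> 0" "fst (visit n) \<le> n"
    by (auto simp: visit_def Let_def simp flip: l_def)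
qed

text \<open>The second component of the outer pair is a free counter, so every admissible index
  recurs arbitrarily late.\<close>

lemma visit_infinitely_often:
  assumes "snd i \<le> N" "fst i = 0 \<or> snd i \<noteq> 0"
  obtains n where "n \<ge> l" "visit n = i"
proof (rule that)
  show "prod_encode (prod_encode i, l) \<ge> l" by (rule le_prod_encode_2)
  show "visit (prod_encode (prod_encode i, l)) = i" using assms by (simp add: visit_def)
qed

text \<open>The invariant after \<open>n\<close> steps: blocks beyond \<open>n\<close> are
  untouched, the others still span \<open>F n\<close>, and the factor \<open>L\<close> in the moduli
  has not grown.\<close>

definition stage :: "nat \<Rightarrow> (nat \<times> nat \<Rightarrow> real \<Rightarrow> 'h) \<Rightarrow> bool" where
  "stage n g \<longleftrightarrow> (\<forall>t\<in>{0..1}. orthonormal_on I (\<lambda>i. g i t)) \<and>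
     (\<forall>i. fst i > n \<longrightarrow> g i = h i) \<and>
     (\<forall>t\<in>{0..1}. cspan ((\<lambda>i. g i t) ` J n) = F n) \<and>
     (\<forall>t t' R. modulus t t' R n \<longrightarrow> (\<forall>i\<in>I. norm (g i t - g i t') \<le> L * R))"

text \<open>Position \<open>(Suc n, 0)\<close> receives the finished vector, the visited position
  the remainder. Of the fresh partner \<open>w\<close> only the two rotation equations are kept,
  which suffice for completeness.\<close>

definition step :: "nat \<Rightarrow> (nat \<times> nat \<Rightarrow> real \<Rightarrow> 'h) \<Rightarrow> (nat \<times> nat \<Rightarrow> real \<Rightarrow> 'h) \<Rightarrow> bool" where
  "step n g g' \<longleftrightarrow> (\<forall>i. i \<notin> {visit n, (Suc n, 0), (Suc n, 1)} \<longrightarrow> g' i = g i) \<and>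
     (\<forall>t\<in>{0..1}. \<exists>w. g' (Suc n, 0) t = s *\<^sub>R w + c *\<^sub>R g (visit n) t \<and>
        g' (visit n) t = s *\<^sub>R g (visit n) t - c *\<^sub>R w) \<and>
     (\<forall>t\<in>{0..1}. qf t (g' (Suc n, 0) t) (g' (Suc n, 0) t) = d n t)"

lemma stage_zero: "stage 0 h"
proof -
  have "norm (h i t - h i t') \<le> L * R" if "modulus t t' R 0" "i \<in> I" for i t t' R
  proof -
    have R: "\<bar>t - t'\<bar> \<le> R" using that by (auto simp: modulus_def)
    have "0 \<le> 2 * (9 + 10 * M * \<Lambda>) / (e / 2 * sin (2 * \<theta>0))"
      using M \<Lambda> e \<theta>0 by (intro divide_nonneg_pos mult_pos_pos sin_gt_zero) auto
    then have "2 * \<Lambda> \<le> c * L / 4" using L_large by linarith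
    also have "\<dots> \<le> L" using cs(2,3) L mult_right_mono[of c 1 L] by simp
    finally have "\<Lambda> \<le> L" using \<Lambda> by simp
    have "norm (h i t - h i t') \<le> \<Lambda> * \<bar>t - t'\<bar>" using that by (intro h_lip) auto
    also have "\<dots> \<le> L * R" using \<open>\<Lambda> \<le> L\<close> R L by (intro mult_mono) auto
    finally show ?thesis .
  qed
  then show ?thesis unfolding stage_def using h_on h_span by blast
qed

text \<open>Two plane rotations: one by the angle of \<open>angle_exists\<close> turns the fresh
  pair into \<open>w\<close> and its companion, the other, with constant weights \<open>s\<close>
  and \<open>c\<close>, mixes \<open>w\<close> with the visited vector.\<close>

lemma step_exists:
  assumes g: "stage n g"
  shows "\<exists>g'. stage (Suc n) g' \<and> step n g g'"
proof -
  define m where "m = visit n"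
  have mI: "m \<in> I" "m \<in> J n" and mn: "fst m \<le> n" using visit[of n] by (auto simp: m_def)
  have g_on: "\<And>t. t \<in> {0..1} \<Longrightarrow> orthonormal_on I (\<lambda>i. g i t)"
    and g_h: "\<And>i. fst i > n \<Longrightarrow> g i = h i"
    and g_span: "\<And>t. t \<in> {0..1} \<Longrightarrow> cspan ((\<lambda>i. g i t) ` J n) = F n"
    and g_mod: "\<And>t t' R i. modulus t t' R n \<Longrightarrow> i \<in> I \<Longrightarrow> norm (g i t - g i t') \<le> L * R"
    using g by (auto simp: stage_def)
  have "norm (g m t) = 1 \<and> g m t \<in> F n" if "t \<in> {0..1}" for t
    using orthonormal_on_norm[OF g_on[OF that] mI(1)] g_span[OF that] cspan_base[of "g m t" "(\<lambda>i. g i t) ` J n"] mI(2)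
    by auto
  then obtain \<theta> where
    \<theta>d: "\<And>t. t \<in> {0..1} \<Longrightarrow> qf t (s *\<^sub>R (cos (\<theta> t) *\<^sub>R h (Suc n, 0) t + sin (\<theta> t) *\<^sub>R h (Suc n, 1) t) + c *\<^sub>R g m t)
       (s *\<^sub>R (cos (\<theta> t) *\<^sub>R h (Suc n, 0) t + sin (\<theta> t) *\<^sub>R h (Suc n, 1) t) + c *\<^sub>R g m t) = d n t"
    and \<theta>L: "\<And>t t' R. modulus t t' R (Suc n) \<Longrightarrow> norm (g m t - g m t') \<le> L * R \<Longrightarrow>
       2 * \<bar>\<theta> t - \<theta> t'\<bar> + 2 * (\<Lambda> * R) \<le> c / 2 * (L * R)"
    using angle_exists[of "g m" n] by blast
  define k0 where "k0 = (Suc n, 0::nat)"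
  define k1 where "k1 = (Suc n, 1::nat)"
  have k: "k0 \<in> J (Suc n)" "k1 \<in> J (Suc n)" "k0 \<noteq> k1" "m \<noteq> k0" "m \<noteq> k1" "m \<in> J (Suc n)"
    using N mn mI by (auto simp: k0_def k1_def)
  have kI: "k0 \<in> I" "k1 \<in> I" using k by auto
  have gk: "g k0 = h k0" "g k1 = h k1" using g_h by (auto simp: k0_def k1_def)
  define g1 where "g1 t = givens k0 k1 (cos (\<theta> t)) (sin (\<theta> t)) (\<lambda>i. g i t)" for t
  define g' where "g' i t = givens k0 m s c (g1 t) i" for i t
  define w where "w t = cos (\<theta> t) *\<^sub>R h k0 t + sin (\<theta> t) *\<^sub>R h k1 t" for t
  have g'_k0: "g' k0 t = s *\<^sub>R w t + c *\<^sub>R g m t" for t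
    using k by (simp add: g'_def g1_def givens_def w_def gk)
  have g'_m: "g' m t = s *\<^sub>R g m t - c *\<^sub>R w t" for t
    using k by (simp add: g'_def g1_def givens_def w_def gk)
  have g'_k1: "g' k1 t = cos (\<theta> t) *\<^sub>R h k1 t - sin (\<theta> t) *\<^sub>R h k0 t" for t
    using k by (simp add: g'_def g1_def givens_def gk)
  have g'_else: "g' i = g i" if "i \<notin> {m, k0, k1}" for i
    using that by (auto simp: g'_def g1_def givens_def)
  have sc: "s\<^sup>2 + c\<^sup>2 = 1" using cs(1) by simp
  have step: "step n g g'"
    unfolding step_def m_def[symmetric] k0_def[symmetric] k1_def[symmetric]
    using g'_else g'_k0 g'_m \<theta>d by (auto simp: w_def k0_def k1_def)
  have span: "cspan ((\<lambda>i. g' i t) ` J (Suc n)) = F (Suc n)" if t: "t \<in> {0..1}" for t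
  proof -
    have "cspan ((\<lambda>i. g' i t) ` J (Suc n)) = cspan ((\<lambda>i. g i t) ` J (Suc n))"
    proof -
      have "cspan (givens k0 m s c (g1 t) ` J (Suc n)) = cspan (g1 t ` J (Suc n))"
        by (rule cspan_givens) (use k sc in auto)
      moreover have "cspan (g1 t ` J (Suc n)) = cspan ((\<lambda>i. g i t) ` J (Suc n))"
        unfolding g1_def by (rule cspan_givens) (use k in auto)
      ultimately show ?thesis by (simp only: g'_def)
    qed
    \<comment> \<open>The old blocks enter only through their span \<open>F n\<close>, and block
      \<open>Suc n\<close> is still the original one.\<close>
    also have "(\<lambda>i. g i t) ` J (Suc n) = (\<lambda>i. g i t) ` J n \<union> (\<lambda>i. h i t) ` {i \<in> J (Suc n). fst i = Suc n}"
    proof -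
      have "J (Suc n) = J n \<union> {i \<in> J (Suc n). fst i = Suc n}" by auto
      moreover have "(\<lambda>i. g i t) ` {i \<in> J (Suc n). fst i = Suc n} = (\<lambda>i. h i t) ` {i \<in> J (Suc n). fst i = Suc n}"
        by (intro image_cong) (auto simp: g_h)
      ultimately show ?thesis by (metis image_Un)
    qed
    also have "cspan \<dots> = cspan ((\<lambda>i. h i t) ` J n \<union> (\<lambda>i. h i t) ` {i \<in> J (Suc n). fst i = Suc n})"
      by (rule cspan_Un_cong) (simp only: g_span[OF t] h_span[OF t])
    also have "(\<lambda>i. h i t) ` J n \<union> (\<lambda>i. h i t) ` {i \<in> J (Suc n). fst i = Suc n} = (\<lambda>i. h i t) ` J (Suc n)"
      unfolding image_Un[symmetric] by (intro arg_cong[of _ _ "image _"]) auto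
    finally show ?thesis using h_span[OF t] by simp
  qed
  have modl: "norm (g' i t - g' i t') \<le> L * R" if m: "modulus t t' R (Suc n)" and i: "i \<in> I" for i t t' R
  proof -
    have m': "modulus t t' R n" using m by (auto simp: modulus_def)
    have t: "t \<in> {0..1}" "t' \<in> {0..1}" and R: "\<bar>t - t'\<bar> \<le> R" using m by (auto simp: modulus_def)
    have R0: "0 \<le> R" and LR: "0 \<le> L * R" using R L by auto
    have u: "norm (g m t - g m t') \<le> L * R" by (rule g_mod[OF m' mI(1)])
    have hL: "norm (h j t - h j t') \<le> \<Lambda> * R" if "j \<in> I" for j
      using h_lip[of j t t'] that R \<Lambda> by (smt (verit) mem_Collect_eq mult_left_mono)
    have n1: "norm (h j t) \<le> 1" if "j \<in> I" for j using norm_h[OF t(1)] that by simp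
    have wL: "norm (w t - w t') \<le> c / 2 * (L * R)"
      using norm_rotate_diff_le(1)[of "h k0 t" "h k1 t" "\<theta> t" "\<theta> t'" "h k0 t'" "h k1 t'"]
        n1[OF kI(1)] n1[OF kI(2)] hL[OF kI(1)] hL[OF kI(2)] \<theta>L[OF m u] unfolding w_def by linarith
    have zL: "norm (g' k1 t - g' k1 t') \<le> c / 2 * (L * R)"
      using norm_rotate_diff_le(2)[of "h k1 t" "h k0 t" "\<theta> t" "\<theta> t'" "h k1 t'" "h k0 t'"]
        n1[OF kI(1)] n1[OF kI(2)] hL[OF kI(1)] hL[OF kI(2)] \<theta>L[OF m u] unfolding g'_k1 by linarith
    have c2: "c / 2 * (L * R) \<le> 1 / 2 * (L * R)" using cs LR by (intro mult_right_mono) auto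
    consider "i = k0" | "i = k1" | "i = m" | "i \<notin> {m, k0, k1}" by blast
    then show ?thesis
    proof cases
      case 1
      have "g' k0 t - g' k0 t' = s *\<^sub>R (w t - w t') + c *\<^sub>R (g m t - g m t')"
        by (simp add: g'_k0 algebra_simps)
      also have "norm \<dots> \<le> s * norm (w t - w t') + c * norm (g m t - g m t')"
        using norm_triangle_ineq[of "s *\<^sub>R (w t - w t')" "c *\<^sub>R (g m t - g m t')"] cs by simp
      also have "\<dots> \<le> 1 * (1 / 2 * (L * R)) + 1 / 2 * (L * R)"
        using wL c2 u cs s_le(3) LR by (intro add_mono mult_mono) auto
      finally show ?thesis using 1 by simp
    next
      case 2
      then show ?thesis using zL c2 LR by simp
    next
      case 3
      have "g' m t - g' m t' = s *\<^sub>R (g m t - g m t') - c *\<^sub>R (w t - w t')"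
        by (simp add: g'_m algebra_simps)
      also have "norm \<dots> \<le> s * norm (g m t - g m t') + c * norm (w t - w t')"
        using norm_triangle_ineq4[of "s *\<^sub>R (g m t - g m t')" "c *\<^sub>R (w t - w t')"] cs by simp
      \<comment> \<open>The contraction by \<open>c\<^sup>2 / 2\<close> balances exactly what
        \<open>w\<close> adds, so the bound \<open>L * R\<close> reproduces itself.\<close>
      also have "\<dots> \<le> (1 - c\<^sup>2 / 2) * (L * R) + c * (c / 2 * (L * R))"
        using wL u cs s_le(1) LR by (intro add_mono mult_mono) auto
      also have "\<dots> = L * R" by (simp add: algebra_simps power2_eq_square)
      finally show ?thesis using 3 by simp
    next
      case 4
      then show ?thesis using g'_else g_mod[OF m' i] by simp
    qed
  qed
  have "stage (Suc n) g'"
    unfolding stage_def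
  proof (intro conjI ballI allI impI)
    fix t :: real assume t: "t \<in> {0..1}"
    have "orthonormal_on I (givens k0 m s c (g1 t))"
      unfolding g1_def using kI mI(1) k sc g_on[OF t]
      by (intro orthonormal_on_givens) auto
    then show "orthonormal_on I (\<lambda>i. g' i t)" by (simp add: g'_def)
    show "cspan ((\<lambda>i. g' i t) ` J (Suc n)) = F (Suc n)" by (rule span[OF t])
  next
    fix i :: "nat \<times> nat" assume i: "Suc n < fst i"
    then have "i \<notin> {m, k0, k1}" using mn by (auto simp: k0_def k1_def)
    then show "g' i = h i" using g'_else[of i] g_h[of i] i by simp
  qed (rule modl)
  then show ?thesis using step by blast
qed

lemma diagonal_chain:
  obtains G where "\<And>n. stage n (G n)" "\<And>n. step n (G n) (G (Suc n))"
proof -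
  have "\<exists>G. \<forall>n. stage n (G n) \<and> step n (G n) (G (Suc n))"
    by (rule dependent_nat_choice) (use stage_zero step_exists in blast)+
  then show thesis using that by blast
qed

text \<open>Orthogonality of \<open>x\<close> to \<open>s w + c u\<close> gives the remainder
  \<open>s u - c w\<close> the coefficient \<open>(s + c\<^sup>2 / s)\<close> times that of
  \<open>u\<close>, which is a factor \<open>1 / s\<close>. A nonzero coefficient would thus grow
  without bound over infinitely many visits, although it never exceeds
  \<open>norm x\<close>.\<close>

lemma chain_zero:
  assumes G: "\<And>n. stage n (G n)" "\<And>n. step n (G n) (G (Suc n))" and t: "t \<in> {0..1}"
    and x: "\<And>n. ci x (G (Suc n) (Suc n, 0) t) = 0"
    and i: "snd i \<le> N" "fst i = 0 \<or> snd i \<noteq> 0" "fst i \<le> n0"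
  shows "ci x (G n0 i t) = 0"
proof (rule ccontr)
  assume nz: "ci x (G n0 i t) \<noteq> 0"
  define f where "f n = cmod (ci x (G n i t))" for n
  have f0: "f n0 > 0" using nz by (simp add: f_def)
  have s1: "s < 1" using s_le(1) cs(2) by (smt (verit) zero_less_power half_gt_zero)
  have hit: "f (Suc n) = f n / s" if v: "visit n = i" for n
  proof -
    obtain w where w: "G (Suc n) (Suc n, 0) t = s *\<^sub>R w + c *\<^sub>R G n i t" "G (Suc n) i t = s *\<^sub>R G n i t - c *\<^sub>R w"
      using G(2)[of n] t v unfolding step_def by blast
    have "of_real s * ci x w + of_real c * ci x (G n i t) = 0"
      using x[of n] by (simp add: w ci_bilinear)
    then have sw: "of_real s * ci x w = - (of_real c * ci x (G n i t))" by (simp only: eq_neg_iff_add_eq_0)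
    have "of_real s * ci x (G (Suc n) i t) = of_real (s\<^sup>2) * ci x (G n i t) - of_real c * (of_real s * ci x w)"
      unfolding w(2) by (simp add: ci_bilinear right_diff_distrib power2_eq_square)
    also have "\<dots> = of_real (s\<^sup>2 + c\<^sup>2) * ci x (G n i t)"
      unfolding sw by (simp add: distrib_right power2_eq_square)
    finally have "of_real s * ci x (G (Suc n) i t) = ci x (G n i t)" using cs(1) by (simp only: add.commute of_real_1 mult_1)
    then have "s * f (Suc n) = f n" unfolding f_def using cs(4)
      by (metis abs_of_pos norm_mult norm_of_real)
    then show ?thesis using cs(4) by (simp add: field_simps)
  qed
  have miss: "f (Suc n) = f n" if "visit n \<noteq> i" "n \<ge> n0" for n
  proof -
    have "i \<notin> {visit n, (Suc n, 0), (Suc n, 1)}" using that i(3) by auto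
    then have "G (Suc n) i = G n i" using G(2)[of n] unfolding step_def by blast
    then show ?thesis by (simp add: f_def)
  qed
  have mono: "f n \<le> f (Suc n)" if "n \<ge> n0" for n
  proof (cases "visit n = i")
    case True
    have "s * f n \<le> 1 * f n" using s1 by (intro mult_right_mono) (auto simp: f_def)
    then show ?thesis using hit[OF True] cs(4) by (simp add: pos_le_divide_eq mult.commute)
  qed (simp add: miss that)
  have mono': "f n \<le> f n'" if "n0 \<le> n" "n \<le> n'" for n n'
    using that(2,1) by (induction rule: dec_induct) (auto intro: order_trans mono)
  have grow: "\<exists>n\<ge>n0. f n0 / s ^ k \<le> f n" for k
  proof (induction k)
    case (Suc k)
    then obtain n where n: "n \<ge> n0" "f n0 / s ^ k \<le> f n" by blast
    obtain n' where n': "n' \<ge> n" "visit n' = i" using visit_infinitely_often[OF i(1,2)] by blast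
    have "f n0 / s ^ Suc k = (f n0 / s ^ k) / s" by simp
    also have "\<dots> \<le> f n' / s" using n mono'[OF n(1) n'(1)] cs(4) by (intro divide_right_mono) auto
    also have "\<dots> = f (Suc n')" using hit[OF n'(2)] by simp
    finally show ?case using n n' by (intro exI[of _ "Suc n'"]) auto
  qed (auto simp: f_def)
  have bnd: "f n \<le> norm x" for n
  proof -
    have "norm (G n i t) = 1" using G(1)[of n] t i(1) orthonormal_on_norm[of I "\<lambda>i. G n i t" i] by (simp add: stage_def)
    then show ?thesis using cauchy_schwarz[of x "G n i t"] by (simp add: f_def)
  qed
  obtain k where k: "norm x / f n0 < (1 / s) ^ k"
    using real_arch_pow[of "1 / s" "norm x / f n0"] s1 cs(4) by auto
  obtain n where "f n0 / s ^ k \<le> f n" using grow by blast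
  then have "f n0 * (1 / s) ^ k \<le> norm x" using bnd[of n] by (simp add: divide_inverse power_inverse)
  then show False using k f0 by (simp add: pos_divide_less_eq mult.commute)
qed

text \<open>Each \<open>v n\<close> is recorded when it is finished and never changes again. At
  stage \<open>n\<close> the space \<open>F n\<close> is spanned by finished vectors and by those
  still in chains; whatever is orthogonal to all \<open>v n\<close> is orthogonal to both kinds,
  hence to a dense set.\<close>

theorem diagonal_basis_exists:
  obtains v where
    "\<And>t. t \<in> {0..1} \<Longrightarrow> orthonormal_basis ci (\<lambda>n. v n t)"
    "\<And>n t. t \<in> {0..1} \<Longrightarrow> ci (v n t) (A t (v n t)) = complex_of_real (d n t)"
    "\<And>n t t' R. modulus t t' R (Suc n) \<Longrightarrow> norm (v n t - v n t') \<le> L * R"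
proof -
  obtain G where G: "\<And>n. stage n (G n)" "\<And>n. step n (G n) (G (Suc n))" by (rule diagonal_chain) blast
  define v where "v n = G (Suc n) (Suc n, 0)" for n
  have stable: "G n' (Suc n, 0) = v n" if "n' \<ge> Suc n" for n n'
    using that
  proof (induction rule: dec_induct)
    case (step k)
    have "(Suc n, 0) \<notin> {visit k, (Suc k, 0), (Suc k, 1)}"
      using step.hyps visit(2)[of k] by (cases "visit k") auto
    then have "G (Suc k) (Suc n, 0) = G k (Suc n, 0)" using G(2)[of k] unfolding step_def by blast
    then show ?case using step.IH by simp
  qed (simp add: v_def)
  show thesis
  proof (rule that[of v])
    fix t :: real assume t: "t \<in> {0..1}"
    have "ci (v i t) (v j t) = (if i = j then 1 else 0)" for i j
    proof -
      define n where "n = Suc (max i j)"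
      have "orthonormal_on I (\<lambda>i. G n i t)" using G(1) t by (simp add: stage_def)
      from orthonormal_onD[OF this, of "(Suc i, 0)" "(Suc j, 0)"]
      show ?thesis using stable[of i n] stable[of j n] by (simp add: n_def)
    qed
    moreover have "closure (cspan (range (\<lambda>n. v n t))) = UNIV"
    proof (rule ccontr)
      let ?V = "closure (cspan (range (\<lambda>n. v n t)))"
      assume "?V \<noteq> UNIV"
      then obtain y where y: "y \<notin> ?V" by blast
      obtain p where p: "p \<in> ?V" "\<And>u. u \<in> ?V \<Longrightarrow> ci u (y - p) = 0"
        using orthogonal_projection[OF csubspace_closure[OF csubspace_cspan] closed_closure] by blast
      define x where "x = y - p"
      have xv: "ci x (G (Suc n) (Suc n, 0) t) = 0" for n
      proof -
        have "v n t \<in> ?V" by (rule subsetD[OF closure_subset], rule cspan_base) simp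
        from p(2)[OF this] have "ci (v n t) x = 0" by (simp only: x_def)
        then show ?thesis using ci_eq_0_commute[of x "v n t"] by (simp add: v_def)
      qed
      have F0: "ci z x = 0" if z: "z \<in> F n" for z n
      proof (rule orth_cspan[of "(\<lambda>i. G n i t) ` J n"])
        show "z \<in> cspan ((\<lambda>i. G n i t) ` J n)" using z G(1)[of n] t by (simp add: stage_def)
        fix u assume "u \<in> (\<lambda>i. G n i t) ` J n"
        then obtain i where i: "i \<in> J n" "u = G n i t" by auto
        have "ci x u = 0"
        proof (cases "fst i = 0 \<or> snd i \<noteq> 0")
          case True
          then show ?thesis unfolding i(2) using i(1) by (intro chain_zero[OF G t xv]) auto
        next
          case False
          then obtain k where "fst i = Suc k" by (cases "fst i") auto
          with False have k: "i = (Suc k, 0)" by (cases i) auto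
          then have "G n i = v k" using stable[of k n] i(1) by auto
          then show ?thesis using xv[of k] i(2) by (simp add: v_def)
        qed
        then show "ci u x = 0" using ci_eq_0_commute[of u x] by simp
      qed
      have "closure (\<Union>n. F n) \<subseteq> {z. \<forall>s\<in>{x}. ci s z = 0}"
        by (rule closure_minimal[OF _ closed_orth]) (use F0 ci_eq_0_commute[of x] in auto)
      then have "ci x x = 0" using total by auto
      then have "y = p" by (simp add: ci_self x_def)
      then show False using y p(1) by simp
    qed
    ultimately show "orthonormal_basis ci (\<lambda>n. v n t)" by (simp add: orthonormal_basis_def)
  next
    fix n and t :: real assume t: "t \<in> {0..1}"
    have "qf t (v n t) (v n t) = d n t" using G(2)[of n] t by (simp add: step_def v_def)
    moreover have "Im (ci (v n t) (A t (v n t))) = 0"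
      using arg_cong[OF ci_cnj[of "A t (v n t)" "v n t"], of Im] A_sa[OF t] by (simp add: selfadjoint_op_def)
    ultimately show "ci (v n t) (A t (v n t)) = complex_of_real (d n t)"
      by (simp add: complex_eq_iff qf_def)
  next
    fix n t t' R assume "modulus t t' R (Suc n)"
    then show "norm (v n t - v n t') \<le> L * R" using G(1)[of "Suc n"] by (simp add: stage_def v_def)
  qed
qed

end

section \<open>Moduli of continuity and extremality of the swept vectors\<close>

text \<open>The modulus is the supremum of all oscillations over distances up to \<open>x\<close>;
  the uniform bound \<open>B\<close> keeps these suprema finite for large \<open>x\<close> as
  well.\<close>

lemma equicontinuous_onI:
  fixes f :: "nat \<Rightarrow> real \<Rightarrow> 'b::real_normed_vector"
  assumes ne: "S \<noteq> {}"
    and bdd: "\<And>n t t'. t \<in> S \<Longrightarrow> t' \<in> S \<Longrightarrow> norm (f n t - f n t') \<le> B"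
    and ec: "\<And>\<epsilon>. \<epsilon> > 0 \<Longrightarrow> \<exists>\<rho>>0. \<forall>n. \<forall>t\<in>S. \<forall>t'\<in>S. \<bar>t - t'\<bar> < \<rho> \<longrightarrow> norm (f n t - f n t') \<le> \<epsilon>"
  shows "equicontinuous_on S f"
proof -
  define X where "X x = {norm (f n t - f n t') |n t t'. t \<in> S \<and> t' \<in> S \<and> \<bar>t - t'\<bar> \<le> x}" for x
  define \<delta> where "\<delta> x = Sup (X x)" for x
  obtain t0 where t0: "t0 \<in> S" using ne by blast
  have zero_in: "0 \<in> X x" if "x \<ge> 0" for x
    unfolding X_def using t0 that by (auto intro!: exI[of _ 0] exI[of _ t0])
  have bddX: "bdd_above (X x)" for x unfolding X_def using bdd by (auto intro!: bdd_aboveI[of _ B])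
  show ?thesis unfolding equicontinuous_on_def
  proof (intro exI[of _ \<delta>] conjI allI ballI)
    show "mono_on {0..} \<delta>"
    proof (rule mono_onI)
      fix x y :: real assume "x \<in> {0..}" "y \<in> {0..}" "x \<le> y"
      then have "X x \<noteq> {}" "X x \<subseteq> X y"
        using zero_in[of x] by auto (smt (verit) X_def mem_Collect_eq)
      then show "\<delta> x \<le> \<delta> y" unfolding \<delta>_def by (intro cSup_subset_mono bddX)
    qed
    have "X 0 = {0}" using zero_in[of 0] by (auto simp: X_def)
    then show "\<delta> 0 = 0" by (simp add: \<delta>_def)
    show "(\<delta> \<longlongrightarrow> 0) (at_right 0)"
    proof (rule tendstoI)
      fix \<epsilon> :: real assume "\<epsilon> > 0"
      then obtain \<rho> where \<rho>: "\<rho> > 0"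
        "\<And>n t t'. t \<in> S \<Longrightarrow> t' \<in> S \<Longrightarrow> \<bar>t - t'\<bar> < \<rho> \<Longrightarrow> norm (f n t - f n t') \<le> \<epsilon> / 2"
        using ec[of "\<epsilon> / 2"] by auto
      have "dist (\<delta> x) 0 < \<epsilon>" if "x > 0" "x < \<rho>" for x
      proof -
        have "\<delta> x \<le> \<epsilon> / 2" unfolding \<delta>_def
          by (rule cSup_least) (use zero_in[of x] \<rho>(2) that in \<open>auto simp: X_def\<close>)
        moreover have "0 \<le> \<delta> x" unfolding \<delta>_def using zero_in[of x] that bddX by (intro cSup_upper) auto
        ultimately show ?thesis using \<open>\<epsilon> > 0\<close> by (simp add: dist_real_def)
      qed
      then show "\<forall>\<^sub>F x in at_right 0. dist (\<delta> x) 0 < \<epsilon>"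
        unfolding eventually_at_right_field using \<rho>(1) by blast
    qed
    fix n t t' assume "t \<in> S" "t' \<in> S"
    then show "norm (f n t - f n t') \<le> \<delta> \<bar>t - t'\<bar>"
      unfolding \<delta>_def by (intro cSup_upper bddX) (auto simp: X_def)
  qed
qed

section \<open>Quadratic forms of the swept vectors between grid times\<close>

context hilbert_ip
begin

text \<open>The diagonal values are averaged with weights summing to 1, and the cross term has a
  factor \<open>2 * cos \<phi> * sin \<phi>\<close> of modulus at most 1.\<close>

lemma quadratic_combination_ge:
  fixes T :: "'h \<Rightarrow>\<^sub>L 'h"
  assumes sa: "selfadjoint_op ci T" and \<sigma>: "\<bar>\<sigma>\<bar> = (1::real)"
    and p: "\<beta> \<le> \<sigma> * Re (ci p (T p))" "\<beta> \<le> \<sigma> * Re (ci q (T q))" and pq: "\<bar>Re (ci p (T q))\<bar> \<le> \<eta>"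
  shows "\<beta> - \<eta> \<le> \<sigma> * Re (ci (cos \<phi> *\<^sub>R p + sin \<phi> *\<^sub>R q) (T (cos \<phi> *\<^sub>R p + sin \<phi> *\<^sub>R q)))"
proof -
  have "ci q (T p) = cnj (ci p (T q))"
    using sa ci_cnj[of "T q" p] ci_cnj[of q "T p"] by (simp add: selfadjoint_op_def)
  then have "\<sigma> * Re (ci (cos \<phi> *\<^sub>R p + sin \<phi> *\<^sub>R q) (T (cos \<phi> *\<^sub>R p + sin \<phi> *\<^sub>R q))) =
      (cos \<phi>)\<^sup>2 * (\<sigma> * Re (ci p (T p))) + (sin \<phi>)\<^sup>2 * (\<sigma> * Re (ci q (T q))) +
      2 * cos \<phi> * sin \<phi> * (\<sigma> * Re (ci p (T q)))"
    by (simp add: ci_bilinear blinfun.add_right blinfun.scaleR_right algebra_simps power2_eq_square)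
  moreover have "(cos \<phi>)\<^sup>2 * (\<sigma> * Re (ci p (T p))) \<ge> (cos \<phi>)\<^sup>2 * \<beta>"
    "(sin \<phi>)\<^sup>2 * (\<sigma> * Re (ci q (T q))) \<ge> (sin \<phi>)\<^sup>2 * \<beta>"
    using p by (auto intro: mult_left_mono)
  moreover have "\<bar>2 * cos \<phi> * sin \<phi> * (\<sigma> * Re (ci p (T q)))\<bar> \<le> 1 * (1 * \<eta>)"
    by (intro abs_mult_le two_mult_le_one) (use \<sigma> pq in auto)
  moreover have "(cos \<phi>)\<^sup>2 * \<beta> + (sin \<phi>)\<^sup>2 * \<beta> = \<beta>"
    by (simp flip: distrib_right)
  moreover have "\<beta> - \<eta> \<le> u + v + w" if "u \<ge> u'" "v \<ge> v'" "\<bar>w\<bar> \<le> 1 * (1 * \<eta>)" "u' + v' = \<beta>" for u v w u' v' :: real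
    using that by linarith
  ultimately show ?thesis by metis
qed

lemma Re_ci_blinfun_close:
  fixes T T' :: "'h \<Rightarrow>\<^sub>L 'h"
  assumes "norm (T - T') \<le> \<eta>"
  shows "\<bar>Re (ci y (T x)) - Re (ci y (T' x))\<bar> \<le> \<eta> * (norm y * norm x)"
proof -
  have "\<bar>Re (ci y ((T - T') x))\<bar> \<le> norm y * norm ((T - T') x)"
    using abs_Re_le_cmod cauchy_schwarz order_trans by blast
  also have "norm ((T - T') x) \<le> \<eta> * norm x"
    using order_trans[OF norm_blinfun mult_right_mono[OF assms norm_ge_zero]] .
  then have "norm y * norm ((T - T') x) \<le> norm y * (\<eta> * norm x)" by (rule mult_left_mono) simp
  finally show ?thesis by (simp add: blinfun.diff_left ci_bilinear mult.left_commute)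
qed

text \<open>The time-discretised situation: \<open>bb\<close> is exactly adapted to the operators at
  the grid times \<open>i / r\<close>, \<open>h\<close> sweeps between them, and
  \<open>\<eta>\<close> bounds the variation of \<open>A\<close> over one grid cell.\<close>

context
  fixes A :: "real \<Rightarrow> 'h \<Rightarrow>\<^sub>L 'h" and bb :: "nat \<times> nat \<Rightarrow> 'h" and h :: "nat \<times> nat \<Rightarrow> real \<Rightarrow> 'h"
    and r :: nat and \<eta> e a b :: real
  assumes r: "r > 0"
    and A_sa: "\<And>t. t \<in> {0..1} \<Longrightarrow> selfadjoint_op ci (A t)"
    and grid: "\<And>t t'. t \<in> {0..1} \<Longrightarrow> t' \<in> {0..1} \<Longrightarrow> \<bar>t - t'\<bar> \<le> 1 / real r \<Longrightarrow> norm (A t - A t') \<le> \<eta>"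
    and bb_on: "orthonormal_on {i. snd i \<le> 2 * r + 2} bb"
    and bb_up: "\<And>n i. i \<le> r \<Longrightarrow> b + e \<le> Re (ci (bb (n, 2 * i)) (A (real i / real r) (bb (n, 2 * i))))"
    and bb_low: "\<And>n i. i \<le> r \<Longrightarrow> Re (ci (bb (n, 2 * i + 1)) (A (real i / real r) (bb (n, 2 * i + 1)))) \<le> a - e"
    and bb_orth: "\<And>j n k n' k'. j \<le> r \<Longrightarrow> k < 2 * r + 2 \<Longrightarrow> k' \<le> 2 * r + 2 \<Longrightarrow>
      n' < n \<or> n' = n \<and> k' < 2 * r + 2 \<and> k' \<noteq> k \<Longrightarrow> ci (A (real j / real r) (bb (n, k))) (bb (n', k')) = 0"
    and h_on: "\<And>t. orthonormal_on {i. snd i \<le> 2 * r + 2} (\<lambda>i. h i t)"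
    and h_form: "\<And>n t. t \<in> {0..1} \<Longrightarrow> \<exists>i<r. \<exists>\<phi>. real i / real r \<le> t \<and> t \<le> real (Suc i) / real r \<and>
          h (n, 0) t = cos \<phi> *\<^sub>R bb (n, 2 * i) + sin \<phi> *\<^sub>R bb (n, 2 * i + 2) \<and>
          h (n, 1) t = cos \<phi> *\<^sub>R bb (n, 2 * i + 1) + sin \<phi> *\<^sub>R bb (n, 2 * i + 3)"
begin

text \<open>In the diagonal bounds one \<eta> is lost in moving from the grid times to
  \<open>t\<close>, another in the cross term of the two basis vectors being mixed.\<close>

lemma sweep_extremal:
  assumes t: "t \<in> {0..1}"
  shows "b + e - 2 * \<eta> \<le> Re (ci (h (n, 0) t) (A t (h (n, 0) t)))"
    and "Re (ci (h (n, 1) t) (A t (h (n, 1) t))) \<le> a - e + 2 * \<eta>"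
    and "\<bar>Re (ci (h (n, 1) t) (A t (h (n, 0) t)))\<bar> \<le> \<eta>"
proof -
  obtain i \<phi> where i: "i < r" "real i / real r \<le> t" "t \<le> real (Suc i) / real r"
    and h0: "h (n, 0) t = cos \<phi> *\<^sub>R bb (n, 2 * i) + sin \<phi> *\<^sub>R bb (n, 2 * i + 2)"
    and h1: "h (n, 1) t = cos \<phi> *\<^sub>R bb (n, 2 * i + 1) + sin \<phi> *\<^sub>R bb (n, 2 * i + 3)"
    using h_form[OF t, of n] by blast
  have "t - real i / real r \<le> 1 / real r" "real (Suc i) / real r - t \<le> 1 / real r" using i by (auto simp: add_divide_distrib)
  then have tc: "norm (A t - A (real i / real r)) \<le> \<eta>" "norm (A t - A (real (Suc i) / real r)) \<le> \<eta>"
    using i t r by (auto intro!: grid simp: divide_le_eq_1)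
  have n1: "norm (bb (n, k)) = 1" if "k \<le> 2 * r + 2" for k using orthonormal_on_norm[OF bb_on] that by simp
  have orth: "ci (bb (n, k')) (A (real i / real r) (bb (n, k))) = 0" if "k < 2 * r + 2" "k' < 2 * r + 2" "k' \<noteq> k" for k k'
    using bb_orth[of i k k' n n] i(1) that ci_eq_0_commute by auto
  have small: "\<bar>Re (ci (bb (n, k')) (A t (bb (n, k))))\<bar> \<le> \<eta>"
    if "k < 2 * r + 2" "k' < 2 * r + 2" "k' \<noteq> k" for k k'
    using Re_ci_blinfun_close[OF tc(1), of "bb (n, k')" "bb (n, k)"] orth[OF that] n1[of k] n1[of k'] that by simp
  have near: "\<bar>Re (ci (bb (n, k)) (A t (bb (n, k)))) - Re (ci (bb (n, k)) (A (real j / real r) (bb (n, k))))\<bar> \<le> \<eta>"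
    if "k < 2 * r + 2" "j = i \<or> j = Suc i" for k j
    using Re_ci_blinfun_close[OF tc(1), of "bb (n, k)" "bb (n, k)"] Re_ci_blinfun_close[OF tc(2), of "bb (n, k)" "bb (n, k)"]
      n1[of k] that by auto
  have "(b + e - \<eta>) - \<eta> \<le> 1 * Re (ci (h (n, 0) t) (A t (h (n, 0) t)))"
    unfolding h0
  proof (rule quadratic_combination_ge[OF A_sa[OF t]])
    show "b + e - \<eta> \<le> 1 * Re (ci (bb (n, 2 * i)) (A t (bb (n, 2 * i))))"
      using bb_up[of i n] near[of "2 * i" i] i(1) by simp
    show "b + e - \<eta> \<le> 1 * Re (ci (bb (n, 2 * i + 2)) (A t (bb (n, 2 * i + 2))))"
      using bb_up[of "Suc i" n] near[of "2 * i + 2" "Suc i"] i(1) by simp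
  qed (use i(1) in \<open>auto intro!: small\<close>)
  then show "b + e - 2 * \<eta> \<le> Re (ci (h (n, 0) t) (A t (h (n, 0) t)))" by simp
  have "(e - a - \<eta>) - \<eta> \<le> (- 1) * Re (ci (h (n, 1) t) (A t (h (n, 1) t)))"
    unfolding h1
  proof (rule quadratic_combination_ge[OF A_sa[OF t]])
    show "e - a - \<eta> \<le> - 1 * Re (ci (bb (n, 2 * i + 1)) (A t (bb (n, 2 * i + 1))))"
      using bb_low[of i n] near[of "2 * i + 1" i] i(1) by simp
    show "e - a - \<eta> \<le> - 1 * Re (ci (bb (n, 2 * i + 3)) (A t (bb (n, 2 * i + 3))))"
      using bb_low[of "Suc i" n] near[of "2 * i + 3" "Suc i"] i(1) by (simp add: numeral_3_eq_3)
  qed (use i(1) in \<open>auto intro!: small\<close>)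
  then show "Re (ci (h (n, 1) t) (A t (h (n, 1) t))) \<le> a - e + 2 * \<eta>" by simp
  \<comment> \<open>One vector uses odd, the other even positions, so all four products vanish at
    the grid time.\<close>
  have "ci (h (n, 1) t) (A (real i / real r) (h (n, 0) t)) = 0"
    unfolding h0 h1 using i(1) by (simp add: ci_bilinear blinfun.add_right blinfun.scaleR_right orth)
  moreover have "norm (h (n, 0) t) = 1" "norm (h (n, 1) t) = 1"
    using orthonormal_on_norm[OF h_on, of _ t] by auto
  ultimately show "\<bar>Re (ci (h (n, 1) t) (A t (h (n, 0) t)))\<bar> \<le> \<eta>"
    using Re_ci_blinfun_close[OF tc(1), of "h (n, 1) t" "h (n, 0) t"] by simp
qed

text \<open>The inner product is exactly 0 for the operator at the left grid time; replacing it by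
  \<open>A t\<close> costs \<open>\<eta> * norm y\<close>.\<close>

lemma sweep_almost_orth:
  assumes t: "t \<in> {0..1}" and y: "y \<in> cspan (bb ` {i. snd i \<le> 2 * r + 2 \<and> fst i \<le> n})" and k: "k \<in> {0, 1}"
  shows "\<bar>Re (ci y (A t (h (Suc n, k) t)))\<bar> \<le> \<eta> * norm y"
proof -
  obtain i \<phi> where i: "i < r" "real i / real r \<le> t" "t \<le> real (Suc i) / real r"
    and h01: "h (Suc n, 0) t = cos \<phi> *\<^sub>R bb (Suc n, 2 * i) + sin \<phi> *\<^sub>R bb (Suc n, 2 * i + 2)"
      "h (Suc n, 1) t = cos \<phi> *\<^sub>R bb (Suc n, 2 * i + 1) + sin \<phi> *\<^sub>R bb (Suc n, 2 * i + 3)"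
    using h_form[OF t, of "Suc n"] by blast
  have "t - real i / real r \<le> 1 / real r" using i by (auto simp: add_divide_distrib)
  then have tc: "norm (A t - A (real i / real r)) \<le> \<eta>"
    using i t r by (auto intro!: grid simp: divide_le_eq_1)
  have orth: "ci y (A (real i / real r) (bb (Suc n, l))) = 0" if "l < 2 * r + 2" for l
  proof (rule orth_cspan[OF _ y])
    fix z assume "z \<in> bb ` {i. snd i \<le> 2 * r + 2 \<and> fst i \<le> n}"
    then obtain n' k' where "z = bb (n', k')" "k' \<le> 2 * r + 2" "n' < Suc n" by auto
    then show "ci z (A (real i / real r) (bb (Suc n, l))) = 0"
      using bb_orth[of i l k' n' "Suc n"] i(1) that ci_eq_0_commute[of z] by simp
  qed
  have "ci y (A (real i / real r) (h (Suc n, k) t)) = 0"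
    using k i(1) by (auto simp: h01[simplified] ci_bilinear blinfun.add_right blinfun.scaleR_right orth)
  moreover have "norm (h (Suc n, k) t) = 1"
    using orthonormal_on_norm[OF h_on, of "(Suc n, k)" t] k by auto
  ultimately show ?thesis
    using Re_ci_blinfun_close[OF tc, of y "h (Suc n, k) t"] by simp
qed

end
end

section \<open>Existence of the continuous orthonormal basis\<close>

text \<open>If no point of \<open>E\<close> exceeded \<open>b\<close>, the hull would lie in the
  half-line below \<open>b\<close> and could not contain a neighbourhood of \<open>b\<close>;
  likewise at \<open>a\<close>.\<close>

lemma convex_hull_interior_bounds:
  fixes E :: "real set"
  assumes ab: "{a..b} \<subseteq> interior (convex hull E)" and le: "a \<le> b"
  shows "\<exists>l\<in>E. b < l" "\<exists>l\<in>E. l < a"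
proof -
  have op: "open (interior (convex hull E))" by simp
  have "b \<in> interior (convex hull E)" "a \<in> interior (convex hull E)" using ab le by auto
  then obtain \<rho> \<rho>' where \<rho>: "\<rho> > 0" "cball b \<rho> \<subseteq> interior (convex hull E)"
    "\<rho>' > 0" "cball a \<rho>' \<subseteq> interior (convex hull E)"
    using op by (meson open_contains_cball)
  have "b + \<rho> \<in> cball b \<rho>" "a - \<rho>' \<in> cball a \<rho>'" using \<rho> by (auto simp: dist_real_def)
  then have 1: "b + \<rho> \<in> convex hull E" "a - \<rho>' \<in> convex hull E" using \<rho> interior_subset by blast+
  show "\<exists>l\<in>E. b < l"
  proof (rule ccontr)
    assume "\<not> ?thesis"
    then have "convex hull E \<subseteq> {..b}" by (intro hull_minimal) (auto simp: not_less)
    then show False using 1 \<rho> by auto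
  qed
  show "\<exists>l\<in>E. l < a"
  proof (rule ccontr)
    assume "\<not> ?thesis"
    then have "convex hull E \<subseteq> {a..}" by (intro hull_minimal) (auto simp: not_less)
    then show False using 1 \<rho> by auto
  qed
qed

lemma cspan_subset_UN_of_mono:
  assumes mono: "\<And>m n. m \<le> n \<Longrightarrow> X m \<subseteq> X n"
  shows "cspan (\<Union>n. X n) \<subseteq> (\<Union>n::nat. cspan (X n))"
proof (rule cspan_minimal)
  show "(\<Union>n. X n) \<subseteq> (\<Union>n. cspan (X n))" using cspan_base by fast
  have m: "cspan (X m) \<subseteq> cspan (X n)" if "m \<le> n" for m n by (intro cspan_mono mono that)
  show "csubspace (\<Union>n. cspan (X n))"
    unfolding csubspace_def
  proof (intro conjI ballI allI)
    fix x y assume "x \<in> (\<Union>n. cspan (X n))" "y \<in> (\<Union>n. cspan (X n))"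
    then obtain i j where "x \<in> cspan (X i)" "y \<in> cspan (X j)" by blast
    then have "x + y \<in> cspan (X (max i j))" using m[of i "max i j"] m[of j "max i j"] by (intro cspan_add) auto
    then show "x + y \<in> (\<Union>n. cspan (X n))" by blast
  qed (auto intro: cspan_zero cspan_scaleC)
qed

text \<open>The order of the choices matters: margin \<open>e\<close> and bound \<open>M\<close>
  come from the data, then \<open>\<theta>0\<close>, \<open>c\<close> and \<open>\<eta>\<close>,
  then the mesh \<open>1 / r\<close>, which determines the frame and \<open>\<Lambda>\<close>, and
  \<open>L\<close> comes last.\<close>

lemma (in hilbert_ip) diagonal_setup_exists:
  fixes A :: "real \<Rightarrow> 'h \<Rightarrow>\<^sub>L 'h" and d :: "nat \<Rightarrow> real \<Rightarrow> real"
  assumes sep: "separable_space TYPE('h)" and inf: "\<not> cfinite_dim (UNIV :: 'h set)"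
    and A_cont: "continuous_on {0..1} A"
    and A_lin: "\<forall>t\<in>{0..1}. clinear_op (A t)" and A_sa: "\<forall>t\<in>{0..1}. selfadjoint_op ci (A t)"
    and d_range: "\<forall>n. \<forall>t\<in>{0..1}. d n t \<in> {a..b}"
    and ab: "\<forall>t\<in>{0..1}. {a..b} \<subseteq>
               interior (convex hull {r::real. complex_of_real r \<in> essential_spectrum (A t)})"
  shows "\<exists>e M c s \<eta> \<theta>0 \<Lambda> L N h F. diagonal_setup ci A d a b e M c s \<eta> \<theta>0 \<Lambda> L N h F"
proof -
  have "a \<le> b" using d_range by (meson atLeastAtMost_iff order_trans order_refl zero_le_one)
  note ext = convex_hull_interior_bounds[OF ab[rule_format] this]
  have "\<exists>l. complex_of_real l \<in> essential_spectrum (A t) \<and> 1 * l > b" if "t \<in> {0..1}" for t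
    using ext(1)[OF that] by auto
  then obtain e1 where e1: "e1 > 0" "\<And>t S. t \<in> {0..1} \<Longrightarrow> finite S \<Longrightarrow>
      \<exists>x. norm x = 1 \<and> (\<forall>s\<in>S. ci s x = 0) \<and> 1 * Re (ci x (A t x)) \<ge> b + e1"
    using uniform_extremal_vectors[OF A_cont A_lin A_sa, of 1 b] by auto
  have "\<exists>l. complex_of_real l \<in> essential_spectrum (A t) \<and> (- 1) * l > - a" if "t \<in> {0..1}" for t
    using ext(2)[OF that] by auto
  then obtain e2 where e2: "e2 > 0" "\<And>t S. t \<in> {0..1} \<Longrightarrow> finite S \<Longrightarrow>
      \<exists>x. norm x = 1 \<and> (\<forall>s\<in>S. ci s x = 0) \<and> (- 1) * Re (ci x (A t x)) \<ge> - a + e2"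
    using uniform_extremal_vectors[OF A_cont A_lin A_sa, of "- 1" "- a"] by auto
  \<comment> \<open>Half of the margin is reserved for the losses of the sweep.\<close>
  define e where "e = min e1 e2 / 2"
  have e: "e > 0" "2 * e \<le> e1" "2 * e \<le> e2" using e1(1) e2(1) by (auto simp: e_def)
  have "compact (A ` {0..1})" using A_cont by (intro compact_continuous_image) auto
  then obtain M0 where M0: "\<And>t. t \<in> {0..1} \<Longrightarrow> norm (A t) \<le> M0"
    using compact_imp_bounded[of "A ` {0..1}"] unfolding bounded_iff by blast
  define M where "M = max 1 M0"
  have M: "1 \<le> M" "\<And>t. t \<in> {0..1} \<Longrightarrow> norm (A t) \<le> M" using M0 by (auto simp: M_def le_max_iff_disj)
  define \<theta>0 where "\<theta>0 = min (pi / 4) (min 1 (e / (8 * M)))"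
  have \<theta>0: "0 < \<theta>0" "\<theta>0 \<le> pi / 4" using e M by (auto simp: \<theta>0_def)
  define \<kappa> where "\<kappa> = e / 2 * sin (2 * \<theta>0)"
  have \<kappa>: "\<kappa> > 0" unfolding \<kappa>_def using e \<theta>0 by (intro mult_pos_pos sin_gt_zero) auto
  define c where "c = min (1 / 2) (min (e / (8 * M)) (\<kappa> / (48 * M)))"
  have c: "0 < c" "c \<le> 1 / 2" "c \<le> e / (8 * M)" "c \<le> \<kappa> / (48 * M)"
    using e M \<kappa> by (auto simp: c_def)
  define s where "s = sqrt (1 - c\<^sup>2)"
  have c2: "c\<^sup>2 < 1" using c by (simp add: abs_square_less_1)
  have s: "0 < s" "c\<^sup>2 + s\<^sup>2 = 1" using c2 by (auto simp: s_def)
  \<comment> \<open>The bound \<open>\<kappa> / 4\<close> is the condition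
    \<open>8 * \<eta> \<le> e * sin (2 * \<theta>0)\<close>.\<close>
  define \<eta> where "\<eta> = min c (min (e / 6) (\<kappa> / 4))"
  have \<eta>: "0 < \<eta>" "\<eta> \<le> c" "6 * \<eta> \<le> e" "4 * \<eta> \<le> \<kappa>" using c e \<kappa> by (auto simp: \<eta>_def)
  have sq: "2 * M * x\<^sup>2 \<le> e / 4" if "0 < x" "x \<le> 1" "x \<le> e / (8 * M)" for x
  proof -
    have "x\<^sup>2 \<le> x * 1" unfolding power2_eq_square using that by (intro mult_left_mono) auto
    then have "2 * M * x\<^sup>2 \<le> 2 * M * (e / (8 * M))" using that M by (intro mult_left_mono) auto
    also have "\<dots> = e / 4" using M by (simp add: field_simps)
    finally show ?thesis .
  qed
  have "uniformly_continuous_on {0..1} A" by (rule compact_uniformly_continuous[OF A_cont]) simp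
  then obtain \<rho> where \<rho>: "\<rho> > 0"
    "\<And>t t'. t \<in> {0..1} \<Longrightarrow> t' \<in> {0..1} \<Longrightarrow> dist t' t < \<rho> \<Longrightarrow> dist (A t') (A t) < \<eta>"
    unfolding uniformly_continuous_on_def using \<eta>(1) by metis
  obtain r0 where r0: "1 / real (Suc r0) < \<rho>" using \<rho>(1) nat_approx_posE by blast
  define r where "r = Suc r0"
  have r: "r > 0" and grid: "\<And>t t'. t \<in> {0..1} \<Longrightarrow> t' \<in> {0..1} \<Longrightarrow> \<bar>t - t'\<bar> \<le> 1 / real r \<Longrightarrow> norm (A t - A t') \<le> \<eta>"
    using \<rho>(2) r0 by (force simp: r_def dist_real_def dist_norm less_imp_le)+
  \<comment> \<open>Positions \<open>2 * j\<close> and \<open>2 * j + 1\<close> belong to the grid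
    time \<open>j / r\<close> for \<open>j \<le> r\<close>; the last position \<open>N\<close>
    captures the dense sequence.\<close>
  define N where "N = 2 * r + 2"
  define Q where "Q k x \<longleftrightarrow> (if even k then b + 2 * e \<le> Re (ci x (A (real (k div 2) / real r) x))
      else Re (ci x (A (real (k div 2) / real r) x)) \<le> a - 2 * e)" for k :: nat and x
  have gridpt: "real j / real r \<in> {0..1}" if "j \<le> r" for j using that r by (simp add: divide_le_eq_1)
  define Bs where "Bs = (\<lambda>j. blinfun_apply (A (real j / real r))) ` {..r}"
  have Bs: "finite Bs" "\<And>B. B \<in> Bs \<Longrightarrow> selfadjoint_op ci B"
    using A_sa gridpt by (auto simp: Bs_def simp del: atLeastAtMost_iff)
  have Qex: "\<exists>x. norm x = 1 \<and> (\<forall>s\<in>S. ci s x = 0) \<and> Q k x" if k: "k < N" and S: "finite S" for k S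
  proof -
    have "k div 2 \<le> r" using k by (simp add: N_def)
    note g = gridpt[OF this]
    show ?thesis
    proof (cases "even k")
      case True
      from e1(2)[OF g S] obtain x where "norm x = 1" "\<forall>s\<in>S. ci s x = 0"
        "1 * Re (ci x (A (real (k div 2) / real r) x)) \<ge> b + e1" by blast
      then show ?thesis using True e by (intro exI[of _ x]) (simp add: Q_def)
    next
      case False
      from e2(2)[OF g S] obtain x where "norm x = 1" "\<forall>s\<in>S. ci s x = 0"
        "(- 1) * Re (ci x (A (real (k div 2) / real r) x)) \<ge> - a + e2" by blast
      then show ?thesis using False e by (intro exI[of _ x]) (simp add: Q_def)
    qed
  qed
  obtain bb :: "nat \<times> nat \<Rightarrow> 'h" where bb: "orthonormal_on {i. snd i \<le> N} bb"
    "closure (cspan (bb ` {i. snd i \<le> N})) = UNIV" "\<And>n k. k < N \<Longrightarrow> Q k (bb (n, k))"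
    "\<And>B n k n' k'. B \<in> Bs \<Longrightarrow> k < N \<Longrightarrow> k' \<le> N \<Longrightarrow> n' < n \<or> n' = n \<and> k' < N \<and> k' \<noteq> k \<Longrightarrow>
      ci (B (bb (n, k))) (bb (n', k')) = 0"
    by (rule block_orthonormal_basis[where Bs = Bs and N = N and Q = Q, OF inf sep Bs(1)])
       (erule Bs(2), erule (1) Qex, rule that)
  obtain h \<Lambda>0 where h: "\<And>t. orthonormal_on {i. snd i \<le> 2 * r + 2} (\<lambda>i. h i t)"
    "\<And>t n. cspan ((\<lambda>i. h i t) ` {i \<in> {i. snd i \<le> 2 * r + 2}. fst i \<le> n}) = cspan (bb ` {i \<in> {i. snd i \<le> 2 * r + 2}. fst i \<le> n})"
    "\<And>i t t'. i \<in> {i. snd i \<le> 2 * r + 2} \<Longrightarrow> norm (h i t - h i t') \<le> \<Lambda>0 * \<bar>t - t'\<bar>"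
    "\<And>n t. t \<in> {0..1} \<Longrightarrow> \<exists>i<r. \<exists>\<phi>. i / r \<le> t \<and> t \<le> Suc i / r \<and>
          h (n, 0) t = cos \<phi> *\<^sub>R bb (n, 2 * i) + sin \<phi> *\<^sub>R bb (n, 2 * i + 2) \<and>
          h (n, 1) t = cos \<phi> *\<^sub>R bb (n, 2 * i + 1) + sin \<phi> *\<^sub>R bb (n, 2 * i + 3)"
    by (rule sweeping_frame[OF bb(1)[unfolded N_def] r]) (rule that)
  define F where "F n = cspan (bb ` {i. snd i \<le> N \<and> fst i \<le> n})" for n
  define \<Lambda> where "\<Lambda> = max 0 \<Lambda>0"
  \<comment> \<open>Chosen so that \<open>L_large\<close> holds with equality.\<close>
  define L where "L = 4 / c * (2 * (9 + 10 * M * \<Lambda>) / \<kappa> + 2 * \<Lambda>)"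
  have \<Lambda>: "0 \<le> \<Lambda>" by (simp add: \<Lambda>_def)
  have L0: "0 \<le> L" using \<Lambda> c M \<kappa> by (simp add: L_def)
  have up: "b + 2 * e \<le> Re (ci (bb (n, 2 * i)) (A (real i / real r) (bb (n, 2 * i))))"
    and low: "Re (ci (bb (n, 2 * i + 1)) (A (real i / real r) (bb (n, 2 * i + 1)))) \<le> a - 2 * e" if "i \<le> r" for n i
    using bb(3)[of "2 * i" n] bb(3)[of "2 * i + 1" n] that by (auto simp: Q_def N_def)
  have orth: "ci (A (real j / real r) (bb (n, k))) (bb (n', k')) = 0"
    if "j \<le> r" "k < 2 * r + 2" "k' \<le> 2 * r + 2" "n' < n \<or> n' = n \<and> k' < 2 * r + 2 \<and> k' \<noteq> k" for j n k n' k'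
    by (rule bb(4)) (use that in \<open>auto simp: Bs_def N_def\<close>)
  \<comment> \<open>Applied with margin \<open>2 * e\<close>; since
    \<open>6 * \<eta> \<le> e\<close>, the loss \<open>2 * \<eta>\<close> leaves at least
    \<open>e\<close>.\<close>
  note sweep = sweep_extremal[OF r A_sa[rule_format] grid bb(1)[unfolded N_def] up low orth h(1,4)]
    and sweep_orth = sweep_almost_orth[OF r A_sa[rule_format] grid bb(1)[unfolded N_def] up low orth h(1,4)]
  have "diagonal_setup ci A d a b e M c s \<eta> \<theta>0 \<Lambda> L N h F"
  proof
    fix t :: real and n assume t: "t \<in> {0..1}"
    show "selfadjoint_op ci (A t)" using A_sa t by blast
    show "norm (A t) \<le> M" by (rule M(2)[OF t])
    show "a \<le> d n t" "d n t \<le> b" using d_range t by auto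
    show "orthonormal_on {i. snd i \<le> N} (\<lambda>i. h i t)" using h(1) by (simp add: N_def)
    show "cspan ((\<lambda>i. h i t) ` {i. snd i \<le> N \<and> fst i \<le> n}) = F n" using h(2) by (simp add: F_def N_def)
    show "b + e \<le> Re (ci (h (Suc n, 0) t) (A t (h (Suc n, 0) t)))"
      using sweep(1)[OF _ _ _ _ _ _ _ _ _ _ _ t, of "Suc n"] \<eta> by simp
    show "Re (ci (h (Suc n, 1) t) (A t (h (Suc n, 1) t))) \<le> a - e"
      using sweep(2)[OF _ _ _ _ _ _ _ _ _ _ _ t, of "Suc n"] \<eta> by simp
    show "\<bar>Re (ci (h (Suc n, 1) t) (A t (h (Suc n, 0) t)))\<bar> \<le> \<eta>"
      using sweep(3)[OF _ _ _ _ _ _ _ _ _ _ _ t, of "Suc n"] by simp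
    fix y assume "y \<in> F n"
    then have y: "y \<in> cspan (bb ` {i. snd i \<le> 2 * r + 2 \<and> fst i \<le> n})" by (simp add: F_def N_def)
    show "\<bar>Re (ci y (A t (h (Suc n, 0) t)))\<bar> \<le> \<eta> * norm y" "\<bar>Re (ci y (A t (h (Suc n, 1) t)))\<bar> \<le> \<eta> * norm y"
      using sweep_orth[OF _ _ _ _ _ _ _ _ _ _ _ t y] by auto
  next
    fix i :: "nat \<times> nat" and t t' assume "snd i \<le> N"
    then have "norm (h i t - h i t') \<le> \<Lambda>0 * \<bar>t - t'\<bar>" by (intro h(3)) (simp add: N_def)
    also have "\<dots> \<le> \<Lambda> * \<bar>t - t'\<bar>" by (intro mult_right_mono) (auto simp: \<Lambda>_def)
    finally show "norm (h i t - h i t') \<le> \<Lambda> * \<bar>t - t'\<bar>" .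
  next
    have "bb ` {i. snd i \<le> N} = (\<Union>n. bb ` {i. snd i \<le> N \<and> fst i \<le> n})" by auto
    moreover have "cspan (\<Union>n. bb ` {i. snd i \<le> N \<and> fst i \<le> n}) \<subseteq> (\<Union>n. F n)"
      unfolding F_def by (rule cspan_subset_UN_of_mono) auto
    ultimately show "closure (\<Union>n. F n) = UNIV" using bb(2) closure_mono by (metis top.extremum_uniqueI)
  next
    show "2 * M * c\<^sup>2 \<le> e / 4" using c by (intro sq) auto
    show "2 * M * \<theta>0\<^sup>2 \<le> e / 4" using \<theta>0(1) by (intro sq) (auto simp: \<theta>0_def)
    show "48 * M * c \<le> e / 2 * sin (2 * \<theta>0)"
      using c(4) M(1) unfolding \<kappa>_def[symmetric] by (simp add: pos_le_divide_eq mult.commute)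
    show "8 * \<eta> \<le> e * sin (2 * \<theta>0)" using \<eta>(4) by (simp add: \<kappa>_def)
    show "2 * (9 + 10 * M * \<Lambda>) / (e / 2 * sin (2 * \<theta>0)) + 2 * \<Lambda> \<le> c * L / 4"
      unfolding \<kappa>_def[symmetric] using c(1) by (simp add: L_def)
  qed (use N_def s c M(1) e(1) \<Lambda> L0 \<theta>0 \<eta> in auto)
  then show ?thesis by blast
qed

text \<open>The bound \<open>L * R\<close> is used twice: with an \<open>R\<close> that depends on
  \<open>t\<close> and sums the increments of finitely many \<open>d k\<close> for continuity, and
  with a constant \<open>R\<close> serving all \<open>d k\<close> for equicontinuity.\<close>

lemma (in diagonal_setup) continuous_diagonal_basis:
  assumes A_cont: "continuous_on {0..1} A" and d_cont: "\<forall>n. continuous_on {0..1} (d n)"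
  shows "\<exists>v. (\<forall>n. continuous_on {0..1} (v n)) \<and>
           (\<forall>t\<in>{0..1}. orthonormal_basis ci (\<lambda>n. v n t)) \<and>
           (\<forall>n. \<forall>t\<in>{0..1}. ci (v n t) (A t (v n t)) = complex_of_real (d n t)) \<and>
           (equicontinuous_on {0..1} d \<longrightarrow> equicontinuous_on {0..1} v)"
proof -
  obtain v where v: "\<And>t. t \<in> {0..1} \<Longrightarrow> orthonormal_basis ci (\<lambda>n. v n t)"
    "\<And>n t. t \<in> {0..1} \<Longrightarrow> ci (v n t) (A t (v n t)) = complex_of_real (d n t)"
    "\<And>n t t' R. modulus t t' R (Suc n) \<Longrightarrow> norm (v n t - v n t') \<le> L * R"
    using diagonal_basis_exists by blast
  have "continuous_on {0..1} (v n)" for n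
    unfolding continuous_on_def
  proof
    fix t0 :: real assume t0: "t0 \<in> {0..1}"
    define R where "R t = \<bar>t - t0\<bar> + norm (A t - A t0) + (\<Sum>k\<le>n. \<bar>d k t - d k t0\<bar>)" for t
    have "continuous_on {0..1} R" unfolding R_def
      by (intro continuous_intros A_cont d_cont[rule_format])
    then have "(R \<longlongrightarrow> R t0) (at t0 within {0..1})" using t0 by (simp add: continuous_on_def)
    moreover have "R t0 = 0" by (simp add: R_def)
    ultimately have lim: "((\<lambda>t. L * R t) \<longlongrightarrow> 0) (at t0 within {0..1})"
      by (intro tendsto_mult_right_zero) simp
    have le: "norm (v n t - v n t0) \<le> L * R t" if "t \<in> {0..1}" for t
    proof (rule v(3))
      have "\<bar>d k t - d k t0\<bar> \<le> (\<Sum>k\<le>n. \<bar>d k t - d k t0\<bar>)" if "k < Suc n" for k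
        using that by (intro member_le_sum) auto
      moreover have "0 \<le> (\<Sum>k\<le>n. \<bar>d k t - d k t0\<bar>)" by (simp add: sum_nonneg)
      ultimately show "modulus t t0 (R t) (Suc n)"
        unfolding modulus_def R_def using that t0 by (auto intro: add_increasing)
    qed
    have "\<forall>\<^sub>F t in at t0 within {0..1}. norm (v n t - v n t0) \<le> L * R t"
      unfolding eventually_at_filter by (intro always_eventually) (use le in blast)
    then have "((\<lambda>t. v n t - v n t0) \<longlongrightarrow> 0) (at t0 within {0..1})" by (rule Lim_null_comparison[OF _ lim])
    then show "(v n \<longlongrightarrow> v n t0) (at t0 within {0..1})" by (rule LIM_zero_cancel)
  qed
  moreover have "equicontinuous_on {0..1} v" if eq: "equicontinuous_on {0..1} d"
  proof (rule equicontinuous_onI)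
    fix n and t t' :: real assume t: "t \<in> {0..1}" "t' \<in> {0..1}"
    have "norm (v n t) = 1" "norm (v n t') = 1"
      using v(1)[OF t(1)] v(1)[OF t(2)] by (simp_all add: orthonormal_basis_def norm_eq_1_iff)
    then show "norm (v n t - v n t') \<le> 2" using norm_triangle_ineq4[of "v n t" "v n t'"] by simp
  next
    fix \<epsilon> :: real assume \<epsilon>: "\<epsilon> > 0"
    obtain \<delta> where \<delta>: "\<delta> 0 = 0" "(\<delta> \<longlongrightarrow> 0) (at_right 0)"
      "\<And>n t t'. t \<in> {0..1} \<Longrightarrow> t' \<in> {0..1} \<Longrightarrow> norm (d n t - d n t') \<le> \<delta> \<bar>t - t'\<bar>"
      using eq unfolding equicontinuous_on_def by blast
    \<comment> \<open>The summand 1 avoids a division by zero for \<open>L = 0\<close>.\<close>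
    define R where "R = \<epsilon> / (L + 1)"
    have R: "R > 0" "L * R \<le> \<epsilon>" using \<epsilon> L by (auto simp: R_def field_simps)
    have "uniformly_continuous_on {0..1} A" by (rule compact_uniformly_continuous[OF A_cont]) simp
    then obtain \<rho>1 where \<rho>1: "\<rho>1 > 0"
      "\<And>t t'. t \<in> {0..1} \<Longrightarrow> t' \<in> {0..1} \<Longrightarrow> dist t' t < \<rho>1 \<Longrightarrow> dist (A t') (A t) < R"
      unfolding uniformly_continuous_on_def using R(1) by metis
    have "\<forall>\<^sub>F x in at_right 0. \<delta> x < R" using \<delta>(2) R(1) by (rule order_tendstoD)
    then obtain \<rho>2 where \<rho>2: "\<rho>2 > 0" "\<And>x. 0 < x \<Longrightarrow> x < \<rho>2 \<Longrightarrow> \<delta> x < R"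
      unfolding eventually_at_right_field by blast
    have "norm (v n t - v n t') \<le> \<epsilon>"
      if "t \<in> {0..1}" "t' \<in> {0..1}" "\<bar>t - t'\<bar> < min R (min \<rho>1 \<rho>2)" for n t t'
    proof -
      have "\<delta> \<bar>t - t'\<bar> \<le> R"
        using \<rho>2(2)[of "\<bar>t - t'\<bar>"] that(3) \<delta>(1) R(1) by (cases "t = t'") auto
      then have "\<bar>d k t - d k t'\<bar> \<le> R" for k using \<delta>(3)[OF that(1,2), of k] by simp
      moreover have "norm (A t - A t') \<le> R"
        using \<rho>1(2)[OF that(2,1)] that(3) by (simp add: dist_real_def dist_norm)
      ultimately have "modulus t t' R (Suc n)" using that by (simp add: modulus_def)
      then show ?thesis using v(3)[of t t' R n] R(2) by linarith
    qed
    then show "\<exists>\<rho>>0. \<forall>n. \<forall>t\<in>{0..1}. \<forall>t'\<in>{0..1}. \<bar>t - t'\<bar> < \<rho> \<longrightarrow> norm (v n t - v n t') \<le> \<epsilon>"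
      using R(1) \<rho>1(1) \<rho>2(1) by (intro exI[of _ "min R (min \<rho>1 \<rho>2)"]) auto
  qed simp
  ultimately show ?thesis using v(1,2) by blast
qed

theorem theorem7p6:
  fixes ci :: "'h::{complex_normed_vector, banach} \<Rightarrow> 'h \<Rightarrow> complex"
    and A :: "real \<Rightarrow> ('h \<Rightarrow>\<^sub>L 'h)"
    and d :: "nat \<Rightarrow> real \<Rightarrow> real"
    and a b :: real
  assumes hilbert: "complex_inner_product ci"
    and separable: "separable_space TYPE('h)"
    and infdim: "\<not> cfinite_dim (UNIV :: 'h set)"
    and A_cont: "continuous_on {0..1} A"
    and A_lin: "\<forall>t\<in>{0..1}. clinear_op (blinfun_apply (A t))"
    and A_sa: "\<forall>t\<in>{0..1}. selfadjoint_op ci (blinfun_apply (A t))"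
    and d_cont: "\<forall>n. continuous_on {0..1} (d n)"
    and d_range: "\<forall>n. \<forall>t\<in>{0..1}. d n t \<in> {a..b}"
    and ab: "\<forall>t\<in>{0..1}. {a..b} \<subseteq>
               interior (convex hull {r::real. complex_of_real r \<in> essential_spectrum (blinfun_apply (A t))})"
  shows "\<exists>v :: nat \<Rightarrow> real \<Rightarrow> 'h.
           (\<forall>n. continuous_on {0..1} (v n)) \<and>
           (\<forall>t\<in>{0..1}. orthonormal_basis ci (\<lambda>n. v n t)) \<and>
           (\<forall>n. \<forall>t\<in>{0..1}. ci (v n t) (A t (v n t)) = complex_of_real (d n t)) \<and>
           (equicontinuous_on {0..1} d \<longrightarrow> equicontinuous_on {0..1} v)"
proof -
  interpret hilbert_ip ci by unfold_locales (rule hilbert)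
  obtain e M c s \<eta> \<theta>0 \<Lambda> L N h F where "diagonal_setup ci A d a b e M c s \<eta> \<theta>0 \<Lambda> L N h F"
    using diagonal_setup_exists[OF separable infdim A_cont A_lin A_sa d_range ab] by blast
  then interpret diagonal_setup ci A d a b e M c s \<eta> \<theta>0 \<Lambda> L N h F .
  show ?thesis by (rule continuous_diagonal_basis[OF A_cont d_cont])
qed

end
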